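(* Let $a,b,c,e$ be positive integers and $\mu:=((a+b+c+e)^a,(a+b+c)^b,(a+b)^c,a^e)$, a partition of $n-1:=a(a+b+c+e)+b(a+b+c)+c(a+b)+ea$. Then $\mu$ is an isoclinic partition if and only if $e=\frac{b^2}{c}+b$.
   Context: Notation $(l_1^{a_1},\dots)$ means $l_1$ repeated $a_1$ times, etc. For $\lambda\vdash n$, $\operatorname{Tab}(\lambda)$ is the set of standard Young tableaux, $d_\lambda=|\operatorname{Tab}(\lambda)|$, $V_\lambda$ the real Hilbert space with orthonormal basis $\{v_T\}$, and $\pi_\lambda\colon S_n\to\operatorname{U}(V_\lambda)$ Young's orthogonal form, $\pi_\lambda(s_k)v_T=\frac1{D_T(k+1,k)}v_T+\sqrt{1-\frac1{D_T(k+1,k)^2}}v_{s_kT}$, where $s_k=(k\ k{+}1)$ acts on entries, and $D_T(a,b)=(j-i)-(j'-i')$ for $a$ in box $(i,j)$, $b$ in box $(i',j')$ (second term absent if $s_kT$ not standard). For $\mu\vdash n-1$, $\mu^\uparrow$ is the set of $\lambda\vdash n$ obtained by adding one box to $\mu$'s Young diagram; for $R\in\operatorname{Tab}(\mu)$, $R^\lambda$ places $n$ in the added box; $\Psi_{\lambda,\mu}v_R=v_{R^\lambda}$. For $L\subseteq\mu^\uparrow$: $V_L=\bigoplus_{\lambda\in L}V_\lambda$, $\pi_L=\bigoplus\pi_\lambda$, $d_L=\sum d_\lambda$, $W_L=\operatorname{im}\Psi_L$ where $\Psi_L(v)=\{\sqrt{d_\lambda/d_L}\Psi_{\lambda,\mu}v\}_{\lambda\in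 L}$, and $\mathcal{W}_L=\{\pi_L(t_k)W_L\}_{k\in[n]}$ for $t_k\in S_n$ with $t_k(n)=k$. $\mu$ is isoclinic if there is a nonempty proper $L\subset\mu^\uparrow$ such that $\mathcal{W}_L$ is equi-isoclinic: for isometries $\Phi_k$ onto its members there is $\alpha$ with $(\Phi_k^*\Phi_\ell)^*(\Phi_k^*\Phi_\ell)=\alpha I$ for all $k\ne\ell$. *)

theory Defs
  imports Complex_Main "HOL-Combinatorics.Permutations"
begin

section \<open>Real Hilbert spaces with an orthonormal basis indexed by a finite set\<close>

text \<open>The Hilbert space with orthonormal basis indexed by a finite set \<open>I\<close> is the space of
  coordinate functions vanishing off \<open>I\<close>. Operators are total functions of which only the
  restriction to the relevant space is meaningful.\<close>

definition hspace :: "'i set \<Rightarrow> ('i \<Rightarrow> real) set" where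
  "hspace I = {x. \<forall>i. i \<notin> I \<longrightarrow> x i = 0}"

definition basis_vec :: "'i \<Rightarrow> 'i \<Rightarrow> real" where
  "basis_vec i = (\<lambda>j. if j = i then 1 else 0)"

definition iprod :: "'i set \<Rightarrow> ('i \<Rightarrow> real) \<Rightarrow> ('i \<Rightarrow> real) \<Rightarrow> real" where
  "iprod I x y = (\<Sum>i\<in>I. x i * y i)"

definition lin_op :: "'i set \<Rightarrow> 'j set \<Rightarrow> (('i \<Rightarrow> real) \<Rightarrow> ('j \<Rightarrow> real)) \<Rightarrow> bool" where
  "lin_op I J f \<longleftrightarrow>
     (\<forall>x \<in> hspace I. f x \<in> hspace J) \<and>
     (\<forall>x \<in> hspace I. \<forall>y \<in> hspace I. f (\<lambda>i. x i + y i) = (\<lambda>j. f x j + f y j)) \<and>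
     (\<forall>r. \<forall>x \<in> hspace I. f (\<lambda>i. r * x i) = (\<lambda>j. r * f x j))"

definition isometry_op :: "'i set \<Rightarrow> 'j set \<Rightarrow> (('i \<Rightarrow> real) \<Rightarrow> ('j \<Rightarrow> real)) \<Rightarrow> bool" where
  "isometry_op I J f \<longleftrightarrow>
     lin_op I J f \<and> (\<forall>x \<in> hspace I. \<forall>y \<in> hspace I. iprod J (f x) (f y) = iprod I x y)"

definition unitary_op :: "'i set \<Rightarrow> (('i \<Rightarrow> real) \<Rightarrow> ('i \<Rightarrow> real)) \<Rightarrow> bool" where
  "unitary_op I f \<longleftrightarrow> isometry_op I I f \<and> f ` hspace I = hspace I"

definition adj_op ::
    "'i set \<Rightarrow> 'j set \<Rightarrow> (('i \<Rightarrow> real) \<Rightarrow> ('j \<Rightarrow> real)) \<Rightarrow> ('j \<Rightarrow> real) \<Rightarrow> ('i \<Rightarrow> real)" where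
  "adj_op I J f y = (\<lambda>i. if i \<in> I then iprod J (f (basis_vec i)) y else 0)"

lemma iprod_adj_op:
  assumes "finite I" "lin_op I J f" "x \<in> hspace I"
  shows "iprod J (f x) y = iprod I x (adj_op I J f y)"
proof -
  have add: "f (\<lambda>i. u i + v i) = (\<lambda>j. f u j + f v j)" if "u \<in> hspace I" "v \<in> hspace I" for u v
    using assms(2) that unfolding lin_op_def by simp
  have scale: "f (\<lambda>i. r * u i) = (\<lambda>j. r * f u j)" if "u \<in> hspace I" for r u
    using assms(2) that unfolding lin_op_def by simp
  have *: "f (\<lambda>i. if i \<in> A then x i else 0) = (\<lambda>j. \<Sum>i\<in>A. x i * f (basis_vec i) j)"
    if "finite A" "A \<subseteq> I" for A
    using that
  proof (induction A rule: finite_induct)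
    case empty
    have "f (\<lambda>i. 0 * (\<lambda>_. 0) i) = (\<lambda>j. 0 * f (\<lambda>_. 0) j)"
      by (rule scale) (simp add: hspace_def)
    then show ?case by simp
  next
    case (insert a A)
    have b: "basis_vec a \<in> hspace I"
      using insert.prems by (auto simp: hspace_def basis_vec_def)
    then have c: "f (\<lambda>i. x a * basis_vec a i) = (\<lambda>j. x a * f (basis_vec a) j)"
      by (rule scale)
    have "(\<lambda>i. x a * basis_vec a i) \<in> hspace I" "(\<lambda>i. if i \<in> A then x i else 0) \<in> hspace I"
      using insert.prems b by (auto simp: hspace_def)
    then have "f (\<lambda>i. x a * basis_vec a i + (if i \<in> A then x i else 0)) =
        (\<lambda>j. f (\<lambda>i. x a * basis_vec a i) j + f (\<lambda>i. if i \<in> A then x i else 0) j)"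
      by (rule add)
    moreover have "(\<lambda>i. x a * basis_vec a i + (if i \<in> A then x i else 0)) =
        (\<lambda>i. if i \<in> insert a A then x i else 0)"
      using insert.hyps by (auto simp: basis_vec_def fun_eq_iff)
    ultimately show ?case
      using insert c by simp
  qed
  have "(\<lambda>i. if i \<in> I then x i else 0) = x"
    using assms(3) by (auto simp: hspace_def fun_eq_iff)
  then have "f x = (\<lambda>j. \<Sum>i\<in>I. x i * f (basis_vec i) j)"
    using *[OF assms(1) subset_refl] by simp
  then have "iprod J (f x) y = (\<Sum>j\<in>J. \<Sum>i\<in>I. x i * (f (basis_vec i) j * y j))"
    by (simp add: iprod_def sum_distrib_right mult.assoc)
  also have "\<dots> = (\<Sum>i\<in>I. \<Sum>j\<in>J. x i * (f (basis_vec i) j * y j))"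
    by (rule sum.swap)
  also have "\<dots> = iprod I x (adj_op I J f y)"
    by (simp add: iprod_def adj_op_def sum_distrib_left)
  finally show ?thesis .
qed

text \<open>The isometries onto the members \<open>W k\<close> have a common domain \<open>\<real>\<^sup>d\<close>. Another choice of
  isometries replaces \<open>\<Phi> k\<close> by \<open>\<Phi> k \<circ> U k\<close> with \<open>U k\<close> unitary, which does not affect the
  condition.\<close>

definition equi_isoclinic :: "'k set \<Rightarrow> 'j set \<Rightarrow> ('k \<Rightarrow> ('j \<Rightarrow> real) set) \<Rightarrow> bool" where
  "equi_isoclinic K J W \<longleftrightarrow>
     (\<exists>(d::nat) \<Phi> \<alpha>.
        (\<forall>k\<in>K. isometry_op {..<d} J (\<Phi> k) \<and> \<Phi> k ` hspace {..<d} = W k) \<and>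
        (\<forall>k\<in>K. \<forall>l\<in>K. k \<noteq> l \<longrightarrow>
           (let A = adj_op {..<d} J (\<Phi> k) \<circ> \<Phi> l in
              \<forall>x \<in> hspace {..<d}. adj_op {..<d} {..<d} A (A x) = (\<lambda>i. \<alpha> * x i))))"


section \<open>Partitions and standard Young tableaux\<close>

definition partition_of :: "nat list \<Rightarrow> nat \<Rightarrow> bool" where
  "partition_of lam n \<longleftrightarrow> sorted_wrt (\<ge>) lam \<and> 0 \<notin> set lam \<and> sum_list lam = n"

text \<open>Boxes are (row, column), counted from 0; only differences of \<open>column - row\<close> are used.\<close>

definition boxes :: "nat list \<Rightarrow> (nat \<times> nat) set" where
  "boxes lam = {(i, j). i < length lam \<and> j < lam ! i}"

text \<open>A tableau is its filling of the boxes, extended by 0 outside the diagram; hence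
  permutations of \<open>{1..n}\<close> act on tableaux by composition.\<close>

type_synonym tableau = "nat \<times> nat \<Rightarrow> nat"

definition Tab :: "nat list \<Rightarrow> tableau set" where
  "Tab lam = {T.
     bij_betw T (boxes lam) {1..sum_list lam} \<and>
     (\<forall>p. p \<notin> boxes lam \<longrightarrow> T p = 0) \<and>
     (\<forall>i j j'. j < j' \<and> (i, j') \<in> boxes lam \<longrightarrow> T (i, j) < T (i, j')) \<and>
     (\<forall>i i' j. i < i' \<and> (i', j) \<in> boxes lam \<longrightarrow> T (i, j) < T (i', j))}"

definition dim :: "nat list \<Rightarrow> nat" where
  "dim lam = card (Tab lam)"

definition content_at :: "nat list \<Rightarrow> tableau \<Rightarrow> nat \<Rightarrow> int" where
  "content_at lam T a = (let (i, j) = inv_into (boxes lam) T a in int j - int i)"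

definition axial_dist :: "nat list \<Rightarrow> tableau \<Rightarrow> nat \<Rightarrow> nat \<Rightarrow> int" where
  "axial_dist lam T a b = content_at lam T a - content_at lam T b"


section \<open>Young's orthogonal form\<close>

abbreviation adj_transp :: "nat \<Rightarrow> nat \<Rightarrow> nat" where
  "adj_transp k \<equiv> Transposition.transpose k (k + 1)"

definition is_young_orthogonal_form ::
    "nat list \<Rightarrow> ((nat \<Rightarrow> nat) \<Rightarrow> (tableau \<Rightarrow> real) \<Rightarrow> (tableau \<Rightarrow> real)) \<Rightarrow> bool" where
  "is_young_orthogonal_form lam \<pi> \<longleftrightarrow>
     (\<forall>\<sigma>. \<sigma> permutes {1..sum_list lam} \<longrightarrow> unitary_op (Tab lam) (\<pi> \<sigma>)) \<and>
     (\<forall>\<sigma> \<tau>. \<sigma> permutes {1..sum_list lam} \<and> \<tau> permutes {1..sum_list lam} \<longrightarrow>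
        (\<forall>x \<in> hspace (Tab lam). \<pi> (\<sigma> \<circ> \<tau>) x = \<pi> \<sigma> (\<pi> \<tau> x))) \<and>
     (\<forall>k \<in> {1..<sum_list lam}. \<forall>T \<in> Tab lam.
        \<pi> (adj_transp k) (basis_vec T) =
          (let D = real_of_int (axial_dist lam T (k + 1) k); T' = adj_transp k \<circ> T in
             (\<lambda>S. 1 / D * basis_vec T S +
                (if T' \<in> Tab lam then sqrt (1 - 1 / D\<^sup>2) * basis_vec T' S else 0))))"

text \<open>Since the adjacent transpositions generate the symmetric group, the operators
  \<open>\<pi> \<sigma>\<close> are determined on \<open>hspace (Tab lam)\<close> for every permutation \<open>\<sigma>\<close> of \<open>{1..n}\<close>; the choice
  only concerns irrelevant values.\<close>

definition young_rep :: "nat list \<Rightarrow> (nat \<Rightarrow> nat) \<Rightarrow> (tableau \<Rightarrow> real) \<Rightarrow> (tableau \<Rightarrow> real)" where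
  "young_rep lam = (SOME \<pi>. is_young_orthogonal_form lam \<pi>)"


section \<open>Isoclinic partitions\<close>

definition up :: "nat list \<Rightarrow> nat list set" where
  "up mu = {lam. partition_of lam (sum_list mu + 1) \<and>
                 (\<exists>p. p \<notin> boxes mu \<and> boxes lam = insert p (boxes mu))}"

definition extend_tab :: "nat list \<Rightarrow> nat list \<Rightarrow> tableau \<Rightarrow> tableau" where
  "extend_tab lam mu R = (\<lambda>p. if p \<in> boxes lam - boxes mu then sum_list lam else R p)"

definition Psi :: "nat list \<Rightarrow> nat list \<Rightarrow> (tableau \<Rightarrow> real) \<Rightarrow> (tableau \<Rightarrow> real)" where
  "Psi lam mu v = (\<lambda>T. \<Sum>R\<in>Tab mu. v R * basis_vec (extend_tab lam mu R) T)"

text \<open>The direct sum over \<open>L\<close> has its orthonormal basis indexed by \<open>Sigma L Tab\<close>; the component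
  of \<open>x\<close> at \<open>lam\<close> is \<open>\<lambda>T. x (lam, T)\<close>.\<close>

definition dim_sum :: "nat list set \<Rightarrow> nat" where
  "dim_sum L = (\<Sum>lam\<in>L. dim lam)"

definition young_rep_sum ::
    "nat list set \<Rightarrow> (nat \<Rightarrow> nat) \<Rightarrow> (nat list \<times> tableau \<Rightarrow> real) \<Rightarrow> (nat list \<times> tableau \<Rightarrow> real)"
where
  "young_rep_sum L \<sigma> x =
     (\<lambda>(lam, T). if lam \<in> L then young_rep lam \<sigma> (\<lambda>S. x (lam, S)) T else 0)"

definition Psi_sum ::
    "nat list set \<Rightarrow> nat list \<Rightarrow> (tableau \<Rightarrow> real) \<Rightarrow> (nat list \<times> tableau \<Rightarrow> real)" where
  "Psi_sum L mu v =
     (\<lambda>(lam, T). if lam \<in> L then sqrt (real (dim lam) / real (dim_sum L)) * Psi lam mu v T else 0)"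

definition W_space :: "nat list set \<Rightarrow> nat list \<Rightarrow> (nat list \<times> tableau \<Rightarrow> real) set" where
  "W_space L mu = Psi_sum L mu ` hspace (Tab mu)"

text \<open>The member with index \<open>k\<close> does not depend on the choice of \<open>t k\<close>, because \<open>W_space L mu\<close> is
  invariant under the stabiliser of \<open>n\<close>.\<close>

definition isoclinic_partition :: "nat list \<Rightarrow> bool" where
  "isoclinic_partition mu \<longleftrightarrow>
     partition_of mu (sum_list mu) \<and>
     (let n = sum_list mu + 1 in
       \<exists>L. L \<noteq> {} \<and> L \<subset> up mu \<and>
         (\<forall>t. (\<forall>k\<in>{1..n}. t k permutes {1..n} \<and> t k n = k) \<longrightarrow>
            equi_isoclinic {1..n} (Sigma L Tab) (\<lambda>k. young_rep_sum L (t k) ` W_space L mu)))"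

lemma partition_of_block_partition:
  assumes "a > 0" "b > 0" "c > 0" "e > 0"
  shows "partition_of (replicate a (a + b + c + e) @ replicate b (a + b + c) @ replicate c (a + b) @ replicate e a)
           (a * (a + b + c + e) + b * (a + b + c) + c * (a + b) + e * a)"
proof -
  have rep: "sorted_wrt (\<ge>) (replicate m (x::nat))" for m x
    by (induction m) auto
  have sum: "sum_list (replicate m (x::nat)) = m * x" for m x
    by (simp add: sum_list_replicate)
  show ?thesis
    using assms unfolding partition_of_def sorted_wrt_append
    by (auto simp: rep sum)
qed

end

theory Submission
  imports Defs
begin

text \<open>Let \<open>\<mu>\<close> be a partition of \<open>n - 1\<close>. Since \<open>\<Psi>\<^sub>L\<close> intertwines the representations of \<open>S\<^sub>n\<^sub>-\<^sub>1\<close>, and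
  every permutation moving \<open>n\<close> lies in the double coset of \<open>s\<^sub>n\<^sub>-\<^sub>1\<close>, equi-isoclinicity only depends
  on the compression of \<open>\<pi>\<^sub>L(s\<^sub>n\<^sub>-\<^sub>1)\<close> to \<open>W\<^sub>L\<close>. By Young's orthogonal form this operator is diagonal:
  its eigenvalue at a tableau with \<open>n - 1\<close> in a corner of content \<open>y\<close> is
  \<open>f\<^sub>L(y) = \<Sum> d\<^sub>\<lambda> / (d\<^sub>L (x\<^sub>\<lambda> - y))\<close>, summed over \<open>\<lambda> \<in> L\<close>, where \<open>x\<^sub>\<lambda>\<close> is the content of the added
  box. So \<open>L\<close> works iff \<open>|f\<^sub>L|\<close> is constant on the corner contents.

  The Frobenius formula for \<open>d\<^sub>\<lambda>\<close> and partial fractions give Kerov's equations: for the full set of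
  \<open>\<lambda>\<close> the function vanishes at every corner content. Hence \<open>L\<close> may be replaced by its complement, and
  the weights \<open>d\<^sub>\<lambda>\<close> of the four-block partition, whose contents are symmetric about 0, are symmetric.
  With added contents \<open>\<pm>X, \<pm>x, 0\<close> and corner contents \<open>\<pm>Y, \<pm>y\<close>, where \<open>X > Y > x > y > 0\<close>,
  monotonicity of \<open>f\<^sub>L\<close> between its poles and Kerov's equations exclude every \<open>L\<close> not containing 0 except \<open>{x, -x}\<close>,
  for which the condition reads \<open>x\<^sup>2 = y Y\<close>, that is \<open>(b + c)\<^sup>2 = c (b + c + e)\<close>.\<close>

section \<open>Extending Coxeter relations to the symmetric group\<close>

text \<open>\<open>young_rep\<close> is a Hilbert choice among all maps satisfying Young's formula,
  so nothing can be said about it before one such representation has been constructed. The operators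
  attached to adjacent transpositions are explicit; the obstacle is to extend them consistently to
  all permutations. This is the purpose of solving the word problem of the symmetric group below.
  The relations are relative to a carrier \<open>X\<close> because operators are total functions
  that are meaningful only on \<open>hspace\<close>.

  A second obstacle is that \<open>equi_isoclinic\<close> allows arbitrary isometries from a space
  of unspecified dimension. In the forward direction the condition is therefore read as one on
  squared norms of orthogonal projections, which depend on the images only.

  The numbers of tableaux enter the final argument through their positivity and Kerov's equations
  alone. Each such equation is the difference of two values of one partial fraction expansion, taken
  at two zeros of the expanded product.\<close>

definition coxeter_ops :: "nat \<Rightarrow> (nat \<Rightarrow> 'x \<Rightarrow> 'x) \<Rightarrow> 'x set \<Rightarrow> bool" where
  "coxeter_ops n A X \<longleftrightarrow>
     (\<forall>k\<in>{1..<n}. \<forall>x\<in>X. A k x \<in> X \<and> A k (A k x) = x) \<and>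
     (\<forall>k\<in>{1..<n}. \<forall>l\<in>{1..<n}. k + 1 < l \<longrightarrow> (\<forall>x\<in>X. A k (A l x) = A l (A k x))) \<and>
     (\<forall>k\<ge>1. k + 1 < n \<longrightarrow>
        (\<forall>x\<in>X. A k (A (k + 1) (A k x)) = A (k + 1) (A k (A (k + 1) x))))"

lemma coxeter_opsD:
  assumes "coxeter_ops n A X"
  shows "\<And>k x. 1 \<le> k \<Longrightarrow> k < n \<Longrightarrow> x \<in> X \<Longrightarrow> A k x \<in> X"
    and "\<And>k x. 1 \<le> k \<Longrightarrow> k < n \<Longrightarrow> x \<in> X \<Longrightarrow> A k (A k x) = x"
    and "\<And>k l x. 1 \<le> k \<Longrightarrow> k < n \<Longrightarrow> 1 \<le> l \<Longrightarrow> l < n \<Longrightarrow> k + 1 < l \<or> l + 1 < k \<Longrightarrow>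
           x \<in> X \<Longrightarrow> A k (A l x) = A l (A k x)"
    and "\<And>k x. 1 \<le> k \<Longrightarrow> k + 1 < n \<Longrightarrow> x \<in> X \<Longrightarrow>
           A k (A (k + 1) (A k x)) = A (k + 1) (A k (A (k + 1) x))"
  using assms unfolding coxeter_ops_def
  by (simp, simp, metis atLeastLessThan_iff, simp)

lemma coxeter_ops_mono: "coxeter_ops n A X \<Longrightarrow> m \<le> n \<Longrightarrow> coxeter_ops m A X"
  unfolding coxeter_ops_def by (meson atLeastLessThan_iff order_less_le_trans)

lemma coxeter_ops_word_closed:
  assumes "coxeter_ops n A X" "set w \<subseteq> {1..<n}" "x \<in> X"
  shows "foldr A w x \<in> X"
  using assms(2) by (induction w) (use coxeter_opsD(1)[OF assms(1)] assms(3) in auto)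

lemma coxeter_ops_commute_word:
  assumes "coxeter_ops n A X" "k \<in> {1..<n}" "set w \<subseteq> {1..<n}"
    and "\<forall>l\<in>set w. l + 1 < k \<or> k + 1 < l" "x \<in> X"
  shows "A k (foldr A w x) = foldr A w (A k x)"
  using assms(3,4)
proof (induction w)
  case Nil
  then show ?case by simp
next
  case (Cons l w)
  let ?y = "foldr A w x"
  have y: "?y \<in> X"
    using coxeter_ops_word_closed[OF assms(1) _ assms(5)] Cons.prems by simp
  have "A k (A l ?y) = A l (A k ?y)"
    by (rule coxeter_opsD(3)[OF assms(1)]) (use assms(2) Cons.prems y in auto)
  then show ?case using Cons by simp
qed

text \<open>The word \<open>[j..<n]\<close> represents the coset that sends n to j. Multiplication
  by s_k on the left moves this coset just as s_k moves the point j. If j is fixed, a generator of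
  the smaller group emerges on the right: s_k itself if it commutes with the whole word, and s_(k-1)
  if it has to cross the word by a braid relation.\<close>

lemma coxeter_ops_push:
  assumes A: "coxeter_ops n A X" and k: "k \<in> {1..<n}" and j: "j \<in> {1..n}" and x: "x \<in> X"
  shows "A k (foldr A [j..<n] x) =
    foldr A [if k + 1 = j then k else if k = j then j + 1 else j..<n]
      (foldr A (if k + 1 < j then [k] else if k > j then [k - 1] else []) x)"
proof -
  consider "k + 1 < j" | "k + 1 = j" | "k = j" | "j < k" by linarith
  then show ?thesis
  proof cases
    case 1
    then show ?thesis
      using coxeter_ops_commute_word[OF A k, of "[j..<n]" x] x j k by auto
  next
    case 2
    then show ?thesis using k by (simp add: upt_conv_Cons)
  next
    case 3
    have "foldr A [j + 1..<n] x \<in> X"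
      using coxeter_ops_word_closed[OF A _ x, of "[j+1..<n]"] j by auto
    then show ?thesis
      using 3 k coxeter_opsD(2)[OF A, of j] by (simp add: upt_conv_Cons)
  next
    case 4
    define z where "z = foldr A [k + 1..<n] x"
    have z: "z \<in> X"
      unfolding z_def by (rule coxeter_ops_word_closed[OF A _ x]) (use k in auto)
    \<comment> \<open>The two letters k - 1 and k are isolated so that s_k s_(k-1) s_k can become
      s_(k-1) s_k s_(k-1); the last factor then commutes with every letter of the tail.\<close>
    have split: "[j..<n] = [j..<k - 1] @ [k - 1, k] @ [k + 1..<n]"
    proof -
      have "[j..<n] = [j..<k - 1] @ [k - 1..<n]"
        using upt_add_eq_append[of j "k - 1" "n - (k - 1)"] 4 k by simp
      also have "[k - 1..<n] = (k - 1) # [k..<n]"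
        using upt_conv_Cons[of "k - 1" n] 4 k by simp
      also have "[k..<n] = k # [k + 1..<n]"
        using upt_conv_Cons[of k n] k by simp
      finally show ?thesis by simp
    qed
    have z1: "A (k - 1) (A k z) \<in> X"
      by (intro coxeter_opsD(1)[OF A]) (use k 4 z j in auto)
    have "A k (foldr A [j..<n] x) = A k (foldr A [j..<k - 1] (A (k - 1) (A k z)))"
      unfolding split z_def by simp
    also have "\<dots> = foldr A [j..<k - 1] (A k (A (k - 1) (A k z)))"
      by (rule coxeter_ops_commute_word[OF A k _ _ z1]) (use j k in auto)
    also have "A k (A (k - 1) (A k z)) = A (k - 1) (A k (A (k - 1) z))"
      using coxeter_opsD(4)[OF A, of "k - 1" z] 4 j k z by simp
    also have "A (k - 1) z = foldr A [k + 1..<n] (A (k - 1) x)"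
      unfolding z_def
      by (rule coxeter_ops_commute_word[OF A _ _ _ x]) (use 4 j k in auto)
    also have "foldr A [j..<k - 1] (A (k - 1) (A k (foldr A [k + 1..<n] (A (k - 1) x)))) =
        foldr A [j..<n] (A (k - 1) x)"
      unfolding split by simp
    finally show ?thesis using 4 by simp
  qed
qed

text \<open>Coset representatives of \<open>S\<^sub>n\<^sub>-\<^sub>1\<close> in \<open>S\<^sub>n\<close>: every word is \<open>s\<^sub>j \<dots> s\<^sub>n\<^sub>-\<^sub>1\<close> times a word in
  the generators of \<open>S\<^sub>n\<^sub>-\<^sub>1\<close>. The same rewriting is performed in two systems at once.\<close>

lemma coxeter_ops_normal_form:
  assumes A: "coxeter_ops n A X" and B: "coxeter_ops n B Y" and n: "n \<ge> 1"
    and w: "set w \<subseteq> {1..<n}"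
  shows "\<exists>j\<in>{1..n}. \<exists>w'. set w' \<subseteq> {1..<n - 1} \<and>
    (\<forall>x\<in>X. foldr A w x = foldr A [j..<n] (foldr A w' x)) \<and>
    (\<forall>y\<in>Y. foldr B w y = foldr B [j..<n] (foldr B w' y))"
  using w
proof (induction w)
  case Nil
  show ?case using n by (intro bexI[of _ n] exI[of _ "[]"]) auto
next
  case (Cons k w)
  then obtain j w' where j: "j \<in> {1..n}" and w': "set w' \<subseteq> {1..<n - 1}"
    and eA: "\<forall>x\<in>X. foldr A w x = foldr A [j..<n] (foldr A w' x)"
    and eB: "\<forall>y\<in>Y. foldr B w y = foldr B [j..<n] (foldr B w' y)"
    by auto
  have k: "k \<in> {1..<n}" using Cons.prems by simp
  define j' where "j' = (if k + 1 = j then k else if k = j then j + 1 else j)"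
  define u where "u = (if k + 1 < j then [k] else if k > j then [k - 1] else [])"
  have w'n: "set w' \<subseteq> {1..<n}" using w' by fastforce
  have "foldr A (k # w) x = foldr A [j'..<n] (foldr A (u @ w') x)" if "x \<in> X" for x
    using coxeter_ops_push[OF A k j coxeter_ops_word_closed[OF A w'n that]] eA that
    unfolding j'_def u_def by simp
  moreover have "foldr B (k # w) y = foldr B [j'..<n] (foldr B (u @ w') y)" if "y \<in> Y" for y
    using coxeter_ops_push[OF B k j coxeter_ops_word_closed[OF B w'n that]] eB that
    unfolding j'_def u_def by simp
  moreover have "j' \<in> {1..n}" "set (u @ w') \<subseteq> {1..<n - 1}"
    using j k w' unfolding j'_def u_def by auto
  ultimately show ?case by blast
qed

section \<open>Words in adjacent transpositions and the word problem\<close>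

lemma coxeter_ops_adj_transp: "coxeter_ops n adj_transp UNIV"
  unfolding coxeter_ops_def by (auto simp: transpose_def)

lemma adj_word_permutes: "set w \<subseteq> {1..<n} \<Longrightarrow> foldr adj_transp w permutes {1..n}"
proof (induction w)
  case Nil
  then show ?case by (simp add: permutes_def)
next
  case (Cons k w)
  have "adj_transp k permutes {1..n}"
    using Cons.prems by (intro permutes_swap_id) auto
  moreover have "foldr adj_transp w permutes {1..n}" using Cons by simp
  ultimately have "adj_transp k \<circ> foldr adj_transp w permutes {1..n}"
    by (intro permutes_compose)
  then show ?case by (simp add: comp_def)
qed

text \<open>\<open>foldr\<close> applies the last letter first, so n descends one step per letter
  until it reaches j.\<close>

lemma adj_word_last: "j \<le> n \<Longrightarrow> foldr adj_transp [j..<n] n = j"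
proof (induction "n - j" arbitrary: j)
  case 0
  then show ?case by simp
next
  case (Suc d)
  then have "foldr adj_transp [Suc j..<n] n = Suc j" by simp
  then show ?case using Suc by (simp add: upt_conv_Cons)
qed

lemma adj_word_fixes: "set w \<subseteq> {1..<n - 1} \<Longrightarrow> foldr adj_transp w n = n"
  by (induction w) (auto simp: transpose_def)

text \<open>This is the Coxeter presentation of the symmetric group. The normal form is computed in
  \<open>A\<close> and in the permutations simultaneously. The image of the last point reveals the
  coset representative, which cancels by injectivity, and the remaining words belong to the next
  smaller group.\<close>

lemma coxeter_ops_words_eq:
  assumes "coxeter_ops n A X" "set w \<subseteq> {1..<n}" "set v \<subseteq> {1..<n}"
    and "foldr adj_transp w = foldr adj_transp v" "x \<in> X"
  shows "foldr A w x = foldr A v x"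
  using assms
proof (induction n arbitrary: w v)
  case 0
  then show ?case by simp
next
  case (Suc n)
  obtain j w' where j: "j \<in> {1..Suc n}" "set w' \<subseteq> {1..<n}"
    "foldr A w x = foldr A [j..<Suc n] (foldr A w' x)"
    "\<And>y. foldr adj_transp w y = foldr adj_transp [j..<Suc n] (foldr adj_transp w' y)"
    using coxeter_ops_normal_form[OF Suc.prems(1) coxeter_ops_adj_transp _ Suc.prems(2)] Suc.prems(5)
    by auto
  obtain i v' where i: "i \<in> {1..Suc n}" "set v' \<subseteq> {1..<n}"
    "foldr A v x = foldr A [i..<Suc n] (foldr A v' x)"
    "\<And>y. foldr adj_transp v y = foldr adj_transp [i..<Suc n] (foldr adj_transp v' y)"
    using coxeter_ops_normal_form[OF Suc.prems(1) coxeter_ops_adj_transp _ Suc.prems(3)] Suc.prems(5)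
    by auto
  have "foldr adj_transp w (Suc n) = j" "foldr adj_transp v (Suc n) = i"
    using i(1,4) j(1,4) adj_word_fixes[of w' "Suc n"] adj_word_fixes[of v' "Suc n"] i(2) j(2)
      adj_word_last[of i "Suc n"] adj_word_last[of j "Suc n"]
    by auto
  then have ij: "i = j" using Suc.prems(4) by simp
  have "inj (foldr adj_transp [j..<Suc n])"
    by (rule permutes_inj[OF adj_word_permutes[of _ "Suc n"]]) (use j(1) in auto)
  then have "foldr adj_transp w' = foldr adj_transp v'"
    using i(4) j(4) Suc.prems(4) ij by (metis (no_types, lifting) ext injD)
  then have "foldr A w' x = foldr A v' x"
    using Suc.IH[OF coxeter_ops_mono[OF Suc.prems(1)] j(2) i(2)] Suc.prems(5) by simp
  then show ?case using i j ij by simp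
qed

lemma adj_word_rev: "foldr adj_transp (rev w) (foldr adj_transp w y) = y"
  by (induction w arbitrary: y) auto

lemma adj_word_exists:
  assumes "\<sigma> permutes {1..n}"
  shows "\<exists>w. set w \<subseteq> {1..<n} \<and> foldr adj_transp w = \<sigma>"
  using assms
proof (induction n arbitrary: \<sigma>)
  case 0
  then show ?case by (auto intro!: exI[of _ "[]"] simp: permutes_def)
next
  case (Suc n)
  define j where "j = \<sigma> (Suc n)"
  have j: "j \<in> {1..Suc n}"
    unfolding j_def using permutes_in_image[OF Suc.prems, of "Suc n"] by simp
  define u where "u = [j..<Suc n]"
  have u: "set u \<subseteq> {1..<Suc n}" using j unfolding u_def by auto
  define \<tau> where "\<tau> = foldr adj_transp (rev u) \<circ> \<sigma>"
  have "\<tau> permutes {1..Suc n}"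
    unfolding \<tau>_def using u by (intro permutes_compose Suc.prems adj_word_permutes) simp
  moreover have "\<tau> (Suc n) = Suc n"
    using adj_word_rev[of u "Suc n"] adj_word_last[of j "Suc n"] j
    unfolding \<tau>_def u_def comp_apply j_def[symmetric] by simp
  ultimately have "\<tau> permutes {1..n}"
    unfolding permutes_def by (metis atLeastAtMost_iff le_SucE)
  then obtain w where w: "set w \<subseteq> {1..<n}" "foldr adj_transp w = \<tau>"
    using Suc.IH by blast
  have "foldr adj_transp (u @ w) = \<sigma>"
    unfolding foldr_append comp_def w(2) \<tau>_def using adj_word_rev[of "rev u"] by (auto simp: fun_eq_iff)
  moreover have "set (u @ w) \<subseteq> {1..<Suc n}" using u w by auto
  ultimately show ?case by blast
qed

text \<open>Each permutation acts through a chosen word, and the choice is immaterial on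
  \<open>X\<close> by \<open>coxeter_ops_words_eq\<close>. The last conclusion lets properties
  closed under composition, such as unitarity, pass from the generators to all permutations.\<close>

theorem coxeter_ops_extend:
  assumes A: "coxeter_ops n A X"
  obtains \<pi> where "\<And>k x. k \<in> {1..<n} \<Longrightarrow> x \<in> X \<Longrightarrow> \<pi> (adj_transp k) x = A k x"
    and "\<And>\<sigma> \<tau> x. \<sigma> permutes {1..n} \<Longrightarrow> \<tau> permutes {1..n} \<Longrightarrow> x \<in> X \<Longrightarrow>
           \<pi> (\<sigma> \<circ> \<tau>) x = \<pi> \<sigma> (\<pi> \<tau> x)"
    and "\<And>\<sigma>. \<sigma> permutes {1..n} \<Longrightarrow> \<exists>w. set w \<subseteq> {1..<n} \<and> \<pi> \<sigma> = foldr A w"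
proof
  define W where "W \<sigma> = (SOME w. set w \<subseteq> {1..<n} \<and> foldr adj_transp w = \<sigma>)" for \<sigma>
  have W: "set (W \<sigma>) \<subseteq> {1..<n} \<and> foldr adj_transp (W \<sigma>) = \<sigma>" if "\<sigma> permutes {1..n}" for \<sigma>
    unfolding W_def by (rule someI_ex[OF adj_word_exists[OF that]])
  show "foldr A (W (adj_transp k)) x = A k x" if "k \<in> {1..<n}" "x \<in> X" for k x
  proof -
    have "adj_transp k permutes {1..n}" using that by (intro permutes_swap_id) auto
    from W[OF this] coxeter_ops_words_eq[OF A, of "W (adj_transp k)" "[k]" x] that
    show ?thesis by auto
  qed
  show "foldr A (W (\<sigma> \<circ> \<tau>)) x = foldr A (W \<sigma>) (foldr A (W \<tau>) x)"
    if "\<sigma> permutes {1..n}" "\<tau> permutes {1..n}" "x \<in> X" for \<sigma> \<tau> x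
  proof -
    have "foldr adj_transp (W \<sigma> @ W \<tau>) = \<sigma> \<circ> \<tau>"
      using W[OF that(1)] W[OF that(2)] unfolding foldr_append comp_def by simp
    then show ?thesis
      using coxeter_ops_words_eq[OF A, of "W (\<sigma> \<circ> \<tau>)" "W \<sigma> @ W \<tau>" x] that(3)
        W[OF that(1)] W[OF that(2)] W[OF permutes_compose[OF that(2,1)]]
      by (simp add: comp_def)
  qed
  show "\<exists>w. set w \<subseteq> {1..<n} \<and> foldr A (W \<sigma>) = foldr A w" if "\<sigma> permutes {1..n}" for \<sigma>
    using W[OF that] by blast
qed

section \<open>Young diagrams and standard tableaux\<close>

definition young_shape :: "(nat \<times> nat) set \<Rightarrow> bool" where
  "young_shape S \<longleftrightarrow> finite S \<and> (\<forall>i j i' j'. (i', j') \<in> S \<and> i \<le> i' \<and> j \<le> j' \<longrightarrow> (i, j) \<in> S)"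

text \<open>The conditions of \<open>Tab\<close> for a bare set of boxes: adding or removing a box
  is then a set operation, with no list of row lengths to rebuild.\<close>

definition Syt :: "(nat \<times> nat) set \<Rightarrow> tableau set" where
  "Syt S = {T. bij_betw T S {1..card S} \<and> (\<forall>p. p \<notin> S \<longrightarrow> T p = 0) \<and>
     (\<forall>i j j'. j < j' \<and> (i, j') \<in> S \<longrightarrow> T (i, j) < T (i, j')) \<and>
     (\<forall>i i' j. i < i' \<and> (i', j) \<in> S \<longrightarrow> T (i, j) < T (i', j))}"

lemma young_shapeD: "young_shape S \<Longrightarrow> (i', j') \<in> S \<Longrightarrow> i \<le> i' \<Longrightarrow> j \<le> j' \<Longrightarrow> (i, j) \<in> S"
  unfolding young_shape_def by blast

lemma boxes_Sigma: "boxes lam = Sigma {..<length lam} (\<lambda>i. {..<lam ! i})"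
  by (auto simp: boxes_def)

lemma card_boxes: "card (boxes lam) = sum_list lam"
  unfolding boxes_Sigma by (subst card_SigmaI) (auto simp: sum_list_sum_nth atLeast0LessThan)

lemma Tab_eq_Syt: "Tab lam = Syt (boxes lam)"
  unfolding Tab_def Syt_def card_boxes ..

lemma young_shape_boxes:
  assumes "partition_of lam n"
  shows "young_shape (boxes lam)"
  unfolding young_shape_def
proof (intro conjI allI impI)
  show "finite (boxes lam)" unfolding boxes_Sigma by auto
  fix i j i' j' assume *: "(i', j') \<in> boxes lam \<and> i \<le> i' \<and> j \<le> j'"
  then have "lam ! i' \<le> lam ! i"
    using assms sorted_wrt_nth_less[of "(\<ge>)" lam i i']
    by (cases "i = i'") (auto simp: partition_of_def boxes_def)
  then show "(i, j) \<in> boxes lam" using * by (auto simp: boxes_def)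
qed

lemma SytD:
  assumes "T \<in> Syt S"
  shows "bij_betw T S {1..card S}" "\<And>p. p \<notin> S \<Longrightarrow> T p = 0"
    and "\<And>i j j'. j < j' \<Longrightarrow> (i, j') \<in> S \<Longrightarrow> T (i, j) < T (i, j')"
    and "\<And>i i' j. i < i' \<Longrightarrow> (i', j) \<in> S \<Longrightarrow> T (i, j) < T (i', j)"
  using assms unfolding Syt_def by blast+

lemma Syt_mono:
  assumes "T \<in> Syt S" "young_shape S" "(i', j') \<in> S" "i \<le> i'" "j \<le> j'" "(i, j) \<noteq> (i', j')"
  shows "T (i, j) < T (i', j')"
proof -
  have "(i, j') \<in> S" using assms young_shapeD by blast
  then have "T (i, j) \<le> T (i, j')" "j < j' \<Longrightarrow> T (i, j) < T (i, j')"
    using SytD(3)[OF assms(1), of j j' i] assms(5) by (cases "j = j'", auto)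
  moreover have "T (i, j') \<le> T (i', j')" "i < i' \<Longrightarrow> T (i, j') < T (i', j')"
    using SytD(4)[OF assms(1), of i i' j'] assms(3,4) by (cases "i = i'", auto)
  ultimately show ?thesis using assms(4-6) by (cases "i < i'") auto
qed

text \<open>The other two corners of the rectangle spanned by the two boxes carry two distinct
  entries strictly in between.\<close>

lemma Syt_diagonal_gap:
  assumes "T \<in> Syt S" "young_shape S" "(i', j') \<in> S" "i < i'" "j < j'"
  shows "T (i, j) + 3 \<le> T (i', j')"
proof -
  have S: "(i, j') \<in> S" "(i', j) \<in> S" using assms young_shapeD by (meson less_imp_le order_refl)+
  have "T (i, j) < T (i, j')" "T (i, j) < T (i', j)" "T (i, j') < T (i', j')" "T (i', j) < T (i', j')"
    using SytD(3,4)[OF assms(1)] S assms by auto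
  moreover have "T (i, j') \<noteq> T (i', j)"
    using SytD(1)[OF assms(1)] S assms(4) unfolding bij_betw_def inj_on_def by blast
  ultimately show ?thesis by linarith
qed

lemma finite_Syt: assumes "finite S" shows "finite (Syt S)"
proof -
  have "Syt S \<subseteq> {T. \<forall>p. (p \<in> S \<longrightarrow> T p \<in> {1..card S}) \<and> (p \<notin> S \<longrightarrow> T p = 0)}"
    unfolding Syt_def bij_betw_def by blast
  moreover have "finite \<dots>" by (rule finite_set_of_finite_funs) (use assms in auto)
  ultimately show ?thesis by (rule finite_subset)
qed

lemma Syt_insertI:
  assumes R: "R \<in> Syt S" and p: "p \<notin> S" and S: "young_shape S" "young_shape (insert p S)"
  shows "R(p := Suc (card S)) \<in> Syt (insert p S)"
proof -
  obtain pi pj where pp: "p = (pi, pj)" by (cases p)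
  have fin: "finite S" using S(1) by (simp add: young_shape_def)
  have bR: "bij_betw R S {1..card S}" using SytD(1)[OF R] .
  have le: "R q \<le> card S" for q
  proof (cases "q \<in> S")
    case True
    then have "R q \<in> R ` S" by simp
    then show ?thesis using bR unfolding bij_betw_def by simp
  qed (simp add: SytD(2)[OF R])
  have "bij_betw (R(p := Suc (card S))) S {1..card S}"
    using bR p by (subst bij_betw_cong[of S _ R]) auto
  then have "bij_betw (R(p := Suc (card S))) (S \<union> {p}) ({1..card S} \<union> {Suc (card S)})"
    by (rule bij_betw_combine) (auto simp: bij_betw_def)
  moreover have "{1..card S} \<union> {Suc (card S)} = {1..Suc (card S)}" by auto
  ultimately have "bij_betw (R(p := Suc (card S))) (insert p S) {1..card (insert p S)}"
    using p fin by simp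
  moreover have "(R(p := Suc (card S))) (i, j) < (R(p := Suc (card S))) (i, j')"
    if "j < j'" "(i, j') \<in> insert p S" for i j j'
  proof (cases "(i, j') = p")
    case True
    then show ?thesis using that le[of "(i, j)"] by auto
  next
    case False
    then have "(i, j') \<in> S" using that by simp
    moreover from this have "(i, j) \<noteq> p"
      using that p young_shapeD[OF S(1), of i j' i j] by auto
    ultimately show ?thesis using False SytD(3)[OF R that(1)] by auto
  qed
  moreover have "(R(p := Suc (card S))) (i, j) < (R(p := Suc (card S))) (i', j)"
    if "i < i'" "(i', j) \<in> insert p S" for i i' j
  proof (cases "(i', j) = p")
    case True
    then show ?thesis using that le[of "(i, j)"] by auto
  next
    case False
    then have "(i', j) \<in> S" using that by simp
    moreover from this have "(i, j) \<noteq> p"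
      using that p young_shapeD[OF S(1), of i' j i j] by auto
    ultimately show ?thesis using False SytD(4)[OF R that(1)] by auto
  qed
  ultimately show ?thesis using SytD(2)[OF R] unfolding Syt_def by auto
qed

lemma Syt_insertD:
  assumes T: "T \<in> Syt (insert p S)" and p: "p \<notin> S" and S: "finite S" "young_shape S"
    and Tp: "T p = Suc (card S)"
  shows "T(p := 0) \<in> Syt S"
proof -
  have b: "bij_betw T (insert p S) {1..Suc (card S)}" using SytD(1)[OF T] p S by simp
  have "bij_betw T (insert p S - {p}) ({1..Suc (card S)} - {T p})"
    by (rule bij_betw_subset[OF b]) (use b p in \<open>auto simp: bij_betw_def inj_on_def\<close>)
  moreover have "insert p S - {p} = S" "{1..Suc (card S)} - {T p} = {1..card S}"
    using p Tp by auto
  ultimately have "bij_betw T S {1..card S}" by simp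
  then have "bij_betw (T(p := 0)) S {1..card S}"
    using p by (subst bij_betw_cong[of S _ T]) auto
  moreover have "(T(p := 0)) (i, j) < (T(p := 0)) (i, j')" if "j < j'" "(i, j') \<in> S" for i j j'
    using SytD(3)[OF T that(1), of i] that p by auto
  moreover have "(T(p := 0)) (i, j) < (T(p := 0)) (i', j)" if "i < i'" "(i', j) \<in> S" for i i' j
    using SytD(4)[OF T that(1), of j] that p by auto
  ultimately show ?thesis using SytD(2)[OF T] unfolding Syt_def by auto
qed

lemma Syt_max_corner:
  assumes T: "T \<in> Syt S" and S: "young_shape S" and p: "p \<in> S" "T p = card S"
  shows "young_shape (S - {p})"
  unfolding young_shape_def
proof (intro conjI allI impI)
  show "finite (S - {p})" using S by (simp add: young_shape_def)
  fix i j i' j' assume *: "(i', j') \<in> S - {p} \<and> i \<le> i' \<and> j \<le> j'"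
  have "(i, j) \<noteq> p"
  proof
    assume e: "(i, j) = p"
    have "T (i, j) < T (i', j')" by (rule Syt_mono[OF T S]) (use * e in auto)
    moreover have "T (i', j') \<le> card S"
      using SytD(1)[OF T] * unfolding bij_betw_def by fastforce
    ultimately show False using e p by simp
  qed
  then show "(i, j) \<in> S - {p}" using * young_shapeD[OF S] by blast
qed

text \<open>The branching rule: tableaux are sorted by the box of their largest entry, which can be
  any removable corner.\<close>

lemma card_Syt_branch:
  assumes S: "young_shape S" and ne: "S \<noteq> {}"
  shows "card (Syt S) = (\<Sum>p\<in>{p\<in>S. young_shape (S - {p})}. card (Syt (S - {p})))"
proof -
  let ?C = "{p\<in>S. young_shape (S - {p})}"
  let ?f = "\<lambda>p R. R(p := card S)"
  have fin: "finite S" using S by (simp add: young_shape_def)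
  have card1: "Suc (card (S - {p})) = card S" if "p \<in> S" for p
    by (rule card_Suc_Diff1[OF fin that])
  have "Syt S = (\<Union>p\<in>?C. ?f p ` Syt (S - {p}))"
  proof (intro subset_antisym subsetI)
    fix T assume T: "T \<in> Syt S"
    have "card S \<in> {1..card S}" using ne fin by (simp add: Suc_le_eq card_gt_0_iff)
    then obtain p where p: "p \<in> S" "T p = card S"
      using SytD(1)[OF T] unfolding bij_betw_def by (metis imageE)
    have y: "young_shape (S - {p})" by (rule Syt_max_corner[OF T S p])
    have "T(p := 0) \<in> Syt (S - {p})"
      by (rule Syt_insertD) (use T p y fin card1[OF p(1)] in \<open>auto simp: insert_absorb\<close>)
    moreover have "T = ?f p (T(p := 0))" using p by auto
    ultimately show "T \<in> (\<Union>p\<in>?C. ?f p ` Syt (S - {p}))" using p y by blast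
  next
    fix T assume "T \<in> (\<Union>p\<in>?C. ?f p ` Syt (S - {p}))"
    then obtain p R where p: "p \<in> S" "young_shape (S - {p})" "R \<in> Syt (S - {p})" "T = ?f p R" by auto
    then show "T \<in> Syt S"
      using Syt_insertI[of R "S - {p}" p] S card1[OF p(1)] by (simp add: insert_absorb)
  qed
  then have "card (Syt S) = card (\<Union>p\<in>?C. ?f p ` Syt (S - {p}))" by simp
  also have "\<dots> = (\<Sum>p\<in>?C. card (?f p ` Syt (S - {p})))"
  proof (rule card_UN_disjoint)
    show "finite ?C" using fin by simp
    show "\<forall>p\<in>?C. finite (?f p ` Syt (S - {p}))" using fin finite_Syt by auto
    show "\<forall>p\<in>?C. \<forall>q\<in>?C. p \<noteq> q \<longrightarrow> ?f p ` Syt (S - {p}) \<inter> ?f q ` Syt (S - {q}) = {}"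
    proof (intro ballI impI, rule ccontr)
      fix p q assume pq: "p \<in> ?C" "q \<in> ?C" "p \<noteq> q"
        and "?f p ` Syt (S - {p}) \<inter> ?f q ` Syt (S - {q}) \<noteq> {}"
      then obtain R Q where R: "R \<in> Syt (S - {p})" "?f p R = ?f q Q" by auto
      have "R q = card S" using fun_cong[OF R(2), of q] pq(3) by simp
      moreover have "R q \<in> {1..card (S - {p})}"
        using SytD(1)[OF R(1)] pq unfolding bij_betw_def by auto
      ultimately show False using card1[of p] pq by auto
    qed
  qed
  also have "\<dots> = (\<Sum>p\<in>?C. card (Syt (S - {p})))"
  proof (rule sum.cong[OF refl], rule card_image, rule inj_onI)
    fix p R Q assume "R \<in> Syt (S - {p})" "Q \<in> Syt (S - {p})" "?f p R = ?f p Q"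
    then show "R = Q"
      using SytD(2)[of R "S - {p}" p] SytD(2)[of Q "S - {p}" p] by (metis fun_upd_triv fun_upd_upd Diff_iff singletonI)
  qed
  finally show ?thesis .
qed

section \<open>Contents of entries and the effect of swapping k and k + 1\<close>

lemma content_at_eq:
  assumes "T \<in> Tab lam" "(i, j) \<in> boxes lam"
  shows "content_at lam T (T (i, j)) = int j - int i"
  using assms SytD(1)[of T "boxes lam"] unfolding Tab_eq_Syt content_at_def bij_betw_def
  by (simp add: inv_into_f_f)

lemma Tab_obtain_box:
  assumes "T \<in> Tab lam" "m \<in> {1..sum_list lam}"
  obtains i j where "(i, j) \<in> boxes lam" "T (i, j) = m"
proof -
  have "m \<in> T ` boxes lam"
    using assms SytD(1)[of T "boxes lam"] unfolding Tab_eq_Syt bij_betw_def card_boxes by simp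
  then show ?thesis using that by auto
qed

text \<open>Equal contents mean a common diagonal. The bound keeps the denominators of Young's form
  nonzero: the contents of k and k + 1 differ, and so do those of k and k + 2, which meet in the
  braid relation.\<close>

lemma content_at_eq_gap:
  assumes lam: "partition_of lam n" and T: "T \<in> Tab lam"
    and ab: "k \<in> {1..sum_list lam}" "l \<in> {1..sum_list lam}" "k < l"
    and eq: "content_at lam T k = content_at lam T l"
  shows "k + 3 \<le> l"
proof -
  obtain i j where ij: "(i, j) \<in> boxes lam" "T (i, j) = k" by (rule Tab_obtain_box[OF T ab(1)])
  obtain i' j' where ij': "(i', j') \<in> boxes lam" "T (i', j') = l" by (rule Tab_obtain_box[OF T ab(2)])
  have e: "int j - int i = int j' - int i'"
    using eq content_at_eq[OF T] ij ij' by metis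
  have "T \<in> Syt (boxes lam)" using T by (simp add: Tab_eq_Syt)
  note gap = Syt_diagonal_gap[OF this young_shape_boxes[OF lam]]
  have "i \<noteq> i'" using e ij ij' ab by auto
  then consider "i < i'" | "i' < i" by linarith
  then show ?thesis
  proof cases
    case 1
    then show ?thesis using gap[OF ij'(1), of i j] e ij ij' by simp
  next
    case 2
    then show ?thesis using gap[OF ij(1), of i' j'] e ij ij' ab by simp
  qed
qed

lemma transpose_adj_less: "x < y \<Longrightarrow> \<not> adj_transp k x < adj_transp k y \<Longrightarrow> x = k \<and> y = k + 1"
  by (auto simp: transpose_def split: if_splits)

lemma adj_transp_bij_betw:
  assumes "bij_betw T S {1..n}" "k \<in> {1..<n}"
  shows "bij_betw (adj_transp k \<circ> T) S {1..n}"
proof (rule bij_betw_trans[OF assms(1)])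
  have "adj_transp k permutes {1..n}" using assms(2) by (intro permutes_swap_id) auto
  then show "bij_betw (adj_transp k) {1..n} {1..n}" by (rule permutes_imp_bij)
qed

text \<open>The swap can only violate an inequality between k and k + 1 themselves. These then share
  a row or a column, and no entry fits between them, so their boxes are neighbours. Hence the square
  root in Young's formula vanishes wherever its second term is absent.\<close>

lemma swap_not_standard:
  assumes lam: "partition_of lam n" and T: "T \<in> Tab lam" and k: "k \<in> {1..<sum_list lam}"
    and ns: "adj_transp k \<circ> T \<notin> Tab lam"
  shows "\<bar>axial_dist lam T (k + 1) k\<bar> = 1"
proof -
  have TS: "T \<in> Syt (boxes lam)" using T by (simp add: Tab_eq_Syt)
  note TD = SytD[OF TS]
  have "bij_betw (adj_transp k \<circ> T) (boxes lam) {1..card (boxes lam)}"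
    by (rule adj_transp_bij_betw[OF TD(1)]) (use k in \<open>simp add: card_boxes\<close>)
  moreover have "(adj_transp k \<circ> T) p = 0" if "p \<notin> boxes lam" for p
    using TD(2)[OF that] k by (simp add: transpose_def)
  ultimately have
    "(\<exists>i j j'. j < j' \<and> (i, j') \<in> boxes lam \<and> \<not> adj_transp k (T (i, j)) < adj_transp k (T (i, j'))) \<or>
     (\<exists>i i' j. i < i' \<and> (i', j) \<in> boxes lam \<and> \<not> adj_transp k (T (i, j)) < adj_transp k (T (i', j)))"
    using ns unfolding Tab_eq_Syt Syt_def mem_Collect_eq comp_apply by blast
  then show ?thesis
  proof (elim disjE exE conjE)
    fix i j j' assume h: "j < j'" "(i, j') \<in> boxes lam" "\<not> adj_transp k (T (i, j)) < adj_transp k (T (i, j'))"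
    have e: "T (i, j) = k" "T (i, j') = k + 1"
      using transpose_adj_less[OF TD(3)[OF h(1,2)] h(3)] by auto
    have b: "(i, j) \<in> boxes lam" using e k TD(2) by fastforce
    have "j' = j + 1"
    proof (rule ccontr)
      assume "j' \<noteq> j + 1"
      then have j1: "j + 1 < j'" using h by simp
      then have "(i, j + 1) \<in> boxes lam" using young_shapeD[OF young_shape_boxes[OF lam] h(2)] by simp
      then show False using TD(3)[of j "j + 1" i] TD(3)[OF j1 h(2)] e by simp
    qed
    then show ?thesis
      using content_at_eq[OF T b] content_at_eq[OF T h(2)] e unfolding axial_dist_def by simp
  next
    fix i i' j assume h: "i < i'" "(i', j) \<in> boxes lam" "\<not> adj_transp k (T (i, j)) < adj_transp k (T (i', j))"
    have e: "T (i, j) = k" "T (i', j) = k + 1"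
      using transpose_adj_less[OF TD(4)[OF h(1,2)] h(3)] by auto
    have b: "(i, j) \<in> boxes lam" using e k TD(2) by fastforce
    have "i' = i + 1"
    proof (rule ccontr)
      assume "i' \<noteq> i + 1"
      then have j1: "i + 1 < i'" using h by simp
      then have "(i + 1, j) \<in> boxes lam" using young_shapeD[OF young_shape_boxes[OF lam] h(2)] by simp
      then show False using TD(4)[of i "i + 1" j] TD(4)[OF j1 h(2)] e by simp
    qed
    then show ?thesis
      using content_at_eq[OF T b] content_at_eq[OF T h(2)] e unfolding axial_dist_def by simp
  qed
qed

text \<open>Stated for bijective fillings, because the braid computation passes through swapped
  fillings that may fail to be standard.\<close>

lemma content_at_swap:
  assumes "bij_betw T (boxes lam) {1..sum_list lam}" "k \<in> {1..<sum_list lam}" "m \<in> {1..sum_list lam}"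
  shows "content_at lam (adj_transp k \<circ> T) m = content_at lam T (adj_transp k m)"
proof -
  let ?p = "inv_into (boxes lam) T (adj_transp k m)"
  have m: "adj_transp k m \<in> {1..sum_list lam}"
    using assms(2,3) by (auto simp: transpose_def)
  have p: "?p \<in> boxes lam" "T ?p = adj_transp k m"
    using m assms(1) by (auto simp: bij_betw_def inv_into_into f_inv_into_f)
  have "inv_into (boxes lam) (adj_transp k \<circ> T) m = ?p"
    by (rule inv_into_f_eq)
      (use adj_transp_bij_betw[OF assms(1,2)] p in \<open>auto simp: bij_betw_def\<close>)
  then show ?thesis unfolding content_at_def by simp
qed

section \<open>Young's orthogonal form\<close>

text \<open>Young's formula read off in coordinates; the coefficient between T and s_k T is the same
  in both directions because the axial distance only changes sign. Standardness is enforced by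
  zeros: \<open>x\<close> vanishes at a non-standard s_k T, and the root vanishes at a non-standard
  T whose swap is standard.\<close>

definition young_op :: "nat list \<Rightarrow> nat \<Rightarrow> (tableau \<Rightarrow> real) \<Rightarrow> tableau \<Rightarrow> real" where
  "young_op lam k x T = (let D = real_of_int (axial_dist lam T (k + 1) k) in
     x T / D + sqrt (1 - 1 / D\<^sup>2) * x (adj_transp k \<circ> T))"

lemma hspaceD: "x \<in> hspace I \<Longrightarrow> i \<notin> I \<Longrightarrow> x i = 0"
  by (simp add: hspace_def)

lemma transpose_comp_invol [simp]: "Transposition.transpose k l \<circ> (Transposition.transpose k l \<circ> T) = T"
  by (simp add: fun_eq_iff)

lemma Tab_bij: "T \<in> Tab lam \<Longrightarrow> bij_betw T (boxes lam) {1..sum_list lam}"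
  by (simp add: Tab_def)

lemma axial_dist_swap:
  assumes "bij_betw T (boxes lam) {1..sum_list lam}" "k \<in> {1..<sum_list lam}"
  shows "axial_dist lam (adj_transp k \<circ> T) (k + 1) k = - axial_dist lam T (k + 1) k"
  unfolding axial_dist_def using content_at_swap[OF assms, of k] content_at_swap[OF assms, of "k + 1"] assms(2)
  by simp

lemma axial_dist_swap_far:
  assumes "bij_betw T (boxes lam) {1..sum_list lam}" "k \<in> {1..<sum_list lam}" "l \<in> {1..<sum_list lam}"
    "k + 1 < l \<or> l + 1 < k"
  shows "axial_dist lam (adj_transp k \<circ> T) (l + 1) l = axial_dist lam T (l + 1) l"
  unfolding axial_dist_def using content_at_swap[OF assms(1,2), of l] content_at_swap[OF assms(1,2), of "l + 1"] assms(2-)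
  by (auto simp: transpose_def)

lemma axial_dist_ge1:
  assumes "partition_of lam n" "T \<in> Tab lam" "k \<in> {1..<sum_list lam}"
  shows "(real_of_int (axial_dist lam T (k + 1) k))\<^sup>2 \<ge> 1"
proof -
  have "axial_dist lam T (k + 1) k \<noteq> 0"
    using content_at_eq_gap[OF assms(1,2), of k "k + 1"] assms(3) unfolding axial_dist_def by auto
  then have "1 \<le> \<bar>axial_dist lam T (k + 1) k\<bar>" by linarith
  then have "1 \<le> \<bar>real_of_int (axial_dist lam T (k + 1) k)\<bar>" by linarith
  then show ?thesis using one_le_power[of _ 2] by (metis power2_abs)
qed

lemma young_op_hspace:
  assumes lam: "partition_of lam n" and k: "k \<in> {1..<sum_list lam}" and x: "x \<in> hspace (Tab lam)"
  shows "young_op lam k x \<in> hspace (Tab lam)"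
  unfolding hspace_def
proof (intro CollectI allI impI)
  fix T assume T: "T \<notin> Tab lam"
  show "young_op lam k x T = 0"
  proof (cases "adj_transp k \<circ> T \<in> Tab lam")
    case False
    then show ?thesis using T hspaceD[OF x] by (simp add: young_op_def)
  next
    case True
    have "\<bar>axial_dist lam (adj_transp k \<circ> T) (k + 1) k\<bar> = 1"
      by (rule swap_not_standard[OF lam True k]) (use T in simp)
    moreover have "axial_dist lam T (k + 1) k = - axial_dist lam (adj_transp k \<circ> T) (k + 1) k"
      using axial_dist_swap[OF Tab_bij[OF True] k] by simp
    ultimately have "\<bar>axial_dist lam T (k + 1) k\<bar> = 1" by simp
    then have "(real_of_int (axial_dist lam T (k + 1) k))\<^sup>2 = 1"
      by (metis of_int_1 of_int_power power2_abs power_one)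
    then show ?thesis using T hspaceD[OF x] by (simp add: young_op_def Let_def)
  qed
qed

text \<open>On the coordinates at T and s_k T the operator is the reflection with rows (1/D, c) and
  (c, -1/D), where c^2 = 1 - 1/D^2.\<close>

lemma young_op_invol:
  assumes lam: "partition_of lam n" and k: "k \<in> {1..<sum_list lam}" and x: "x \<in> hspace (Tab lam)"
  shows "young_op lam k (young_op lam k x) = x"
proof
  fix T
  show "young_op lam k (young_op lam k x) T = x T"
  proof (cases "T \<in> Tab lam")
    case False
    then show ?thesis
      using hspaceD[OF x] hspaceD[OF young_op_hspace[OF lam k young_op_hspace[OF lam k x]]] by simp
  next
    case True
    define D where "D = real_of_int (axial_dist lam T (k + 1) k)"
    define c where "c = sqrt (1 - 1 / D\<^sup>2)"
    have D: "D\<^sup>2 \<ge> 1" unfolding D_def by (rule axial_dist_ge1[OF lam True k])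
    have c2: "c * c = 1 - 1 / D * (1 / D)"
      unfolding c_def using D by (simp add: power2_eq_square field_simps)
    have 1: "young_op lam k y T = 1 / D * y T + c * y (adj_transp k \<circ> T)" for y
      unfolding young_op_def D_def c_def by (simp add: Let_def)
    have 2: "young_op lam k y (adj_transp k \<circ> T) = - (1 / D * y (adj_transp k \<circ> T)) + c * y T" for y
      unfolding young_op_def axial_dist_swap[OF Tab_bij[OF True] k] D_def c_def by (simp add: Let_def)
    have "young_op lam k (young_op lam k x) T = (1 / D * (1 / D) + c * c) * x T"
      unfolding 1 2 by algebra
    then show ?thesis using c2 by simp
  qed
qed

lemma young_op_commute:
  assumes lam: "partition_of lam n" and k: "k \<in> {1..<sum_list lam}" "l \<in> {1..<sum_list lam}"
    and kl: "k + 1 < l" and x: "x \<in> hspace (Tab lam)"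
  shows "young_op lam k (young_op lam l x) = young_op lam l (young_op lam k x)"
proof
  fix T
  show "young_op lam k (young_op lam l x) T = young_op lam l (young_op lam k x) T"
  proof (cases "T \<in> Tab lam")
    case False
    then show ?thesis
      using hspaceD[OF young_op_hspace[OF lam k(1) young_op_hspace[OF lam k(2) x]] False]
        hspaceD[OF young_op_hspace[OF lam k(2) young_op_hspace[OF lam k(1) x]] False] by simp
  next
    case True
    have "adj_transp k \<circ> (adj_transp l \<circ> T) = adj_transp l \<circ> (adj_transp k \<circ> T)"
      using kl by (auto simp: fun_eq_iff transpose_def)
    then show ?thesis
      unfolding young_op_def Let_def
      using axial_dist_swap_far[OF Tab_bij[OF True] k(1) k(2)] axial_dist_swap_far[OF Tab_bij[OF True] k(2) k(1)] kl
      by (simp add: algebra_simps add_divide_distrib)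
  qed
qed

text \<open>The braid relation at a single filling. Let p, q, r be the contents of k, k + 1, k + 2.
  Then \<alpha>, \<beta>, \<gamma> stand for the reciprocals of q - p, r - p, r - q, and
  \<open>P\<close>, \<open>Q\<close>, \<open>R\<close> for the corresponding square roots;
  \<open>h\<^sub>0\<close> to \<open>h\<^sub>5\<close> are the coordinates at the six rearrangements
  of the three entries. The first assumption is r - p = (q - p) + (r - q), written for
  reciprocals.\<close>

lemma braid_identity:
  fixes \<alpha> \<beta> \<gamma> P Q R h\<^sub>0 h\<^sub>1 h\<^sub>2 h\<^sub>3 h\<^sub>4 h\<^sub>5 :: real
  assumes "\<alpha> * \<gamma> = \<beta> * (\<alpha> + \<gamma>)" "P * P = 1 - \<alpha> * \<alpha>" "R * R = 1 - \<gamma> * \<gamma>"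
  shows "\<alpha> * (\<gamma> * (\<alpha> * h\<^sub>0 + P * h\<^sub>1) + R * (\<beta> * h\<^sub>2 + Q * h\<^sub>4)) +
      P * (\<beta> * (- \<alpha> * h\<^sub>1 + P * h\<^sub>0) + Q * (\<gamma> * h\<^sub>3 + R * h\<^sub>5)) =
    \<gamma> * (\<alpha> * (\<gamma> * h\<^sub>0 + R * h\<^sub>2) + P * (\<beta> * h\<^sub>1 + Q * h\<^sub>3)) +
      R * (\<beta> * (- \<gamma> * h\<^sub>2 + R * h\<^sub>0) + Q * (\<alpha> * h\<^sub>4 + P * h\<^sub>5))"
  using assms by algebra

lemma young_op_braid:
  assumes lam: "partition_of lam n" and k: "1 \<le> k" "k + 1 < sum_list lam"
    and x: "x \<in> hspace (Tab lam)"
  shows "young_op lam k (young_op lam (k + 1) (young_op lam k x)) =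
    young_op lam (k + 1) (young_op lam k (young_op lam (k + 1) x))"
proof
  fix T
  let ?A = "young_op lam k" and ?B = "young_op lam (k + 1)"
  let ?s = "adj_transp k" and ?t = "adj_transp (k + 1)"
  have kk: "k \<in> {1..<sum_list lam}" "k + 1 \<in> {1..<sum_list lam}" using k by auto
  note hA = young_op_hspace[OF lam kk(1)] and hB = young_op_hspace[OF lam kk(2)]
  show "?A (?B (?A x)) T = ?B (?A (?B x)) T"
  proof (cases "T \<in> Tab lam")
    case False
    then show ?thesis
      using hspaceD[OF hA[OF hB[OF hA[OF x]]] False] hspaceD[OF hB[OF hA[OF hB[OF x]]] False] by simp
  next
    case True
    \<comment> \<open>\<open>cc\<close> tracks the contents of the three entries k, k + 1, k + 2 in
      a bijective filling; the two transpositions permute these contents, which fixes every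
      coefficient met along the way.\<close>
    define cc where "cc U p q r \<longleftrightarrow> bij_betw U (boxes lam) {1..sum_list lam} \<and>
      content_at lam U k = p \<and> content_at lam U (k + 1) = q \<and> content_at lam U (k + 2) = r" for U p q r
    have s: "cc (?s \<circ> U) q p r" if "cc U p q r" for U p q r
      using that adj_transp_bij_betw[OF _ kk(1)] content_at_swap[OF _ kk(1)] k unfolding cc_def
      by (auto simp: transpose_def)
    have t: "cc (?t \<circ> U) p r q" if "cc U p q r" for U p q r
      using that adj_transp_bij_betw[OF _ kk(2)] content_at_swap[OF _ kk(2)] k unfolding cc_def
      by (auto simp: transpose_def)
    define c where "c p q = sqrt (1 - 1 / (real_of_int q - real_of_int p)\<^sup>2)" for p q
    define g where "g p q = 1 / (real_of_int q - real_of_int p)" for p q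
    have c_sym: "c p q = c q p" for p q unfolding c_def by (simp add: power2_commute)
    have g_sym: "g p q = - g q p" for p q unfolding g_def using minus_divide_right[of 1 "real_of_int p - real_of_int q"] by simp
    have A: "?A y U = g p q * y U + c p q * y (?s \<circ> U)" if "cc U p q r" for U p q r y
      using that unfolding cc_def young_op_def axial_dist_def c_def g_def by (auto simp: Let_def)
    have B: "?B y U = g q r * y U + c q r * y (?t \<circ> U)" if "cc U p q r" for U p q r y
      using that unfolding cc_def young_op_def axial_dist_def c_def g_def by (auto simp: Let_def)
    obtain p q r where T0: "cc T p q r" unfolding cc_def using Tab_bij[OF True] by blast
    note T1 = s[OF T0] and T2 = t[OF T0]
    note T3 = t[OF T1] and T4 = s[OF T2]
    have sts: "?t \<circ> (?s \<circ> (?t \<circ> T)) = ?s \<circ> (?t \<circ> (?s \<circ> T))"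
      by (auto simp: fun_eq_iff transpose_def)
    have ne: "p \<noteq> q" "q \<noteq> r" "p \<noteq> r"
      using T0 content_at_eq_gap[OF lam True, of k "k + 1"] content_at_eq_gap[OF lam True, of "k + 1" "k + 2"]
        content_at_eq_gap[OF lam True, of k "k + 2"] k unfolding cc_def by auto
    have g1: "g p q * g q r = g p r * (g p q + g q r)"
      unfolding g_def using ne by (simp add: field_simps)
    have cc2: "c p q * c p q = 1 - g p q * g p q" if "p \<noteq> q" for p q
    proof -
      have "1 \<le> \<bar>real_of_int q - real_of_int p\<bar>" using that by linarith
      then have "1 \<le> (real_of_int q - real_of_int p)\<^sup>2"
        using one_le_power[of "\<bar>real_of_int q - real_of_int p\<bar>" 2] by simp
      then show ?thesis unfolding c_def g_def by (simp add: power2_eq_square field_simps)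
    qed
    have "?A (?B (?A x)) T =
      g p q * (g q r * (g p q * x T + c p q * x (?s \<circ> T)) +
        c q r * (g p r * x (?t \<circ> T) + c p r * x (?s \<circ> (?t \<circ> T)))) +
      c p q * (g p r * (- g p q * x (?s \<circ> T) + c p q * x T) +
        c p r * (g q r * x (?t \<circ> (?s \<circ> T)) + c q r * x (?s \<circ> (?t \<circ> (?s \<circ> T)))))"
      unfolding A[OF T0] B[OF T0] B[OF T1] A[OF T1] A[OF T2] A[OF T3] transpose_comp_invol
      using g_sym[of q p] c_sym[of q p] by simp
    moreover have "?B (?A (?B x)) T =
      g q r * (g p q * (g q r * x T + c q r * x (?t \<circ> T)) +
        c p q * (g p r * x (?s \<circ> T) + c p r * x (?t \<circ> (?s \<circ> T)))) +
      c q r * (g p r * (- g q r * x (?t \<circ> T) + c q r * x T) +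
        c p r * (g p q * x (?s \<circ> (?t \<circ> T)) + c p q * x (?s \<circ> (?t \<circ> (?s \<circ> T)))))"
      unfolding A[OF T0] B[OF T0] B[OF T1] A[OF T2] B[OF T2] B[OF T4] transpose_comp_invol sts
      using g_sym[of r q] c_sym[of r q] by simp
    ultimately show ?thesis
      using braid_identity[OF g1 cc2[OF ne(1)] cc2[OF ne(2)]] by simp
  qed
qed

lemma coxeter_ops_young_op:
  assumes "partition_of lam n"
  shows "coxeter_ops (sum_list lam) (young_op lam) (hspace (Tab lam))"
  unfolding coxeter_ops_def
  using young_op_hspace[OF assms] young_op_invol[OF assms] young_op_commute[OF assms] young_op_braid[OF assms]
  by blast

lemma finite_Tab: "finite (Tab lam)"
  unfolding Tab_eq_Syt by (rule finite_Syt) (auto simp: boxes_Sigma)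

lemma lin_op_young_op:
  assumes "partition_of lam n" "k \<in> {1..<sum_list lam}"
  shows "lin_op (Tab lam) (Tab lam) (young_op lam k)"
  unfolding lin_op_def using young_op_hspace[OF assms]
  by (auto simp: young_op_def Let_def fun_eq_iff add_divide_distrib algebra_simps)

text \<open>The swap pairs up the tableaux on which the second term is present, with equal
  coefficients in a pair. A symmetric involution preserves the inner product, which yields
  unitarity.\<close>

lemma young_op_symmetric:
  assumes lam: "partition_of lam n" and k: "k \<in> {1..<sum_list lam}"
    and x: "x \<in> hspace (Tab lam)" and y: "y \<in> hspace (Tab lam)"
  shows "iprod (Tab lam) (young_op lam k x) y = iprod (Tab lam) x (young_op lam k y)"
proof -
  let ?s = "\<lambda>T. adj_transp k \<circ> T"
  let ?D = "\<lambda>T. real_of_int (axial_dist lam T (k + 1) k)"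
  let ?c = "\<lambda>T. sqrt (1 - 1 / (?D T)\<^sup>2)"
  let ?U = "{T \<in> Tab lam. ?s T \<in> Tab lam}"
  have restrict: "(\<Sum>T\<in>Tab lam. ?c T * (u (?s T) * v T)) = (\<Sum>T\<in>?U. ?c T * (u (?s T) * v T))"
    if "u \<in> hspace (Tab lam)" for u v
    using hspaceD[OF that] finite_Tab by (intro sum.mono_neutral_right) auto
  have "(\<Sum>T\<in>?U. ?c T * (x (?s T) * y T)) = (\<Sum>T\<in>?U. ?c T * (y (?s T) * x T))"
  proof (rule sum.reindex_bij_witness[of _ ?s ?s])
    fix T assume "T \<in> ?U"
    then show "?c (?s T) * (y (?s (?s T)) * x (?s T)) = ?c T * (x (?s T) * y T)"
      using axial_dist_swap[OF Tab_bij k, of T] by simp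
  qed auto
  then have "(\<Sum>T\<in>Tab lam. ?c T * (x (?s T) * y T)) = (\<Sum>T\<in>Tab lam. ?c T * (y (?s T) * x T))"
    using restrict[OF x] restrict[OF y] by simp
  then show ?thesis
    unfolding iprod_def young_op_def Let_def by (simp add: algebra_simps sum.distrib)
qed

lemma unitary_young_op:
  assumes lam: "partition_of lam n" and k: "k \<in> {1..<sum_list lam}"
  shows "unitary_op (Tab lam) (young_op lam k)"
  unfolding unitary_op_def isometry_op_def
proof (intro conjI ballI)
  show "lin_op (Tab lam) (Tab lam) (young_op lam k)" by (rule lin_op_young_op[OF assms])
  fix x y assume xy: "x \<in> hspace (Tab lam)" "y \<in> hspace (Tab lam)"
  show "iprod (Tab lam) (young_op lam k x) (young_op lam k y) = iprod (Tab lam) x y"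
    using young_op_symmetric[OF assms xy(1) young_op_hspace[OF assms xy(2)]]
      young_op_invol[OF assms xy(2)] by simp
next
  show "young_op lam k ` hspace (Tab lam) = hspace (Tab lam)"
    using young_op_hspace[OF assms] young_op_invol[OF assms]
    by (auto intro!: rev_image_eqI[where x = "young_op lam k x" for x])
qed

lemma isometry_op_comp: "isometry_op J K g \<Longrightarrow> isometry_op I J f \<Longrightarrow> isometry_op I K (g \<circ> f)"
  unfolding isometry_op_def lin_op_def by simp

lemma unitary_op_comp: "unitary_op I g \<Longrightarrow> unitary_op I f \<Longrightarrow> unitary_op I (g \<circ> f)"
  unfolding unitary_op_def using isometry_op_comp[of I I g I f] image_comp[of g f "hspace I"] by metis

lemma unitary_op_id: "unitary_op I id"
  unfolding unitary_op_def isometry_op_def lin_op_def by auto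

lemma young_op_basis:
  assumes lam: "partition_of lam n" and k: "k \<in> {1..<sum_list lam}" and T: "T \<in> Tab lam"
  shows "young_op lam k (basis_vec T) =
          (let D = real_of_int (axial_dist lam T (k + 1) k); T' = adj_transp k \<circ> T in
             (\<lambda>S. 1 / D * basis_vec T S +
                (if T' \<in> Tab lam then sqrt (1 - 1 / D\<^sup>2) * basis_vec T' S else 0)))"
proof -
  define D where "D = real_of_int (axial_dist lam T (k + 1) k)"
  let ?T = "adj_transp k \<circ> T"
  have D': "real_of_int (axial_dist lam ?T (k + 1) k) = - D"
    unfolding D_def using axial_dist_swap[OF Tab_bij[OF T] k] by simp
  have z: "1 - 1 / D\<^sup>2 = 0" if "?T \<notin> Tab lam"
    using swap_not_standard[OF lam T k that] unfolding D_def
    by (metis cancel_comm_monoid_add_class.diff_cancel div_by_1 of_int_1 of_int_power power2_abs power_one)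
  have sw: "adj_transp k \<circ> S = T \<longleftrightarrow> S = ?T" for S
    by (metis transpose_comp_invol)
  have "young_op lam k (basis_vec T) S =
      1 / D * basis_vec T S + (if ?T \<in> Tab lam then sqrt (1 - 1 / D\<^sup>2) * basis_vec ?T S else 0)" for S
  proof -
    have 1: "basis_vec T S / real_of_int (axial_dist lam S (k + 1) k) = 1 / D * basis_vec T S"
      by (simp add: basis_vec_def D_def)
    have 2: "sqrt (1 - 1 / (real_of_int (axial_dist lam S (k + 1) k))\<^sup>2) * basis_vec T (adj_transp k \<circ> S) =
        (if ?T \<in> Tab lam then sqrt (1 - 1 / D\<^sup>2) * basis_vec ?T S else 0)"
      using sw[of S] D' z by (auto simp: basis_vec_def)
    show ?thesis unfolding young_op_def Let_def using 1 2 by simp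
  qed
  then show ?thesis unfolding D_def Let_def by blast
qed

theorem young_orthogonal_form_exists:
  assumes lam: "partition_of lam n"
  shows "\<exists>\<pi>. is_young_orthogonal_form lam \<pi>"
proof -
  obtain \<pi> where
    gen: "\<And>k x. k \<in> {1..<sum_list lam} \<Longrightarrow> x \<in> hspace (Tab lam) \<Longrightarrow> \<pi> (adj_transp k) x = young_op lam k x"
    and hom: "\<And>\<sigma> \<tau> x. \<sigma> permutes {1..sum_list lam} \<Longrightarrow> \<tau> permutes {1..sum_list lam} \<Longrightarrow>
      x \<in> hspace (Tab lam) \<Longrightarrow> \<pi> (\<sigma> \<circ> \<tau>) x = \<pi> \<sigma> (\<pi> \<tau> x)"
    and word: "\<And>\<sigma>. \<sigma> permutes {1..sum_list lam} \<Longrightarrow>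
      \<exists>w. set w \<subseteq> {1..<sum_list lam} \<and> \<pi> \<sigma> = foldr (young_op lam) w"
    using coxeter_ops_extend[OF coxeter_ops_young_op[OF lam]] by blast
  have "unitary_op (Tab lam) (foldr (young_op lam) w)" if "set w \<subseteq> {1..<sum_list lam}" for w
    using that
  proof (induction w)
    case Nil
    show ?case using unitary_op_id[of "Tab lam"] by (simp add: id_def)
  next
    case (Cons k w)
    then show ?case
      using unitary_op_comp[OF unitary_young_op[OF lam, of k], of "foldr (young_op lam) w"]
      by (simp add: comp_def)
  qed
  then have "unitary_op (Tab lam) (\<pi> \<sigma>)" if "\<sigma> permutes {1..sum_list lam}" for \<sigma>
    using word[OF that] by auto
  moreover have "basis_vec T \<in> hspace (Tab lam)" if "T \<in> Tab lam" for T
    using that by (auto simp: hspace_def basis_vec_def)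
  ultimately have "is_young_orthogonal_form lam \<pi>"
    unfolding is_young_orthogonal_form_def using hom gen young_op_basis[OF lam] by simp
  then show ?thesis by blast
qed

lemma young_rep_form:
  assumes "partition_of lam n"
  shows "is_young_orthogonal_form lam (young_rep lam)"
  unfolding young_rep_def by (rule someI_ex[OF young_orthogonal_form_exists[OF assms]])

section \<open>Branching for one added box\<close>

lemma basis_vec_hspace: "i \<in> I \<Longrightarrow> basis_vec i \<in> hspace I"
  by (auto simp: hspace_def basis_vec_def)

lemma iprod_commute: "iprod I x y = iprod I y x"
  by (simp add: iprod_def mult.commute)

lemma iprod_basis_right: "finite I \<Longrightarrow> i \<in> I \<Longrightarrow> iprod I x (basis_vec i) = x i"
  by (simp add: iprod_def basis_vec_def if_distrib[of "\<lambda>t. _ * t"] cong: if_cong)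

lemma iprod_basis_left: "finite I \<Longrightarrow> i \<in> I \<Longrightarrow> iprod I (basis_vec i) x = x i"
  by (subst iprod_commute) (rule iprod_basis_right)

lemma adj_op_hspace: "adj_op I J f y \<in> hspace I"
  by (simp add: adj_op_def hspace_def)

lemma lin_op_expand:
  assumes "finite I" "finite J" "lin_op I J f" "x \<in> hspace I"
  shows "f x j = (\<Sum>i\<in>I. x i * f (basis_vec i) j)"
proof (cases "j \<in> J")
  case True
  have "f x j = iprod J (f x) (basis_vec j)" using assms(2) True by (simp add: iprod_basis_right)
  also have "\<dots> = iprod I x (adj_op I J f (basis_vec j))" by (rule iprod_adj_op[OF assms(1,3,4)])
  also have "\<dots> = (\<Sum>i\<in>I. x i * f (basis_vec i) j)"
    unfolding iprod_def[of I] adj_op_def using assms(2) True by (simp add: iprod_basis_right)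
  finally show ?thesis .
next
  case False
  then have "f y j = 0" if "y \<in> hspace I" for y
    using that assms(3) hspaceD[of "f y" J j] unfolding lin_op_def by blast
  then show ?thesis using assms(4) basis_vec_hspace[of _ I] by simp
qed

lemma lin_op_eqI:
  assumes "finite I" "finite J" "lin_op I J f" "lin_op I J g" "x \<in> hspace I"
    and "\<And>i. i \<in> I \<Longrightarrow> f (basis_vec i) = g (basis_vec i)"
  shows "f x = g x"
  using lin_op_expand[OF assms(1,2,3,5)] lin_op_expand[OF assms(1,2,4,5)] assms(6) by (simp add: fun_eq_iff)

lemma isometry_opD:
  assumes "isometry_op I J f"
  shows "lin_op I J f" "\<And>x. x \<in> hspace I \<Longrightarrow> f x \<in> hspace J"
    and "\<And>x y. x \<in> hspace I \<Longrightarrow> y \<in> hspace I \<Longrightarrow> iprod J (f x) (f y) = iprod I x y"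
  using assms unfolding isometry_op_def lin_op_def by auto

lemma iprod_diff_square: "iprod I (\<lambda>i. x i - y i) (\<lambda>i. x i - y i) = iprod I x x - 2 * iprod I x y + iprod I y y"
  unfolding iprod_def sum_distrib_left sum_subtractf[symmetric] sum.distrib[symmetric]
  by (rule sum.cong) (auto simp: algebra_simps)

text \<open>Both sides are the squared norm of the orthogonal projection of \<open>w\<close> to the common image.\<close>

lemma adj_op_norm_le:
  assumes "finite I" "finite I'" "isometry_op I J f" "isometry_op I' J g"
    and img: "f ` hspace I = g ` hspace I'"
  shows "iprod I (adj_op I J f w) (adj_op I J f w) \<le> iprod I' (adj_op I' J g w) (adj_op I' J g w)"
proof -
  define x where "x = adj_op I J f w"
  define y where "y = adj_op I' J g w"
  have x: "x \<in> hspace I" and y: "y \<in> hspace I'" unfolding x_def y_def by (rule adj_op_hspace)+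
  obtain z where z: "z \<in> hspace I'" "f x = g z" using img x by (metis image_iff)
  have "iprod I x x = iprod J (f x) w"
    using iprod_adj_op[OF assms(1) isometry_opD(1)[OF assms(3)] x, of w] by (simp add: x_def)
  also have "\<dots> = iprod I' z y"
    using iprod_adj_op[OF assms(2) isometry_opD(1)[OF assms(4)] z(1), of w] by (simp add: y_def z(2))
  finally have 1: "iprod I x x = iprod I' z y" .
  have 2: "iprod I x x = iprod I' z z"
    using isometry_opD(3)[OF assms(3) x x] isometry_opD(3)[OF assms(4) z(1) z(1)] z(2) by simp
  have "0 \<le> iprod I' (\<lambda>i. z i - y i) (\<lambda>i. z i - y i)" unfolding iprod_def by (rule sum_nonneg) simp
  then show ?thesis using 1 2 unfolding iprod_diff_square x_def y_def by simp
qed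

lemma adj_op_norm_eq:
  assumes "finite I" "finite I'" "isometry_op I J f" "isometry_op I' J g"
    and "f ` hspace I = g ` hspace I'"
  shows "iprod I (adj_op I J f w) (adj_op I J f w) = iprod I' (adj_op I' J g w) (adj_op I' J g w)"
  using adj_op_norm_le[OF assms] adj_op_norm_le[OF assms(2,1,4,3) assms(5)[symmetric]] by (rule antisym)

section \<open>Young's form under the addition of one box\<close>

lemma young_repD:
  assumes "partition_of lam n"
  shows "\<And>\<sigma>. \<sigma> permutes {1..sum_list lam} \<Longrightarrow> isometry_op (Tab lam) (Tab lam) (young_rep lam \<sigma>)"
    and "\<And>\<sigma> \<tau> x. \<sigma> permutes {1..sum_list lam} \<Longrightarrow> \<tau> permutes {1..sum_list lam} \<Longrightarrow>
        x \<in> hspace (Tab lam) \<Longrightarrow> young_rep lam (\<sigma> \<circ> \<tau>) x = young_rep lam \<sigma> (young_rep lam \<tau> x)"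
    and "\<And>k T. k \<in> {1..<sum_list lam} \<Longrightarrow> T \<in> Tab lam \<Longrightarrow>
        young_rep lam (adj_transp k) (basis_vec T) =
          (let D = real_of_int (axial_dist lam T (k + 1) k); T' = adj_transp k \<circ> T in
             (\<lambda>S. 1 / D * basis_vec T S +
                (if T' \<in> Tab lam then sqrt (1 - 1 / D\<^sup>2) * basis_vec T' S else 0)))"
    and "\<And>x. x \<in> hspace (Tab lam) \<Longrightarrow> young_rep lam id x = x"
proof -
  note F = young_rep_form[OF assms, unfolded is_young_orthogonal_form_def]
  show "isometry_op (Tab lam) (Tab lam) (young_rep lam \<sigma>)" if "\<sigma> permutes {1..sum_list lam}" for \<sigma>
    using F that unfolding unitary_op_def by blast
  show hom: "young_rep lam (\<sigma> \<circ> \<tau>) x = young_rep lam \<sigma> (young_rep lam \<tau> x)"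
    if "\<sigma> permutes {1..sum_list lam}" "\<tau> permutes {1..sum_list lam}" "x \<in> hspace (Tab lam)" for \<sigma> \<tau> x
    using F that by blast
  show "young_rep lam (adj_transp k) (basis_vec T) =
          (let D = real_of_int (axial_dist lam T (k + 1) k); T' = adj_transp k \<circ> T in
             (\<lambda>S. 1 / D * basis_vec T S +
                (if T' \<in> Tab lam then sqrt (1 - 1 / D\<^sup>2) * basis_vec T' S else 0)))"
    if "k \<in> {1..<sum_list lam}" "T \<in> Tab lam" for k T
    using F that by blast
  show "young_rep lam id x = x" if "x \<in> hspace (Tab lam)" for x
  proof -
    \<comment> \<open>Young's form prescribes no value at the identity permutation; it acts as a
      surjective idempotent, hence trivially.\<close>
    have "young_rep lam id ` hspace (Tab lam) = hspace (Tab lam)"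
      using F permutes_id[of "{1..sum_list lam}"] unfolding unitary_op_def by blast
    then have "x \<in> young_rep lam id ` hspace (Tab lam)" using that by blast
    then obtain y where "y \<in> hspace (Tab lam)" "x = young_rep lam id y" by (rule imageE)
    then show ?thesis using hom[of id id y] permutes_id[of "{1..sum_list lam}"] by simp
  qed
qed

definition add_content :: "nat list \<Rightarrow> nat list \<Rightarrow> int" where
  "add_content mu lam = (let (i, j) = the_elem (boxes lam - boxes mu) in int j - int i)"

lemma up_partition: "lam \<in> up mu \<Longrightarrow> partition_of lam (sum_list mu + 1)"
  by (simp add: up_def)

lemma up_sum_list: "lam \<in> up mu \<Longrightarrow> sum_list lam = sum_list mu + 1"
  by (simp add: up_def partition_of_def)

context
  fixes mu lam :: "nat list" and p :: "nat \<times> nat"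
  assumes mu: "partition_of mu (sum_list mu)" and lam: "lam \<in> up mu"
    and p: "p \<notin> boxes mu" "boxes lam = insert p (boxes mu)"
begin

lemma extend_tab_upd: "R \<in> Tab mu \<Longrightarrow> extend_tab lam mu R = R(p := Suc (sum_list mu))"
  unfolding extend_tab_def using p up_sum_list[OF lam] by (auto simp: fun_eq_iff)

lemma shapes: "young_shape (boxes mu)" "young_shape (insert p (boxes mu))"
  using young_shape_boxes[OF mu] young_shape_boxes[OF up_partition[OF lam]] p by auto

lemma extend_tab_in_aux: "R \<in> Tab mu \<Longrightarrow> extend_tab lam mu R \<in> Tab lam"
  using Syt_insertI[of R "boxes mu" p] p shapes extend_tab_upd[of R] unfolding Tab_eq_Syt card_boxes by simp

lemma extend_tab_inj_aux: "R \<in> Tab mu \<Longrightarrow> S \<in> Tab mu \<Longrightarrow> extend_tab lam mu R = extend_tab lam mu S \<Longrightarrow> R = S"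
  using SytD(2)[of R "boxes mu" p] SytD(2)[of S "boxes mu" p] p(1) extend_tab_upd[of R] extend_tab_upd[of S]
  unfolding Tab_eq_Syt by (metis fun_upd_triv fun_upd_upd)

lemma extend_tab_swap_aux:
  assumes "R \<in> Tab mu" "k \<in> {1..<sum_list mu}"
  shows "adj_transp k \<circ> extend_tab lam mu R = (adj_transp k \<circ> R)(p := Suc (sum_list mu))"
    and "adj_transp k \<circ> extend_tab lam mu R \<in> Tab lam \<longleftrightarrow> adj_transp k \<circ> R \<in> Tab mu"
proof -
  show e: "adj_transp k \<circ> extend_tab lam mu R = (adj_transp k \<circ> R)(p := Suc (sum_list mu))"
    unfolding extend_tab_upd[OF assms(1)] using assms(2) by (auto simp: fun_eq_iff transpose_def)
  show "adj_transp k \<circ> extend_tab lam mu R \<in> Tab lam \<longleftrightarrow> adj_transp k \<circ> R \<in> Tab mu"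
  proof
    assume "adj_transp k \<circ> R \<in> Tab mu"
    then show "adj_transp k \<circ> extend_tab lam mu R \<in> Tab lam"
      unfolding e using extend_tab_in_aux extend_tab_upd by metis
  next
    assume "adj_transp k \<circ> extend_tab lam mu R \<in> Tab lam"
    then have "(adj_transp k \<circ> extend_tab lam mu R)(p := 0) \<in> Syt (boxes mu)"
      unfolding Tab_eq_Syt p(2)
      by (rule Syt_insertD) (use p shapes e in \<open>auto simp: young_shape_def card_boxes\<close>)
    moreover have "R p = 0" using SytD(2)[of R "boxes mu" p] p(1) assms(1) by (simp add: Tab_eq_Syt)
    then have "(adj_transp k \<circ> extend_tab lam mu R)(p := 0) = adj_transp k \<circ> R"
      unfolding e using assms(2) by (auto simp: fun_eq_iff transpose_def)
    ultimately show "adj_transp k \<circ> R \<in> Tab mu" by (simp add: Tab_eq_Syt)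
  qed
qed

lemma content_at_extend_aux:
  assumes "R \<in> Tab mu"
  shows "a \<in> {1..sum_list mu} \<Longrightarrow> content_at lam (extend_tab lam mu R) a = content_at mu R a"
    and "content_at lam (extend_tab lam mu R) (sum_list mu + 1) = add_content mu lam"
proof -
  have T: "extend_tab lam mu R \<in> Tab lam" by (rule extend_tab_in_aux[OF assms])
  show "content_at lam (extend_tab lam mu R) a = content_at mu R a" if a: "a \<in> {1..sum_list mu}"
  proof -
    obtain i j where ij: "(i, j) \<in> boxes mu" "R (i, j) = a" by (rule Tab_obtain_box[OF assms a])
    then have "extend_tab lam mu R (i, j) = a" using extend_tab_upd[OF assms] p by auto
    then show ?thesis
      using content_at_eq[OF assms ij(1)] content_at_eq[OF T, of i j] ij p by simp
  qed
  obtain i j where pp: "p = (i, j)" by (cases p)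
  have "boxes lam - boxes mu = {p}" using p by auto
  then have "add_content mu lam = int j - int i" by (simp add: add_content_def pp)
  then show "content_at lam (extend_tab lam mu R) (sum_list mu + 1) = add_content mu lam"
    using content_at_eq[OF T, of i j] p pp extend_tab_upd[OF assms] by simp
qed

text \<open>Exchanging the two largest entries takes the largest one out of the added box, so the
  result is no extension. This is what makes the compression of s_(n-1) diagonal.\<close>

lemma extend_tab_last_aux:
  assumes "R \<in> Tab mu" "S \<in> Tab mu" "sum_list mu \<ge> 1"
  shows "adj_transp (sum_list mu) \<circ> extend_tab lam mu R \<noteq> extend_tab lam mu S"
proof
  assume "adj_transp (sum_list mu) \<circ> extend_tab lam mu R = extend_tab lam mu S"
  from fun_cong[OF this, of p] show False
    unfolding extend_tab_upd[OF assms(1)] extend_tab_upd[OF assms(2)] using assms(3) by simp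
qed

end

locale branching =
  fixes mu lam :: "nat list"
  assumes mu: "partition_of mu (sum_list mu)" and pos: "sum_list mu \<ge> 1" and lam: "lam \<in> up mu"
begin

abbreviation "ext \<equiv> extend_tab lam mu"

lemma partition_lam: "partition_of lam (sum_list mu + 1)" and sum_lam: "sum_list lam = sum_list mu + 1"
  using up_partition[OF lam] up_sum_list[OF lam] .

lemma ext_in: "R \<in> Tab mu \<Longrightarrow> ext R \<in> Tab lam"
  and ext_inj: "R \<in> Tab mu \<Longrightarrow> S \<in> Tab mu \<Longrightarrow> ext R = ext S \<longleftrightarrow> R = S"
  and ext_swap: "R \<in> Tab mu \<Longrightarrow> k \<in> {1..<sum_list mu} \<Longrightarrow>
    adj_transp k \<circ> ext R \<in> Tab lam \<longleftrightarrow> adj_transp k \<circ> R \<in> Tab mu"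
  and ext_swap_eq: "R \<in> Tab mu \<Longrightarrow> k \<in> {1..<sum_list mu} \<Longrightarrow> adj_transp k \<circ> R \<in> Tab mu \<Longrightarrow>
    adj_transp k \<circ> ext R = ext (adj_transp k \<circ> R)"
  and content_ext: "R \<in> Tab mu \<Longrightarrow> a \<in> {1..sum_list mu} \<Longrightarrow> content_at lam (ext R) a = content_at mu R a"
  and content_ext_last: "R \<in> Tab mu \<Longrightarrow> content_at lam (ext R) (sum_list mu + 1) = add_content mu lam"
  and ext_last: "R \<in> Tab mu \<Longrightarrow> S \<in> Tab mu \<Longrightarrow> adj_transp (sum_list mu) \<circ> ext R \<noteq> ext S"
proof -
  obtain p where p: "p \<notin> boxes mu" "boxes lam = insert p (boxes mu)" using lam by (auto simp: up_def)
  note A = mu lam p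
  show "R \<in> Tab mu \<Longrightarrow> ext R \<in> Tab lam" by (rule extend_tab_in_aux[OF A])
  show "R \<in> Tab mu \<Longrightarrow> S \<in> Tab mu \<Longrightarrow> ext R = ext S \<longleftrightarrow> R = S" using extend_tab_inj_aux[OF A] by blast
  show "R \<in> Tab mu \<Longrightarrow> k \<in> {1..<sum_list mu} \<Longrightarrow>
    adj_transp k \<circ> ext R \<in> Tab lam \<longleftrightarrow> adj_transp k \<circ> R \<in> Tab mu" by (rule extend_tab_swap_aux(2)[OF A])
  show "R \<in> Tab mu \<Longrightarrow> k \<in> {1..<sum_list mu} \<Longrightarrow> adj_transp k \<circ> R \<in> Tab mu \<Longrightarrow>
    adj_transp k \<circ> ext R = ext (adj_transp k \<circ> R)"
    using extend_tab_swap_aux(1)[OF A] extend_tab_upd[OF A] by metis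
  show "R \<in> Tab mu \<Longrightarrow> a \<in> {1..sum_list mu} \<Longrightarrow> content_at lam (ext R) a = content_at mu R a"
    by (rule content_at_extend_aux(1)[OF A])
  show "R \<in> Tab mu \<Longrightarrow> content_at lam (ext R) (sum_list mu + 1) = add_content mu lam"
    by (rule content_at_extend_aux(2)[OF A])
  show "R \<in> Tab mu \<Longrightarrow> S \<in> Tab mu \<Longrightarrow> adj_transp (sum_list mu) \<circ> ext R \<noteq> ext S"
    using extend_tab_last_aux[OF A] pos by blast
qed

lemma Psi_basis: "R \<in> Tab mu \<Longrightarrow> Psi lam mu (basis_vec R) = basis_vec (ext R)"
  unfolding Psi_def using finite_Tab[of mu]
  by (intro ext) (simp add: basis_vec_def[of R] if_distrib[of "\<lambda>t. t * _"] cong: if_cong)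

lemma Psi_ext: "R \<in> Tab mu \<Longrightarrow> Psi lam mu v (ext R) = v R"
proof -
  assume R: "R \<in> Tab mu"
  have "Psi lam mu v (ext R) = (\<Sum>S\<in>Tab mu. if S = R then v S else 0)"
    unfolding Psi_def by (rule sum.cong) (use R ext_inj in \<open>auto simp: basis_vec_def\<close>)
  then show ?thesis using R finite_Tab[of mu] by simp
qed

lemma Psi_hspace: "Psi lam mu v \<in> hspace (Tab lam)"
  unfolding Psi_def hspace_def using ext_in by (auto simp: basis_vec_def intro!: sum.neutral)

lemma Psi_add: "Psi lam mu (\<lambda>R. u R + v R) = (\<lambda>T. Psi lam mu u T + Psi lam mu v T)"
  unfolding Psi_def by (simp add: distrib_right sum.distrib)

lemma Psi_scale: "Psi lam mu (\<lambda>R. r * v R) = (\<lambda>T. r * Psi lam mu v T)"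
  unfolding Psi_def by (simp add: sum_distrib_left mult.assoc)

lemma Psi_lin: "lin_op (Tab mu) (Tab lam) (Psi lam mu)"
  unfolding lin_op_def using Psi_hspace Psi_add Psi_scale by blast

lemma iprod_Psi: "iprod (Tab lam) (Psi lam mu u) y = (\<Sum>R\<in>Tab mu. u R * y (ext R))"
proof -
  have "iprod (Tab lam) (Psi lam mu u) y = (\<Sum>T\<in>Tab lam. \<Sum>R\<in>Tab mu. u R * (basis_vec (ext R) T * y T))"
    unfolding iprod_def Psi_def by (simp add: sum_distrib_right mult.assoc)
  also have "\<dots> = (\<Sum>R\<in>Tab mu. u R * iprod (Tab lam) (basis_vec (ext R)) y)"
    unfolding iprod_def by (subst sum.swap) (simp add: sum_distrib_left)
  also have "\<dots> = (\<Sum>R\<in>Tab mu. u R * y (ext R))"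
    by (rule sum.cong) (auto simp: iprod_basis_left finite_Tab ext_in)
  finally show ?thesis .
qed

lemma iprod_Psi_Psi: "iprod (Tab lam) (Psi lam mu u) (Psi lam mu v) = iprod (Tab mu) u v"
  unfolding iprod_Psi by (simp add: iprod_def Psi_ext)

lemma permutes_up: "\<sigma> permutes {1..sum_list mu} \<Longrightarrow> \<sigma> permutes {1..sum_list lam}"
  using sum_lam by (auto intro: permutes_subset)

text \<open>For k + 1 < n the box of n affects neither the axial distance of k and k + 1 nor the
  standardness of the swap, so Young's formula reads the same for both shapes.\<close>

lemma intertwine_gen:
  assumes k: "k \<in> {1..<sum_list mu}" and v: "v \<in> hspace (Tab mu)"
  shows "young_rep lam (adj_transp k) (Psi lam mu v) = Psi lam mu (young_rep mu (adj_transp k) v)"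
proof -
  have s: "adj_transp k permutes {1..sum_list mu}" using k by (intro permutes_swap_id) auto
  have lmu: "lin_op (Tab mu) (Tab mu) (young_rep mu (adj_transp k))"
    by (rule isometry_opD(1)[OF young_repD(1)[OF mu s]])
  have llam: "lin_op (Tab lam) (Tab lam) (young_rep lam (adj_transp k))"
    by (rule isometry_opD(1)[OF young_repD(1)[OF partition_lam permutes_up[OF s]]])
  have "(young_rep lam (adj_transp k) \<circ> Psi lam mu) v = (Psi lam mu \<circ> young_rep mu (adj_transp k)) v"
  proof (rule lin_op_eqI[OF finite_Tab finite_Tab _ _ v])
    show "lin_op (Tab mu) (Tab lam) (young_rep lam (adj_transp k) \<circ> Psi lam mu)"
      using llam Psi_lin unfolding lin_op_def by simp
    show "lin_op (Tab mu) (Tab lam) (Psi lam mu \<circ> young_rep mu (adj_transp k))"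
      using lmu Psi_lin unfolding lin_op_def by simp
    fix R assume R: "R \<in> Tab mu"
    have k': "k \<in> {1..<sum_list lam}" using k sum_lam by simp
    have ax: "axial_dist lam (ext R) (k + 1) k = axial_dist mu R (k + 1) k"
      unfolding axial_dist_def using content_ext[OF R, of k] content_ext[OF R, of "k + 1"] k by simp
    define D where "D = real_of_int (axial_dist mu R (k + 1) k)"
    \<comment> \<open>If the swap is not standard, \<open>c\<close> is zero and \<open>R'\<close> is
      a placeholder; both cases then have the same form.\<close>
    define c where "c = (if adj_transp k \<circ> R \<in> Tab mu then sqrt (1 - 1 / D\<^sup>2) else 0)"
    define R' where "R' = (if adj_transp k \<circ> R \<in> Tab mu then adj_transp k \<circ> R else R)"
    have R': "R' \<in> Tab mu" unfolding R'_def using R by simp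
    have 1: "young_rep mu (adj_transp k) (basis_vec R) = (\<lambda>S. 1 / D * basis_vec R S + c * basis_vec R' S)"
      unfolding young_repD(3)[OF mu k R] Let_def D_def[symmetric] c_def R'_def by (simp add: fun_eq_iff)
    have 2: "young_rep lam (adj_transp k) (basis_vec (ext R)) =
        (\<lambda>S. 1 / D * basis_vec (ext R) S + c * basis_vec (ext R') S)"
      unfolding young_repD(3)[OF partition_lam k' ext_in[OF R]] Let_def ax D_def[symmetric] c_def R'_def
      using ext_swap[OF R k] ext_swap_eq[OF R k] by simp
    show "(young_rep lam (adj_transp k) \<circ> Psi lam mu) (basis_vec R) =
        (Psi lam mu \<circ> young_rep mu (adj_transp k)) (basis_vec R)"
      unfolding comp_apply 1 Psi_basis[OF R] 2 Psi_add Psi_scale Psi_basis[OF R'] ..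
  qed
  then show ?thesis by simp
qed

lemma intertwine:
  assumes "\<sigma> permutes {1..sum_list mu}" and v: "v \<in> hspace (Tab mu)"
  shows "young_rep lam \<sigma> (Psi lam mu v) = Psi lam mu (young_rep mu \<sigma> v)"
proof -
  obtain w where w: "set w \<subseteq> {1..<sum_list mu}" "foldr adj_transp w = \<sigma>"
    using adj_word_exists[OF assms(1)] by blast
  have "young_rep lam (foldr adj_transp w) (Psi lam mu v) = Psi lam mu (young_rep mu (foldr adj_transp w) v)"
    using w(1)
  proof (induction w)
    case Nil
    then show ?case
      using young_repD(4)[OF mu v] young_repD(4)[OF partition_lam Psi_hspace] by (simp add: id_def)
  next
    case (Cons k w)
    have k: "k \<in> {1..<sum_list mu}" and w: "set w \<subseteq> {1..<sum_list mu}" using Cons.prems by auto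
    have p1: "adj_transp k permutes {1..sum_list mu}" using k by (intro permutes_swap_id) auto
    have p2: "foldr adj_transp w permutes {1..sum_list mu}" by (rule adj_word_permutes[OF w])
    have f: "foldr adj_transp (k # w) = adj_transp k \<circ> foldr adj_transp w" by simp
    have h: "young_rep mu (foldr adj_transp w) v \<in> hspace (Tab mu)"
      by (rule isometry_opD(2)[OF young_repD(1)[OF mu p2] v])
    show ?case
      unfolding f young_repD(2)[OF mu p1 p2 v]
        young_repD(2)[OF partition_lam permutes_up[OF p1] permutes_up[OF p2] Psi_hspace]
        Cons.IH[OF w] intertwine_gen[OF k h] ..
  qed
  then show ?thesis using w(2) by simp
qed

text \<open>Of the two terms in Young's formula the second is orthogonal to the image of
  \<open>Psi\<close> by \<open>ext_last\<close>. The first leaves the reciprocal of the axial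
  distance between n, in the added box, and n - 1.\<close>

lemma compress_last:
  assumes v: "v \<in> hspace (Tab mu)"
  shows "iprod (Tab lam) (Psi lam mu u) (young_rep lam (adj_transp (sum_list mu)) (Psi lam mu v)) =
    (\<Sum>R\<in>Tab mu. u R * (1 / real_of_int (add_content mu lam - content_at mu R (sum_list mu)) * v R))"
proof -
  let ?s = "adj_transp (sum_list mu)"
  let ?m = "\<lambda>R. 1 / real_of_int (add_content mu lam - content_at mu R (sum_list mu))"
  have k: "sum_list mu \<in> {1..<sum_list lam}" using pos sum_lam by simp
  have s: "?s permutes {1..sum_list lam}" using k by (intro permutes_swap_id) auto
  have llam: "lin_op (Tab lam) (Tab lam) (young_rep lam ?s)"
    by (rule isometry_opD(1)[OF young_repD(1)[OF partition_lam s]])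
  have l: "lin_op (Tab mu) (Tab lam) (young_rep lam ?s \<circ> Psi lam mu)"
    using llam Psi_lin unfolding lin_op_def by simp
  have "young_rep lam ?s (Psi lam mu v) (ext R) = ?m R * v R" if R: "R \<in> Tab mu" for R
  proof -
    have "young_rep lam ?s (Psi lam mu v) (ext R) =
        (\<Sum>S\<in>Tab mu. v S * (young_rep lam ?s \<circ> Psi lam mu) (basis_vec S) (ext R))"
      using lin_op_expand[OF finite_Tab finite_Tab l v, of "ext R"] by simp
    also have "\<dots> = (\<Sum>S\<in>Tab mu. if S = R then v S * ?m S else 0)"
    proof (rule sum.cong[OF refl])
      fix S assume S: "S \<in> Tab mu"
      have ax: "axial_dist lam (ext S) (sum_list mu + 1) (sum_list mu) = add_content mu lam - content_at mu S (sum_list mu)"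
        unfolding axial_dist_def content_ext_last[OF S] using content_ext[OF S, of "sum_list mu"] pos by simp
      have "basis_vec (?s \<circ> ext S) (ext R) = 0" using ext_last[OF S R] by (auto simp: basis_vec_def)
      then show "v S * (young_rep lam ?s \<circ> Psi lam mu) (basis_vec S) (ext R) = (if S = R then v S * ?m S else 0)"
        unfolding comp_apply Psi_basis[OF S] young_repD(3)[OF partition_lam k ext_in[OF S]] Let_def ax
        using ext_inj[OF R S] by (auto simp: basis_vec_def)
    qed
    finally show ?thesis using R finite_Tab[of mu] by simp
  qed
  then show ?thesis unfolding iprod_Psi by (intro sum.cong) auto
qed

end

section \<open>Isoclinic partitions and diagonal operators\<close>

lemma iprod_Sigma:
  assumes "finite L"
  shows "iprod (Sigma L Tab) x y = (\<Sum>lam\<in>L. iprod (Tab lam) (\<lambda>S. x (lam, S)) (\<lambda>S. y (lam, S)))"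
  unfolding iprod_def by (subst sum.Sigma) (use assms finite_Tab in \<open>auto simp: case_prod_beta\<close>)

lemma iprod_scale: "iprod I (\<lambda>i. r * x i) (\<lambda>i. s * y i) = r * s * iprod I x y"
  unfolding iprod_def sum_distrib_left by (rule sum.cong) (auto simp: mult_ac)

lemma lin_op_adj_op: "lin_op J I (adj_op I J f)"
proof -
  have "iprod J z (\<lambda>i. x i + y i) = iprod J z x + iprod J z y"
    and "iprod J z (\<lambda>i. r * x i) = r * iprod J z x" for x y z r
    by (simp_all add: iprod_def distrib_left sum.distrib sum_distrib_left mult_ac)
  then show ?thesis unfolding lin_op_def adj_op_def by (auto simp: hspace_def)
qed

text \<open>If \<sigma> sends m + 1 to j, then the transposition of j and m followed by s_m brings j
  back to m + 1, so the composite with \<sigma> fixes m + 1.\<close>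

lemma double_coset:
  assumes \<sigma>: "\<sigma> permutes {1..m + 1}" and "\<sigma> (m + 1) \<noteq> m + 1" and m: "m \<ge> (1::nat)"
  obtains g h where "g permutes {1..m}" "h permutes {1..m}" "\<sigma> = g \<circ> (adj_transp m \<circ> h)"
proof
  define j where "j = \<sigma> (m + 1)"
  have "j \<in> {1..m + 1}" unfolding j_def using permutes_in_image[OF \<sigma>, of "m + 1"] by simp
  then have j: "j \<in> {1..m}" using assms(2) unfolding j_def by auto
  define g where "g = Transposition.transpose j m"
  define h where "h = adj_transp m \<circ> (g \<circ> \<sigma>)"
  show g: "g permutes {1..m}" unfolding g_def using j by (intro permutes_swap_id) auto
  have "h permutes {1..m + 1}"
    unfolding h_def g_def using j by (intro permutes_compose \<sigma> permutes_swap_id) auto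
  moreover have "h (m + 1) = m + 1" unfolding h_def g_def comp_apply j_def[symmetric] by simp
  ultimately show "h permutes {1..m}"
    unfolding permutes_def by (metis Suc_eq_plus1 atLeastAtMost_iff le_SucE)
  show "\<sigma> = g \<circ> (adj_transp m \<circ> h)" unfolding h_def g_def by simp
qed

locale branching_sum =
  fixes mu :: "nat list" and L :: "nat list set"
  assumes mu: "partition_of mu (sum_list mu)" and pos: "sum_list mu \<ge> 1" and L: "L \<subseteq> up mu"
    and fin: "finite L" and ne: "L \<noteq> {}" and dim_pos: "\<And>lam. lam \<in> L \<Longrightarrow> dim lam > 0"
begin

abbreviation "J \<equiv> Sigma L Tab"
abbreviation "n \<equiv> sum_list mu + 1"
abbreviation "\<rho> \<equiv> young_rep_sum L"
abbreviation "\<Psi> \<equiv> Psi_sum L mu"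

text \<open>The diagonal entries of the compression of s_(n-1) to the subspace; the weights are the
  squares of the coefficients in \<open>Psi_sum\<close>.\<close>

definition mult :: "tableau \<Rightarrow> real" where
  "mult R = (\<Sum>lam\<in>L. real (dim lam) / real (dim_sum L) *
     (1 / real_of_int (add_content mu lam - content_at mu R (sum_list mu))))"

lemma br: "lam \<in> L \<Longrightarrow> branching mu lam"
  using L mu pos by unfold_locales auto

lemma partition_L: "lam \<in> L \<Longrightarrow> partition_of lam n"
  by (rule branching.partition_lam[OF br])

lemma sum_L: "lam \<in> L \<Longrightarrow> sum_list lam = n"
  by (rule branching.sum_lam[OF br])

lemma dim_sum_pos: "dim_sum L > 0"
  unfolding dim_sum_def using fin ne dim_pos by (intro sum_pos) auto

lemma comp_hspace: "x \<in> hspace J \<Longrightarrow> lam \<in> L \<Longrightarrow> (\<lambda>S. x (lam, S)) \<in> hspace (Tab lam)"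
  by (auto simp: hspace_def)

lemma rho_apply: "lam \<in> L \<Longrightarrow> (\<lambda>S. \<rho> \<sigma> x (lam, S)) = young_rep lam \<sigma> (\<lambda>S. x (lam, S))"
  by (simp add: young_rep_sum_def)

lemma Psi_sum_apply: "lam \<in> L \<Longrightarrow> (\<lambda>S. \<Psi> v (lam, S)) =
    (\<lambda>S. sqrt (real (dim lam) / real (dim_sum L)) * Psi lam mu v S)"
  by (simp add: Psi_sum_def)

lemma rho_isometry:
  assumes \<sigma>: "\<sigma> permutes {1..n}"
  shows "isometry_op J J (\<rho> \<sigma>)"
proof -
  have I: "isometry_op (Tab lam) (Tab lam) (young_rep lam \<sigma>)" if "lam \<in> L" for lam
    using young_repD(1)[OF partition_L[OF that]] \<sigma> sum_L[OF that] by simp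
  have "lin_op J J (\<rho> \<sigma>)"
    unfolding lin_op_def
  proof (intro conjI ballI allI)
    fix x assume x: "x \<in> hspace J"
    show "\<rho> \<sigma> x \<in> hspace J"
      unfolding hspace_def
    proof (intro CollectI allI impI)
      fix q assume "q \<notin> J"
      then show "\<rho> \<sigma> x q = 0"
        using hspaceD[OF isometry_opD(2)[OF I comp_hspace[OF x]]]
        by (cases q) (auto simp: young_rep_sum_def)
    qed
    fix r
    show "\<rho> \<sigma> (\<lambda>i. r * x i) = (\<lambda>j. r * \<rho> \<sigma> x j)"
      using isometry_opD(1)[OF I] comp_hspace[OF x] by (auto simp: young_rep_sum_def lin_op_def)
  next
    fix x y assume x: "x \<in> hspace J" and y: "y \<in> hspace J"
    show "\<rho> \<sigma> (\<lambda>i. x i + y i) = (\<lambda>j. \<rho> \<sigma> x j + \<rho> \<sigma> y j)"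
      using isometry_opD(1)[OF I] comp_hspace[OF x] comp_hspace[OF y]
      by (auto simp: young_rep_sum_def lin_op_def)
  qed
  moreover have "iprod J (\<rho> \<sigma> x) (\<rho> \<sigma> y) = iprod J x y" if "x \<in> hspace J" "y \<in> hspace J" for x y
    unfolding iprod_Sigma[OF fin]
    by (rule sum.cong[OF refl]) (simp add: rho_apply isometry_opD(3)[OF I] comp_hspace that)
  ultimately show ?thesis unfolding isometry_op_def by blast
qed

lemma rho_hom:
  assumes "\<sigma> permutes {1..n}" "\<tau> permutes {1..n}" "x \<in> hspace J"
  shows "\<rho> (\<sigma> \<circ> \<tau>) x = \<rho> \<sigma> (\<rho> \<tau> x)"
proof -
  have "young_rep lam (\<sigma> \<circ> \<tau>) (\<lambda>S. x (lam, S)) = young_rep lam \<sigma> (young_rep lam \<tau> (\<lambda>S. x (lam, S)))"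
    if "lam \<in> L" for lam
    using young_repD(2)[OF partition_L[OF that]] assms(1,2) sum_L[OF that] comp_hspace[OF assms(3) that] by simp
  then show ?thesis by (auto simp: young_rep_sum_def fun_eq_iff)
qed

lemma rho_id: "x \<in> hspace J \<Longrightarrow> \<rho> id x = x"
  using young_repD(4)[OF partition_L] comp_hspace[of x]
  by (auto simp: young_rep_sum_def fun_eq_iff hspaceD)

lemma iprod_rho_move:
  assumes "\<sigma> permutes {1..n}" "x \<in> hspace J" "y \<in> hspace J"
  shows "iprod J x (\<rho> \<sigma> y) = iprod J (\<rho> (inv \<sigma>) x) y"
proof -
  have i: "inv \<sigma> permutes {1..n}" by (rule permutes_inv[OF assms(1)])
  have h: "\<rho> (inv \<sigma>) x \<in> hspace J" by (rule isometry_opD(2)[OF rho_isometry[OF i] assms(2)])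
  have "x = \<rho> \<sigma> (\<rho> (inv \<sigma>) x)"
    using rho_hom[OF assms(1) i assms(2)] rho_id[OF assms(2)] permutes_inv_o(1)[OF assms(1)] by simp
  then show ?thesis
    using isometry_opD(3)[OF rho_isometry[OF assms(1)] h assms(3)] by simp
qed

lemma Psi_sum_isometry: "isometry_op (Tab mu) J \<Psi>"
proof -
  have "lin_op (Tab mu) J \<Psi>"
    unfolding lin_op_def
  proof (intro conjI ballI allI)
    fix v
    show "\<Psi> v \<in> hspace J"
      using hspaceD[OF branching.Psi_hspace[OF br]] by (auto simp: hspace_def Psi_sum_def)
    show "\<Psi> (\<lambda>i. r * v i) = (\<lambda>j. r * \<Psi> v j)" for r
      using branching.Psi_scale[OF br] by (auto simp: Psi_sum_def fun_eq_iff)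
    show "\<Psi> (\<lambda>i. u i + v i) = (\<lambda>j. \<Psi> u j + \<Psi> v j)" for u
      using branching.Psi_add[OF br] by (auto simp: Psi_sum_def fun_eq_iff distrib_left)
  qed
  moreover have "iprod J (\<Psi> u) (\<Psi> v) = iprod (Tab mu) u v" for u v
  proof -
    have "iprod J (\<Psi> u) (\<Psi> v) = (\<Sum>lam\<in>L. real (dim lam) / real (dim_sum L) * iprod (Tab mu) u v)"
      unfolding iprod_Sigma[OF fin]
    proof (rule sum.cong[OF refl])
      fix lam assume l: "lam \<in> L"
      let ?c = "sqrt (real (dim lam) / real (dim_sum L))"
      have "iprod (Tab lam) (\<lambda>S. \<Psi> u (lam, S)) (\<lambda>S. \<Psi> v (lam, S)) =
          ?c * ?c * iprod (Tab lam) (Psi lam mu u) (Psi lam mu v)"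
        unfolding Psi_sum_apply[OF l] by (rule iprod_scale)
      then show "iprod (Tab lam) (\<lambda>S. \<Psi> u (lam, S)) (\<lambda>S. \<Psi> v (lam, S)) =
          real (dim lam) / real (dim_sum L) * iprod (Tab mu) u v"
        using branching.iprod_Psi_Psi[OF br[OF l]] by simp
    qed
    also have "\<dots> = (\<Sum>lam\<in>L. real (dim lam)) / real (dim_sum L) * iprod (Tab mu) u v"
      by (simp add: sum_distrib_right sum_divide_distrib)
    also have "(\<Sum>lam\<in>L. real (dim lam)) = real (dim_sum L)" by (simp add: dim_sum_def)
    finally show ?thesis using dim_sum_pos by simp
  qed
  ultimately show ?thesis unfolding isometry_op_def by blast
qed

lemma Psi_sum_hspace: "v \<in> hspace (Tab mu) \<Longrightarrow> \<Psi> v \<in> hspace J"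
  by (rule isometry_opD(2)[OF Psi_sum_isometry])

lemma permutes_n: "\<sigma> permutes {1..sum_list mu} \<Longrightarrow> \<sigma> permutes {1..n}"
  by (rule permutes_subset) auto

lemma young_rep_mu_hspace:
  "g permutes {1..sum_list mu} \<Longrightarrow> v \<in> hspace (Tab mu) \<Longrightarrow> young_rep mu g v \<in> hspace (Tab mu)"
  using isometry_opD(2)[OF young_repD(1)[OF mu]] .

lemma intertwine_sum:
  assumes g: "g permutes {1..sum_list mu}" and v: "v \<in> hspace (Tab mu)"
  shows "\<rho> g (\<Psi> v) = \<Psi> (young_rep mu g v)"
proof -
  have "young_rep lam g (\<lambda>S. \<Psi> v (lam, S)) T =
      sqrt (real (dim lam) / real (dim_sum L)) * Psi lam mu (young_rep mu g v) T" if l: "lam \<in> L" for lam T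
  proof -
    have "lin_op (Tab lam) (Tab lam) (young_rep lam g)"
      using isometry_opD(1)[OF young_repD(1)[OF partition_L[OF l]]] permutes_n[OF g] sum_L[OF l] by simp
    then show ?thesis
      unfolding Psi_sum_apply[OF l] lin_op_def
      using branching.Psi_hspace[OF br[OF l]] branching.intertwine[OF br[OF l] g v] by simp
  qed
  then show ?thesis by (auto simp: young_rep_sum_def Psi_sum_def[of L mu "young_rep mu g v"] fun_eq_iff)
qed

lemma compress_last_sum:
  assumes v: "v \<in> hspace (Tab mu)"
  shows "iprod J (\<Psi> u) (\<rho> (adj_transp (sum_list mu)) (\<Psi> v)) = iprod (Tab mu) u (\<lambda>R. mult R * v R)"
proof -
  let ?s = "adj_transp (sum_list mu)"
  let ?m = "\<lambda>lam R. 1 / real_of_int (add_content mu lam - content_at mu R (sum_list mu))"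
  have "iprod J (\<Psi> u) (\<rho> ?s (\<Psi> v)) =
      (\<Sum>lam\<in>L. \<Sum>R\<in>Tab mu. u R * (real (dim lam) / real (dim_sum L) * ?m lam R * v R))"
    unfolding iprod_Sigma[OF fin]
  proof (rule sum.cong[OF refl])
    fix lam assume l: "lam \<in> L"
    let ?c = "sqrt (real (dim lam) / real (dim_sum L))"
    have "?s permutes {1..sum_list lam}" unfolding sum_L[OF l] using pos by (intro permutes_swap_id) auto
    then have "lin_op (Tab lam) (Tab lam) (young_rep lam ?s)"
      using isometry_opD(1)[OF young_repD(1)[OF partition_L[OF l]]] by blast
    then have "(\<lambda>S. \<rho> ?s (\<Psi> v) (lam, S)) = (\<lambda>S. ?c * young_rep lam ?s (Psi lam mu v) S)"
      unfolding rho_apply[OF l] Psi_sum_apply[OF l] lin_op_def using branching.Psi_hspace[OF br[OF l]] by simp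
    then have "iprod (Tab lam) (\<lambda>S. \<Psi> u (lam, S)) (\<lambda>S. \<rho> ?s (\<Psi> v) (lam, S)) =
        ?c * ?c * iprod (Tab lam) (Psi lam mu u) (young_rep lam ?s (Psi lam mu v))"
      unfolding Psi_sum_apply[OF l] by (simp only: iprod_scale)
    then show "iprod (Tab lam) (\<lambda>S. \<Psi> u (lam, S)) (\<lambda>S. \<rho> ?s (\<Psi> v) (lam, S)) =
        (\<Sum>R\<in>Tab mu. u R * (real (dim lam) / real (dim_sum L) * ?m lam R * v R))"
      unfolding branching.compress_last[OF br[OF l] v] by (simp add: sum_distrib_left mult_ac)
  qed
  also have "\<dots> = iprod (Tab mu) u (\<lambda>R. mult R * v R)"
    unfolding iprod_def mult_def by (subst sum.swap) (simp add: sum_distrib_left sum_distrib_right)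
  finally show ?thesis .
qed

lemma mult_hspace: "v \<in> hspace (Tab mu) \<Longrightarrow> (\<lambda>R. mult R * v R) \<in> hspace (Tab mu)"
  by (simp add: hspace_def)

context
  fixes t :: "nat \<Rightarrow> nat \<Rightarrow> nat"
  assumes t: "\<forall>k\<in>{1..n}. t k permutes {1..n} \<and> t k n = k"
begin

text \<open>The canonical isometries onto the members of the family; any others are compared with
  these.\<close>

definition \<Theta> :: "nat \<Rightarrow> (tableau \<Rightarrow> real) \<Rightarrow> nat list \<times> tableau \<Rightarrow> real" where
  "\<Theta> k = \<rho> (t k) \<circ> \<Psi>"

lemma Theta_isometry: "k \<in> {1..n} \<Longrightarrow> isometry_op (Tab mu) J (\<Theta> k)"
  unfolding \<Theta>_def using t by (intro isometry_op_comp[OF rho_isometry Psi_sum_isometry]) blast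

lemma Theta_image: "\<Theta> k ` hspace (Tab mu) = \<rho> (t k) ` W_space L mu"
  unfolding \<Theta>_def W_space_def by (simp add: image_comp)

lemma iprod_Theta:
  assumes k: "k \<in> {1..n}" "l \<in> {1..n}" and v: "u \<in> hspace (Tab mu)" "v \<in> hspace (Tab mu)"
  shows "iprod J (\<Theta> k u) (\<Theta> l v) = iprod J (\<Psi> u) (\<rho> (inv (t k) \<circ> t l) (\<Psi> v))"
proof -
  have tk: "t k permutes {1..n}" "t l permutes {1..n}" using t k by auto
  have i: "inv (t k) permutes {1..n}" by (rule permutes_inv[OF tk(1)])
  have h: "\<Theta> l v \<in> hspace J" by (rule isometry_opD(2)[OF Theta_isometry[OF k(2)] v(2)])
  have "iprod J (\<Theta> k u) (\<Theta> l v) = iprod J (\<Theta> l v) (\<rho> (t k) (\<Psi> u))"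
    by (simp add: \<Theta>_def iprod_commute)
  also have "\<dots> = iprod J (\<rho> (inv (t k)) (\<Theta> l v)) (\<Psi> u)"
    by (rule iprod_rho_move[OF tk(1) h Psi_sum_hspace[OF v(1)]])
  also have "\<rho> (inv (t k)) (\<Theta> l v) = \<rho> (inv (t k) \<circ> t l) (\<Psi> v)"
    by (simp add: \<Theta>_def rho_hom[OF i tk(2) Psi_sum_hspace[OF v(2)]])
  finally show ?thesis by (simp add: iprod_commute)
qed

text \<open>In operator terms, the adjoint of \<open>\<Theta> k\<close> followed after
  \<open>\<Theta> l\<close> is the diagonal operator \<open>mult\<close> between two unitaries, so
  its singular values are |mult R| for every pair k \<noteq> l. The unitaries come from the double
  coset decomposition of \<open>inv (t k) \<circ> t l\<close>.\<close>

lemma Theta_factor: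
  assumes k: "k \<in> {1..n}" "l \<in> {1..n}" "k \<noteq> l"
  obtains g h where "g permutes {1..sum_list mu}" "h permutes {1..sum_list mu}"
    "\<And>u v. u \<in> hspace (Tab mu) \<Longrightarrow> v \<in> hspace (Tab mu) \<Longrightarrow>
      iprod J (\<Theta> k u) (\<Theta> l v) =
        iprod (Tab mu) u (young_rep mu g (\<lambda>R. mult R * young_rep mu h v R))"
proof -
  have tk: "t k permutes {1..n}" "t l permutes {1..n}" "t k n = k" "t l n = l" using t k by auto
  have "inv (t k) \<circ> t l permutes {1..n}" by (intro permutes_compose tk permutes_inv)
  moreover have "(inv (t k) \<circ> t l) n \<noteq> n"
    using tk k(3) permutes_inv_eq[OF tk(1), of l n] by simp
  ultimately obtain g h where gh: "g permutes {1..sum_list mu}" "h permutes {1..sum_list mu}"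
    "inv (t k) \<circ> t l = g \<circ> (adj_transp (sum_list mu) \<circ> h)"
    using double_coset[OF _ _ pos] by metis
  let ?s = "adj_transp (sum_list mu)"
  have s: "?s permutes {1..n}" using pos by (intro permutes_swap_id) auto
  have ig: "inv g permutes {1..sum_list mu}" by (rule permutes_inv[OF gh(1)])
  have "iprod J (\<Theta> k u) (\<Theta> l v) =
        iprod (Tab mu) u (young_rep mu g (\<lambda>R. mult R * young_rep mu h v R))"
    if u: "u \<in> hspace (Tab mu)" and v: "v \<in> hspace (Tab mu)" for u v
  proof -
    note hv = young_rep_mu_hspace[OF gh(2) v]
    note gu = young_rep_mu_hspace[OF ig u]
    have "iprod J (\<Theta> k u) (\<Theta> l v) = iprod J (\<Psi> u) (\<rho> (g \<circ> (?s \<circ> h)) (\<Psi> v))"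
      unfolding iprod_Theta[OF k(1,2) u v] gh(3) ..
    also have "\<rho> (g \<circ> (?s \<circ> h)) (\<Psi> v) = \<rho> g (\<rho> ?s (\<rho> h (\<Psi> v)))"
      unfolding rho_hom[OF permutes_n[OF gh(1)] permutes_compose[OF permutes_n[OF gh(2)] s] Psi_sum_hspace[OF v]]
        rho_hom[OF s permutes_n[OF gh(2)] Psi_sum_hspace[OF v]] ..
    also have "\<rho> h (\<Psi> v) = \<Psi> (young_rep mu h v)" by (rule intertwine_sum[OF gh(2) v])
    also have "iprod J (\<Psi> u) (\<rho> g (\<rho> ?s (\<Psi> (young_rep mu h v)))) =
        iprod J (\<rho> (inv g) (\<Psi> u)) (\<rho> ?s (\<Psi> (young_rep mu h v)))"
      by (rule iprod_rho_move[OF permutes_n[OF gh(1)] Psi_sum_hspace[OF u]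
            isometry_opD(2)[OF rho_isometry[OF s] Psi_sum_hspace[OF hv]]])
    also have "\<rho> (inv g) (\<Psi> u) = \<Psi> (young_rep mu (inv g) u)" by (rule intertwine_sum[OF ig u])
    also have "iprod J (\<Psi> (young_rep mu (inv g) u)) (\<rho> ?s (\<Psi> (young_rep mu h v))) =
        iprod (Tab mu) (young_rep mu (inv g) u) (\<lambda>R. mult R * young_rep mu h v R)"
      by (rule compress_last_sum[OF hv])
    also have "\<dots> = iprod (Tab mu) (young_rep mu g (young_rep mu (inv g) u))
        (young_rep mu g (\<lambda>R. mult R * young_rep mu h v R))"
      by (rule isometry_opD(3)[OF young_repD(1)[OF mu gh(1)] gu mult_hspace[OF hv], symmetric])
    also have "young_rep mu g (young_rep mu (inv g) u) = u"
      using young_repD(2)[OF mu gh(1) ig u] young_repD(4)[OF mu u] permutes_inv_o(1)[OF gh(1)] by simp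
    finally show ?thesis .
  qed
  then show ?thesis using gh that by blast
qed

lemma equi_isoclinicI:
  assumes \<alpha>: "\<And>R. R \<in> Tab mu \<Longrightarrow> (mult R)\<^sup>2 = \<alpha>"
  shows "equi_isoclinic {1..n} J (\<lambda>k. \<rho> (t k) ` W_space L mu)"
proof -
  \<comment> \<open>The isometries have to start from coordinates indexed by \<open>{..<d}\<close>;
    \<iota> transports these to tableaux along an enumeration \<beta>.\<close>
  define d where "d = card (Tab mu)"
  obtain \<beta> where \<beta>: "bij_betw \<beta> {..<d} (Tab mu)"
    using ex_bij_betw_nat_finite[OF finite_Tab[of mu]] unfolding d_def atLeast0LessThan by blast
  define \<gamma> where "\<gamma> = inv_into {..<d} \<beta>"
  have \<gamma>: "\<gamma> (\<beta> i) = i" if "i < d" for i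
    unfolding \<gamma>_def using \<beta> that by (auto simp: bij_betw_def inv_into_f_f)
  define \<iota> where "\<iota> x = (\<lambda>T. if T \<in> Tab mu then x (\<gamma> T) else 0)" for x :: "nat \<Rightarrow> real"
  have reindex: "(\<Sum>T\<in>Tab mu. f T) = (\<Sum>i<d. f (\<beta> i))" for f :: "tableau \<Rightarrow> real"
    by (rule sum.reindex_bij_betw[OF \<beta>, symmetric])
  have \<beta>T: "\<beta> i \<in> Tab mu" if "i < d" for i using \<beta> that by (auto simp: bij_betw_def)
  have iota: "isometry_op {..<d} (Tab mu) \<iota>"
    unfolding isometry_op_def lin_op_def iprod_def reindex
    by (auto simp: \<iota>_def hspace_def \<beta>T \<gamma> fun_eq_iff)
  have surj: "\<iota> ` hspace {..<d} = hspace (Tab mu)"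
  proof (intro subset_antisym subsetI)
    fix v assume v: "v \<in> hspace (Tab mu)"
    have "v = \<iota> (\<lambda>i. if i < d then v (\<beta> i) else 0)"
    proof
      fix T show "v T = \<iota> (\<lambda>i. if i < d then v (\<beta> i) else 0) T"
        using hspaceD[OF v] \<beta> inv_into_into[of T \<beta> "{..<d}"] unfolding \<iota>_def \<gamma>_def bij_betw_def
        by (auto simp: f_inv_into_f)
    qed
    moreover have "(\<lambda>i. if i < d then v (\<beta> i) else 0) \<in> hspace {..<d}" by (simp add: hspace_def)
    ultimately show "v \<in> \<iota> ` hspace {..<d}" by (metis image_eqI)
  next
    fix v assume "v \<in> \<iota> ` hspace {..<d}"
    then show "v \<in> hspace (Tab mu)" using isometry_opD(2)[OF iota] by blast
  qed
  have iota_basis: "\<iota> (basis_vec i) = basis_vec (\<beta> i)" if "i < d" for i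
  proof
    fix T
    have "\<gamma> T = i \<longleftrightarrow> T = \<beta> i" if "T \<in> Tab mu"
      using \<gamma>[OF \<open>i < d\<close>] \<beta> that unfolding \<gamma>_def bij_betw_def by (metis f_inv_into_f)
    then show "\<iota> (basis_vec i) T = basis_vec (\<beta> i) T"
      using \<beta>T[OF that] by (auto simp: \<iota>_def basis_vec_def)
  qed
  show ?thesis
    unfolding equi_isoclinic_def
  proof (intro exI[of _ d] exI[of _ "\<lambda>k. \<Theta> k \<circ> \<iota>"] exI[of _ \<alpha>] conjI ballI impI)
    fix k assume k: "k \<in> {1..n}"
    show "isometry_op {..<d} J (\<Theta> k \<circ> \<iota>)" by (rule isometry_op_comp[OF Theta_isometry[OF k] iota])
    show "(\<Theta> k \<circ> \<iota>) ` hspace {..<d} = \<rho> (t k) ` W_space L mu"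
      unfolding Theta_image[symmetric] surj[symmetric] by (rule image_comp[symmetric])
  next
    fix k l assume k: "k \<in> {1..n}" and l: "l \<in> {1..n}" and kl: "k \<noteq> l"
    obtain g h where gh: "g permutes {1..sum_list mu}" "h permutes {1..sum_list mu}"
      and F: "\<And>u v. u \<in> hspace (Tab mu) \<Longrightarrow> v \<in> hspace (Tab mu) \<Longrightarrow>
      iprod J (\<Theta> k u) (\<Theta> l v) =
        iprod (Tab mu) u (young_rep mu g (\<lambda>R. mult R * young_rep mu h v R))"
      by (rule Theta_factor[OF k l kl, of thesis]) (rule that)
    define A where "A = adj_op {..<d} J (\<Theta> k \<circ> \<iota>) \<circ> (\<Theta> l \<circ> \<iota>)"
    define Z where "Z x = young_rep mu g (\<lambda>R. mult R * young_rep mu h (\<iota> x) R)" for x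
    have A: "A x i = Z x (\<beta> i)" if x: "x \<in> hspace {..<d}" and i: "i < d" for x i
    proof -
      have "A x i = iprod J (\<Theta> k (basis_vec (\<beta> i))) (\<Theta> l (\<iota> x))"
        unfolding A_def adj_op_def using i iota_basis[OF i] by simp
      also have "\<dots> = iprod (Tab mu) (basis_vec (\<beta> i)) (Z x)"
        unfolding Z_def by (rule F[OF basis_vec_hspace[OF \<beta>T[OF i]] isometry_opD(2)[OF iota x]])
      also have "\<dots> = Z x (\<beta> i)" by (rule iprod_basis_left[OF finite_Tab \<beta>T[OF i]])
      finally show ?thesis .
    qed
    have AA: "iprod {..<d} (A x) (A y) = \<alpha> * iprod {..<d} x y"
      if x: "x \<in> hspace {..<d}" and y: "y \<in> hspace {..<d}" for x y
    proof -
      note ix = isometry_opD(2)[OF iota x] and iy = isometry_opD(2)[OF iota y]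
      note hx = young_rep_mu_hspace[OF gh(2) ix] and hy = young_rep_mu_hspace[OF gh(2) iy]
      have "iprod {..<d} (A x) (A y) = (\<Sum>i<d. Z x (\<beta> i) * Z y (\<beta> i))"
        unfolding iprod_def using A[OF x] A[OF y] by simp
      also have "\<dots> = iprod (Tab mu) (Z x) (Z y)" unfolding iprod_def reindex ..
      also have "\<dots> = iprod (Tab mu) (\<lambda>R. mult R * young_rep mu h (\<iota> x) R) (\<lambda>R. mult R * young_rep mu h (\<iota> y) R)"
        unfolding Z_def by (rule isometry_opD(3)[OF young_repD(1)[OF mu gh(1)] mult_hspace[OF hx] mult_hspace[OF hy]])
      also have "\<dots> = \<alpha> * iprod (Tab mu) (young_rep mu h (\<iota> x)) (young_rep mu h (\<iota> y))"
        unfolding iprod_def sum_distrib_left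
        by (rule sum.cong[OF refl]) (simp add: \<alpha>[symmetric] power2_eq_square)
      also have "iprod (Tab mu) (young_rep mu h (\<iota> x)) (young_rep mu h (\<iota> y)) = iprod {..<d} x y"
        using isometry_opD(3)[OF young_repD(1)[OF mu gh(2)] ix iy] isometry_opD(3)[OF iota x y] by simp
      finally show ?thesis .
    qed
    have "adj_op {..<d} {..<d} A (A x) i = \<alpha> * x i" if x: "x \<in> hspace {..<d}" for x i
    proof (cases "i < d")
      case True
      then show ?thesis
        using AA[OF basis_vec_hspace x, of i] iprod_basis_left[of "{..<d}" i x] by (simp add: adj_op_def)
    next
      case False
      then show ?thesis using hspaceD[OF x, of i] by (simp add: adj_op_def)
    qed
    then show "let A = adj_op {..<d} J (\<Theta> k \<circ> \<iota>) \<circ> (\<Theta> l \<circ> \<iota>)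
        in \<forall>x\<in>hspace {..<d}. adj_op {..<d} {..<d} A (A x) = (\<lambda>i. \<alpha> * x i)"
      unfolding Let_def A_def by (auto simp: fun_eq_iff)
  qed
qed

end

text \<open>One family and one pair of indices carry the information: for the transpositions of k
  and n, the members n and n - 1 belong to the identity and to s_(n-1). There \<alpha> is the
  squared norm of the projection of the unit vector \<open>\<Theta> t (n - 1) (basis_vec R)\<close>
  to member n. That norm can be computed with \<open>\<Theta> t n\<close> in place of the unknown
  \<open>\<Phi> n\<close>, and equals the square of \<open>mult R\<close>.\<close>

lemma equi_isoclinicD:
  assumes "\<And>t. \<forall>k\<in>{1..n}. t k permutes {1..n} \<and> t k n = k \<Longrightarrow>
    equi_isoclinic {1..n} J (\<lambda>k. \<rho> (t k) ` W_space L mu)"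
  shows "\<exists>\<alpha>. \<forall>R\<in>Tab mu. (mult R)\<^sup>2 = \<alpha>"
proof -
  define t where "t k = Transposition.transpose k n" for k
  have t: "\<forall>k\<in>{1..n}. t k permutes {1..n} \<and> t k n = k"
    unfolding t_def by (auto intro!: permutes_swap_id)
  let ?m = "sum_list mu"
  obtain d :: nat and \<Phi> \<alpha> where H:
    "(\<forall>k\<in>{1..n}. isometry_op {..<d} J (\<Phi> k) \<and> \<Phi> k ` hspace {..<d} = \<rho> (t k) ` W_space L mu) \<and>
     (\<forall>k\<in>{1..n}. \<forall>l\<in>{1..n}. k \<noteq> l \<longrightarrow> (\<forall>x\<in>hspace {..<d}.
      adj_op {..<d} {..<d} (adj_op {..<d} J (\<Phi> k) \<circ> \<Phi> l) ((adj_op {..<d} J (\<Phi> k) \<circ> \<Phi> l) x) = (\<lambda>i. \<alpha> * x i)))"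
    using assms[OF t] unfolding equi_isoclinic_def Let_def by (elim exE) (rule that)
  have iso: "\<And>k. k \<in> {1..n} \<Longrightarrow> isometry_op {..<d} J (\<Phi> k) \<and> \<Phi> k ` hspace {..<d} = \<rho> (t k) ` W_space L mu"
    and eq: "\<And>k l x. k \<in> {1..n} \<Longrightarrow> l \<in> {1..n} \<Longrightarrow> k \<noteq> l \<Longrightarrow> x \<in> hspace {..<d} \<Longrightarrow>
      adj_op {..<d} {..<d} (adj_op {..<d} J (\<Phi> k) \<circ> \<Phi> l) ((adj_op {..<d} J (\<Phi> k) \<circ> \<Phi> l) x) = (\<lambda>i. \<alpha> * x i)"
    using H by blast+
  have km: "n \<in> {1..n}" "?m \<in> {1..n}" "n \<noteq> ?m" using pos by auto
  note \<Theta>n = Theta_isometry[OF t km(1)] and \<Theta>m = Theta_isometry[OF t km(2)]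
  note \<Phi>n = iso[OF km(1), THEN conjunct1] and \<Phi>m = iso[OF km(2), THEN conjunct1]
  have "(mult R)\<^sup>2 = \<alpha>" if R: "R \<in> Tab mu" for R
  proof -
    let ?v = "basis_vec R"
    have v: "?v \<in> hspace (Tab mu)" by (rule basis_vec_hspace[OF R])
    define w where "w = \<Theta> t ?m ?v"
    have "w \<in> \<Phi> ?m ` hspace {..<d}"
      unfolding iso[OF km(2), THEN conjunct2] Theta_image[OF t, symmetric] w_def using v by blast
    then obtain x where x: "x \<in> hspace {..<d}" "w = \<Phi> ?m x" by blast
    have xx: "iprod {..<d} x x = 1"
      using isometry_opD(3)[OF \<Phi>m x(1) x(1)] isometry_opD(3)[OF \<Theta>m v v] x(2) iprod_basis_left[OF finite_Tab R]
      by (simp add: w_def basis_vec_def)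
    define A where "A = adj_op {..<d} J (\<Phi> n) \<circ> \<Phi> ?m"
    have lA: "lin_op {..<d} {..<d} A"
      using isometry_opD(1)[OF \<Phi>m] lin_op_adj_op[of J "{..<d}" "\<Phi> n"] unfolding A_def lin_op_def by simp
    have "\<alpha> = iprod {..<d} x (adj_op {..<d} {..<d} A (A x))"
      unfolding A_def eq[OF km x(1)] using xx iprod_scale[of "{..<d}" 1 x \<alpha> x] by simp
    also have "\<dots> = iprod {..<d} (A x) (A x)"
      by (rule iprod_adj_op[OF _ lA x(1), symmetric]) simp
    also have "\<dots> = iprod {..<d} (adj_op {..<d} J (\<Phi> n) w) (adj_op {..<d} J (\<Phi> n) w)"
      by (simp add: A_def x(2))
    also have "\<dots> = iprod (Tab mu) (adj_op (Tab mu) J (\<Theta> t n) w) (adj_op (Tab mu) J (\<Theta> t n) w)"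
      by (rule adj_op_norm_eq[OF _ finite_Tab \<Phi>n \<Theta>n])
        (use iso[OF km(1)] Theta_image[OF t] in auto)
    also have "adj_op (Tab mu) J (\<Theta> t n) w = (\<lambda>S. mult S * ?v S)"
    proof
      fix S
      show "adj_op (Tab mu) J (\<Theta> t n) w S = mult S * ?v S"
      proof (cases "S \<in> Tab mu")
        case True
        have tn: "t n = id" "t ?m = adj_transp ?m" by (auto simp: t_def)
        have "adj_op (Tab mu) J (\<Theta> t n) w S = iprod J (\<Theta> t n (basis_vec S)) (\<Theta> t ?m ?v)"
          using True by (simp add: adj_op_def w_def)
        also have "\<dots> = iprod J (\<Psi> (basis_vec S)) (\<rho> (adj_transp ?m) (\<Psi> ?v))"
          unfolding iprod_Theta[OF t km(1,2) basis_vec_hspace[OF True] v] tn by simp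
        also have "\<dots> = mult S * ?v S"
          unfolding compress_last_sum[OF v] by (rule iprod_basis_left[OF finite_Tab True])
        finally show ?thesis .
      next
        case False
        then show ?thesis using hspaceD[OF v False] by (simp add: adj_op_def)
      qed
    qed
    also have "iprod (Tab mu) (\<lambda>S. mult S * ?v S) (\<lambda>S. mult S * ?v S) = (mult R)\<^sup>2"
    proof -
      have "iprod (Tab mu) (\<lambda>S. mult S * ?v S) (\<lambda>S. mult S * ?v S) = iprod (Tab mu) ?v (\<lambda>S. (mult S)\<^sup>2)"
        unfolding iprod_def by (rule sum.cong) (auto simp: basis_vec_def power2_eq_square)
      then show ?thesis using iprod_basis_left[OF finite_Tab R] by simp
    qed
    finally show ?thesis by simp
  qed
  then show ?thesis by blast
qed

end

theorem isoclinic_partition_iff: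
  assumes mu: "partition_of mu (sum_list mu)" and pos: "sum_list mu \<ge> 1"
    and fin: "finite (up mu)" and dim_pos: "\<And>lam. lam \<in> up mu \<Longrightarrow> dim lam > 0"
  shows "isoclinic_partition mu \<longleftrightarrow>
    (\<exists>L. L \<noteq> {} \<and> L \<subset> up mu \<and> (\<exists>\<alpha>. \<forall>R\<in>Tab mu.
      (\<Sum>lam\<in>L. real (dim lam) / real_of_int (add_content mu lam - content_at mu R (sum_list mu)))\<^sup>2 = \<alpha>))"
proof -
  let ?n = "sum_list mu + 1"
  have *: "(\<forall>t. (\<forall>k\<in>{1..?n}. t k permutes {1..?n} \<and> t k ?n = k) \<longrightarrow>
            equi_isoclinic {1..?n} (Sigma L Tab) (\<lambda>k. young_rep_sum L (t k) ` W_space L mu)) \<longleftrightarrow>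
      (\<exists>\<alpha>. \<forall>R\<in>Tab mu.
      (\<Sum>lam\<in>L. real (dim lam) / real_of_int (add_content mu lam - content_at mu R (sum_list mu)))\<^sup>2 = \<alpha>)"
    (is "?E \<longleftrightarrow> (\<exists>\<alpha>. \<forall>R\<in>Tab mu. (?f R)\<^sup>2 = \<alpha>)") if L: "L \<noteq> {}" "L \<subset> up mu" for L
  proof -
    interpret branching_sum mu L
    proof
      show "dim lam > 0" if "lam \<in> L" for lam using that L dim_pos by blast
    qed (use mu pos L finite_subset[OF _ fin, of L] in auto)
    \<comment> \<open>The normalising factor \<open>dim_sum L\<close> does not depend on
      \<open>R\<close> and only rescales \<alpha>.\<close>
    have f: "?f R = real (dim_sum L) * mult R" for R
      unfolding mult_def sum_distrib_left using dim_sum_pos by (intro sum.cong) auto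
    have "?E \<longleftrightarrow> (\<exists>\<alpha>. \<forall>R\<in>Tab mu. (mult R)\<^sup>2 = \<alpha>)"
      using equi_isoclinicI equi_isoclinicD by blast
    also have "\<dots> \<longleftrightarrow> (\<exists>\<alpha>. \<forall>R\<in>Tab mu. (?f R)\<^sup>2 = \<alpha>)"
    proof
      assume "\<exists>\<alpha>. \<forall>R\<in>Tab mu. (mult R)\<^sup>2 = \<alpha>"
      then show "\<exists>\<alpha>. \<forall>R\<in>Tab mu. (?f R)\<^sup>2 = \<alpha>" unfolding f power_mult_distrib by metis
    next
      assume "\<exists>\<alpha>. \<forall>R\<in>Tab mu. (?f R)\<^sup>2 = \<alpha>"
      then obtain \<alpha> where "\<forall>R\<in>Tab mu. (real (dim_sum L))\<^sup>2 * (mult R)\<^sup>2 = \<alpha>"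
        unfolding f power_mult_distrib by blast
      then have "\<forall>R\<in>Tab mu. (mult R)\<^sup>2 = \<alpha> / (real (dim_sum L))\<^sup>2"
        using dim_sum_pos by (auto simp: field_simps)
      then show "\<exists>\<alpha>. \<forall>R\<in>Tab mu. (mult R)\<^sup>2 = \<alpha>" by blast
    qed
    finally show ?thesis .
  qed
  show ?thesis
    unfolding isoclinic_partition_def Let_def using mu by (simp only: * simp_thms cong: conj_cong)
qed

section \<open>Frobenius formula and Kerov equations\<close>

text \<open>As a function of \<open>a\<close> the product tends to 1 at infinity and has simple
  poles at the \<open>l i\<close>, where its residue is t times the product over the other
  indices.\<close>

lemma partial_fractions:
  fixes l :: "'i \<Rightarrow> real"
  assumes "finite I" "inj_on l I" "a \<notin> l ` I"
  shows "(\<Prod>i\<in>I. 1 + t / (a - l i)) = 1 + t * (\<Sum>i\<in>I. (\<Prod>j\<in>I - {i}. 1 + t / (l i - l j)) / (a - l i))"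
  using assms
proof (induction I arbitrary: a rule: finite_induct)
  case empty
  then show ?case by simp
next
  case (insert x I)
  define c where "c = l x"
  define W where "W i = (\<Prod>j\<in>I - {i}. 1 + t / (l i - l j))" for i
  define Q where "Q b = (\<Prod>i\<in>I. 1 + t / (b - l i))" for b
  have c: "c \<notin> l ` I" using insert unfolding c_def by auto
  have ac: "a \<noteq> c" and a: "a \<notin> l ` I" using insert unfolding c_def by auto
  have Qa: "Q a = 1 + t * (\<Sum>i\<in>I. W i / (a - l i))"
    unfolding Q_def W_def by (rule insert.IH) (use insert a in auto)
  have Qc: "Q c = 1 + t * (\<Sum>i\<in>I. W i / (c - l i))"
    unfolding Q_def W_def by (rule insert.IH) (use insert c in auto)
  have Wx: "(\<Prod>j\<in>insert x I - {x}. 1 + t / (l x - l j)) = Q c"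
    unfolding Q_def c_def using insert by (intro prod.cong) auto
  have Wi: "(\<Prod>j\<in>insert x I - {i}. 1 + t / (l i - l j)) = (1 + t / (l i - c)) * W i" if "i \<in> I" for i
  proof -
    have "insert x I - {i} = insert x (I - {i})" using that insert by auto
    then show ?thesis unfolding W_def c_def using insert by simp
  qed
  have "1 + t * (\<Sum>i\<in>insert x I. (\<Prod>j\<in>insert x I - {i}. 1 + t / (l i - l j)) / (a - l i)) =
      1 + t * (Q c / (a - c) + (\<Sum>i\<in>I. (1 + t / (l i - c)) * W i / (a - l i)))"
    using insert Wx Wi by (simp add: c_def)
  \<comment> \<open>Splitting 1 / ((l i - c) (a - l i)) over the common denominator a - c leaves
    exactly the two sums governed by the induction hypothesis, at \<open>a\<close> and at
    \<open>c\<close>.\<close>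
  also have "(\<Sum>i\<in>I. (1 + t / (l i - c)) * W i / (a - l i)) =
      (\<Sum>i\<in>I. W i / (a - l i) + t / (a - c) * (W i / (a - l i) - W i / (c - l i)))"
  proof (rule sum.cong[OF refl])
    fix i assume "i \<in> I"
    then have "a - l i \<noteq> 0" "l i - c \<noteq> 0" "c - l i \<noteq> 0" "a - c \<noteq> 0" using a c ac by auto
    then show "(1 + t / (l i - c)) * W i / (a - l i) =
        W i / (a - l i) + t / (a - c) * (W i / (a - l i) - W i / (c - l i))"
      by (simp add: divide_simps) (simp add: algebra_simps)
  qed
  also have "\<dots> = (\<Sum>i\<in>I. W i / (a - l i)) + t / (a - c) * ((\<Sum>i\<in>I. W i / (a - l i)) - (\<Sum>i\<in>I. W i / (c - l i)))"
    by (simp only: sum.distrib sum_distrib_left[symmetric] sum_subtractf)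
  also have "1 + t * (Q c / (a - c) + \<dots>) = Q a + (t / (a - c)) * (Q c + (Q a - 1) - (Q c - 1))"
    unfolding Qa Qc by (simp add: algebra_simps add_divide_distrib)
  also have "\<dots> = (1 + t / (a - c)) * Q a" by (simp add: algebra_simps)
  also have "\<dots> = (\<Prod>i\<in>insert x I. 1 + t / (a - l i))" unfolding Q_def c_def using insert by simp
  finally show ?case by simp
qed

text \<open>For t \<noteq> 0 these are the coefficients of 1/a and 1/a^2 when
  \<open>partial_fractions\<close> is expanded at infinity; the induction replaces that limit. The
  second sum is the one that drives the Frobenius formula.\<close>

lemma lagrange_sums:
  fixes l :: "'i \<Rightarrow> real"
  assumes "finite I" "inj_on l I"
  shows "(\<Sum>i\<in>I. \<Prod>j\<in>I - {i}. 1 + t / (l i - l j)) = real (card I)"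
    and "(\<Sum>i\<in>I. l i * (\<Prod>j\<in>I - {i}. 1 + t / (l i - l j))) =
      (\<Sum>i\<in>I. l i) + t * (real (card I) * (real (card I) - 1) / 2)"
  using assms
proof (induction I rule: finite_induct)
  case empty
  {
    case 1
    then show ?case by simp
  next
    case 2
    then show ?case by simp
  }
next
  case (insert x I)
  define c where "c = l x"
  define W where "W i = (\<Prod>j\<in>I - {i}. 1 + t / (l i - l j))" for i
  define Q where "Q b = (\<Prod>i\<in>I. 1 + t / (b - l i))" for b
  have key: "c \<notin> l ` I" "inj_on l I" if "inj_on l (insert x I)"
    using that insert.hyps unfolding c_def by auto
  have Qc: "Q c = 1 + t * (\<Sum>i\<in>I. W i / (c - l i))" if "inj_on l (insert x I)"
    unfolding Q_def W_def by (rule partial_fractions[OF insert.hyps(1) key(2)[OF that] key(1)[OF that]])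
  have Wx: "(\<Prod>j\<in>insert x I - {x}. 1 + t / (l x - l j)) = Q c"
    unfolding Q_def c_def using insert.hyps by (intro prod.cong) auto
  have Wi: "(\<Prod>j\<in>insert x I - {i}. 1 + t / (l i - l j)) = (1 + t / (l i - c)) * W i" if "i \<in> I" for i
  proof -
    have "insert x I - {i} = insert x (I - {i})" using that insert.hyps by auto
    then show ?thesis unfolding W_def c_def using insert.hyps by simp
  qed
  {
    case 1
    have IH: "(\<Sum>i\<in>I. W i) = real (card I)" unfolding W_def by (rule insert.IH(1)[OF key(2)[OF 1]])
    have "(\<Sum>i\<in>insert x I. \<Prod>j\<in>insert x I - {i}. 1 + t / (l i - l j)) =
        Q c + (\<Sum>i\<in>I. (1 + t / (l i - c)) * W i)"
      using insert.hyps Wx Wi by simp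
    also have "(\<Sum>i\<in>I. (1 + t / (l i - c)) * W i) = (\<Sum>i\<in>I. W i - t * (W i / (c - l i)))"
    proof (rule sum.cong[OF refl])
      fix i assume "i \<in> I"
      then have "c - l i \<noteq> 0" "l i - c \<noteq> 0" using key(1)[OF 1] by auto
      then show "(1 + t / (l i - c)) * W i = W i - t * (W i / (c - l i))" by (simp add: divide_simps) (simp add: algebra_simps)
    qed
    also have "\<dots> = (\<Sum>i\<in>I. W i) - t * (\<Sum>i\<in>I. W i / (c - l i))"
      by (simp add: sum_subtractf sum_distrib_left)
    finally show ?case using IH Qc[OF 1] insert.hyps by simp
  next
    case 2
    have IH: "(\<Sum>i\<in>I. W i) = real (card I)" unfolding W_def by (rule insert.IH(1)[OF key(2)[OF 2]])
    have IH2: "(\<Sum>i\<in>I. l i * W i) = (\<Sum>i\<in>I. l i) + t * (real (card I) * (real (card I) - 1) / 2)"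
      unfolding W_def by (rule insert.IH(2)[OF key(2)[OF 2]])
    have "(\<Sum>i\<in>insert x I. l i * (\<Prod>j\<in>insert x I - {i}. 1 + t / (l i - l j))) =
        c * Q c + (\<Sum>i\<in>I. l i * ((1 + t / (l i - c)) * W i))"
      using insert.hyps Wx Wi by (simp add: c_def)
    also have "(\<Sum>i\<in>I. l i * ((1 + t / (l i - c)) * W i)) =
        (\<Sum>i\<in>I. l i * W i + t * W i - c * (t * (W i / (c - l i))))"
    proof (rule sum.cong[OF refl])
      fix i assume "i \<in> I"
      then have "c - l i \<noteq> 0" "l i - c \<noteq> 0" using key(1)[OF 2] by auto
      then show "l i * ((1 + t / (l i - c)) * W i) = l i * W i + t * W i - c * (t * (W i / (c - l i)))"
        by (simp add: divide_simps) (simp add: algebra_simps)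
    qed
    also have "\<dots> = (\<Sum>i\<in>I. l i * W i) + t * (\<Sum>i\<in>I. W i) - c * (t * (\<Sum>i\<in>I. W i / (c - l i)))"
      by (simp add: sum_subtractf sum.distrib sum_distrib_left)
    finally have "(\<Sum>i\<in>insert x I. l i * (\<Prod>j\<in>insert x I - {i}. 1 + t / (l i - l j))) =
       c + (\<Sum>i\<in>I. l i * W i) + t * (\<Sum>i\<in>I. W i)"
      using Qc[OF 2] by (simp add: algebra_simps)
    then show ?case unfolding IH IH2 using insert.hyps by (simp add: c_def field_simps)
  }
qed

section \<open>Row-length functions, beta numbers and the Frobenius formula\<close>

definition diagram :: "(nat \<Rightarrow> nat) \<Rightarrow> (nat \<times> nat) set" where
  "diagram r = {(i, j). j < r i}"

text \<open>Row lengths with trailing zeros, where \<open>k\<close> may exceed the number of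
  nonempty rows: a box in a new row is then a function update like any other.\<close>

definition rows :: "nat \<Rightarrow> (nat \<Rightarrow> nat) \<Rightarrow> bool" where
  "rows k r \<longleftrightarrow> (\<forall>i. r (Suc i) \<le> r i) \<and> (\<forall>i\<ge>k. r i = 0)"

text \<open>The beta numbers: adding the staircase k - 1, ..., 0 makes the row lengths strictly
  decreasing. For i < k, subtracting k - 1 gives the content of the first box beyond row i.\<close>

definition beta :: "nat \<Rightarrow> (nat \<Rightarrow> nat) \<Rightarrow> nat \<Rightarrow> nat" where
  "beta k r i = r i + (k - 1 - i)"

text \<open>Frobenius's product, the Vandermonde of the beta numbers over their factorials. Taking
  the root of the product over ordered pairs keeps it symmetric in the indices, so that any one
  index can be split off.\<close>

definition frob :: "nat \<Rightarrow> (nat \<Rightarrow> nat) \<Rightarrow> real" where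
  "frob k r = sqrt (\<Prod>i<k. \<Prod>j\<in>{..<k} - {i}. \<bar>real (beta k r i) - real (beta k r j)\<bar>) / (\<Prod>i<k. fact (beta k r i))"

lemma rows_antimono: "rows k r \<Longrightarrow> i \<le> j \<Longrightarrow> r j \<le> r i"
  unfolding rows_def by (meson lift_Suc_antimono_le)

lemma beta_less: "rows k r \<Longrightarrow> i < j \<Longrightarrow> j < k \<Longrightarrow> beta k r j < beta k r i"
  using rows_antimono[of k r i j] unfolding beta_def by linarith

lemma beta_inj: "rows k r \<Longrightarrow> inj_on (beta k r) {..<k}"
  by (rule inj_onI) (metis beta_less lessThan_iff linorder_neqE_nat nat_less_le)

lemma sqrt_prod_pairs_remove:
  fixes l :: "nat \<Rightarrow> real"
  assumes "finite I" "x \<in> I"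
  shows "sqrt (\<Prod>i\<in>I. \<Prod>j\<in>I - {i}. \<bar>l i - l j\<bar>) =
    (\<Prod>j\<in>I - {x}. \<bar>l x - l j\<bar>) * sqrt (\<Prod>i\<in>I - {x}. \<Prod>j\<in>I - {x} - {i}. \<bar>l i - l j\<bar>)"
proof -
  let ?P = "\<Prod>j\<in>I - {x}. \<bar>l x - l j\<bar>"
  have "(\<Prod>i\<in>I. \<Prod>j\<in>I - {i}. \<bar>l i - l j\<bar>) = ?P * (\<Prod>i\<in>I - {x}. \<Prod>j\<in>I - {i}. \<bar>l i - l j\<bar>)"
    by (rule prod.remove[OF assms])
  also have "(\<Prod>i\<in>I - {x}. \<Prod>j\<in>I - {i}. \<bar>l i - l j\<bar>) =
      (\<Prod>i\<in>I - {x}. \<bar>l x - l i\<bar> * (\<Prod>j\<in>I - {x} - {i}. \<bar>l i - l j\<bar>))"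
  proof (rule prod.cong[OF refl])
    fix i assume i: "i \<in> I - {x}"
    have e: "I - {i} - {x} = I - {x} - {i}" by auto
    have "(\<Prod>j\<in>I - {i}. \<bar>l i - l j\<bar>) = \<bar>l i - l x\<bar> * (\<Prod>j\<in>I - {i} - {x}. \<bar>l i - l j\<bar>)"
      by (rule prod.remove) (use assms i in auto)
    then show "(\<Prod>j\<in>I - {i}. \<bar>l i - l j\<bar>) = \<bar>l x - l i\<bar> * (\<Prod>j\<in>I - {x} - {i}. \<bar>l i - l j\<bar>)"
      unfolding e by (simp add: abs_minus_commute)
  qed
  also have "\<dots> = ?P * (\<Prod>i\<in>I - {x}. \<Prod>j\<in>I - {x} - {i}. \<bar>l i - l j\<bar>)"
    by (rule prod.distrib)
  finally have "(\<Prod>i\<in>I. \<Prod>j\<in>I - {i}. \<bar>l i - l j\<bar>) =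
      ?P\<^sup>2 * (\<Prod>i\<in>I - {x}. \<Prod>j\<in>I - {x} - {i}. \<bar>l i - l j\<bar>)"
    by (simp add: power2_eq_square)
  moreover have "?P \<ge> 0" by (rule prod_nonneg) simp
  ultimately show ?thesis by (simp add: real_sqrt_mult)
qed

text \<open>A nonzero difference of integers has modulus at least 1, so a unit shift cannot carry it
  across zero.\<close>

lemma abs_shift:
  fixes x y :: nat and t :: real
  assumes "x \<noteq> y" "t = 1 \<or> t = -1"
  shows "\<bar>real x + t - real y\<bar> = \<bar>real x - real y\<bar> * (1 + t / (real x - real y))"
proof -
  define d where "d = real x - real y"
  have d: "d \<ge> 1 \<or> d \<le> -1" using assms(1) unfolding d_def by linarith
  then have "\<bar>d + t\<bar> = \<bar>d\<bar> * (1 + t / d)"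
  proof
    assume "d \<ge> 1"
    then show ?thesis using assms(2) by (auto simp: field_simps)
  next
    assume "d \<le> -1"
    then have "\<bar>d + t\<bar> = - (d + t)" "\<bar>d\<bar> = - d" "d \<noteq> 0" using assms(2) by auto
    then show ?thesis by (simp add: field_simps)
  qed
  then show ?thesis by (simp add: d_def algebra_simps)
qed

text \<open>A box added to or removed from row i changes one beta number by t, hence only the
  Vandermonde factors containing it; their ratios form the product met in
  \<open>partial_fractions\<close>. Keeping the factorials as multipliers serves both signs of
  t.\<close>

lemma frob_shift:
  assumes r: "rows k r" and i: "i < k" and t: "t = 1 \<or> t = -1"
    and v: "real (beta k (r(i := v)) i) = real (beta k r i) + t"
  shows "frob k (r(i := v)) * fact (beta k (r(i := v)) i) = frob k r * fact (beta k r i) *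
    (\<Prod>j\<in>{..<k} - {i}. 1 + t / (real (beta k r i) - real (beta k r j)))"
proof -
  define C where "C = sqrt (\<Prod>m\<in>{..<k} - {i}. \<Prod>j\<in>{..<k} - {i} - {m}. \<bar>real (beta k r m) - real (beta k r j)\<bar>) /
    (\<Prod>m\<in>{..<k} - {i}. fact (beta k r m))"
  have split: "frob k s * fact (beta k s i) = (\<Prod>j\<in>{..<k} - {i}. \<bar>real (beta k s i) - real (beta k r j)\<bar>) * C"
    if s: "\<And>j. j \<noteq> i \<Longrightarrow> s j = r j" for s
  proof -
    have b: "beta k s j = beta k r j" if "j \<noteq> i" for j using s[OF that] by (simp add: beta_def)
    have f: "(\<Prod>m<k. fact (beta k s m)) = fact (beta k s i) * (\<Prod>m\<in>{..<k} - {i}. fact (beta k s m) :: real)"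
      by (rule prod.remove) (use i in auto)
    have "frob k s * fact (beta k s i) = (\<Prod>j\<in>{..<k} - {i}. \<bar>real (beta k s i) - real (beta k s j)\<bar>) *
      (sqrt (\<Prod>m\<in>{..<k} - {i}. \<Prod>j\<in>{..<k} - {i} - {m}. \<bar>real (beta k s m) - real (beta k s j)\<bar>) /
    (\<Prod>m\<in>{..<k} - {i}. fact (beta k s m)))"
      unfolding frob_def f
      using sqrt_prod_pairs_remove[of "{..<k}" i "\<lambda>m. real (beta k s m)"] i by simp
    also have "\<dots> = (\<Prod>j\<in>{..<k} - {i}. \<bar>real (beta k s i) - real (beta k r j)\<bar>) * C"
      unfolding C_def using b by (intro arg_cong2[of _ _ _ _ "(*)"] arg_cong2[of _ _ _ _ "(/)"] arg_cong[of _ _ sqrt] prod.cong) auto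
    finally show ?thesis .
  qed
  have ne: "beta k r i \<noteq> beta k r j" if "j \<in> {..<k} - {i}" for j
    using beta_inj[OF r] i that by (auto simp: inj_on_def)
  have "(\<Prod>j\<in>{..<k} - {i}. \<bar>real (beta k (r(i := v)) i) - real (beta k r j)\<bar>) =
    (\<Prod>j\<in>{..<k} - {i}. \<bar>real (beta k r i) - real (beta k r j)\<bar> * (1 + t / (real (beta k r i) - real (beta k r j))))"
    unfolding v by (rule prod.cong[OF refl]) (rule abs_shift[OF ne t])
  then show ?thesis
    using split[of "r(i := v)"] split[of r] by (simp add: prod.distrib)
qed

lemma frob_pos: "rows k r \<Longrightarrow> frob k r > 0"
  unfolding frob_def using beta_inj[of k r]
  by (auto intro!: divide_pos_pos prod_pos simp: inj_on_def)

lemma young_shape_diagram: assumes "rows k r" shows "young_shape (diagram r)"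
  unfolding young_shape_def
proof (intro conjI allI impI)
  have "diagram r \<subseteq> Sigma {..<k} (\<lambda>i. {..<r i})"
    using assms by (auto simp: diagram_def rows_def) (metis not_less less_zeroE)
  then show "finite (diagram r)" by (rule finite_subset) auto
  fix i j i' j' assume "(i', j') \<in> diagram r \<and> i \<le> i' \<and> j \<le> j'"
  then show "(i, j) \<in> diagram r" using rows_antimono[OF assms, of i i'] by (auto simp: diagram_def)
qed

lemma card_diagram: assumes "rows k r" shows "card (diagram r) = (\<Sum>i<k. r i)"
proof -
  have "diagram r = Sigma {..<k} (\<lambda>i. {..<r i})"
    using assms by (auto simp: diagram_def rows_def) (metis not_less less_zeroE)
  then show ?thesis by (simp add: card_SigmaI)
qed

lemma rows_dec: "rows k r \<Longrightarrow> r (Suc i) < r i \<Longrightarrow> rows k (r(i := r i - 1))"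
  unfolding rows_def by (auto simp: fun_upd_def) (metis diff_le_self le_trans)

lemma rows_inc: "rows k r \<Longrightarrow> i < k \<Longrightarrow> i = 0 \<or> r i < r (i - 1) \<Longrightarrow> rows k (r(i := r i + 1))"
  unfolding rows_def by (auto simp: fun_upd_def le_SucI)

lemma diagram_dec: "r i > 0 \<Longrightarrow> diagram r - {(i, r i - 1)} = diagram (r(i := r i - 1))"
  by (auto simp: diagram_def split: if_splits)

lemma diagram_inc: "diagram (r(i := r i + 1)) = insert (i, r i) (diagram r)"
  by (auto simp: diagram_def split: if_splits)

lemma diagram_corners:
  assumes r: "rows k r"
  shows "{p \<in> diagram r. young_shape (diagram r - {p})} = (\<lambda>i. (i, r i - 1)) ` {i. i < k \<and> r (Suc i) < r i}"
proof (intro subset_antisym subsetI)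
  fix p assume p: "p \<in> {p \<in> diagram r. young_shape (diagram r - {p})}"
  obtain i j where ij: "p = (i, j)" by (cases p)
  have j: "j < r i" using p ij by (simp add: diagram_def)
  have "(i, Suc j) \<notin> diagram r"
    using p ij young_shapeD[of "diagram r - {p}" i "Suc j" i j] by auto
  then have j': "j = r i - 1" using j by (simp add: diagram_def)
  have "(Suc i, j) \<notin> diagram r"
    using p ij young_shapeD[of "diagram r - {p}" "Suc i" j i j] by auto
  then have "r (Suc i) < r i" using j' j by (simp add: diagram_def)
  moreover have "i < k" using j r unfolding rows_def by (metis not_less less_zeroE)
  ultimately show "p \<in> (\<lambda>i. (i, r i - 1)) ` {i. i < k \<and> r (Suc i) < r i}" using ij j' by auto
next
  fix p assume "p \<in> (\<lambda>i. (i, r i - 1)) ` {i. i < k \<and> r (Suc i) < r i}"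
  then obtain i where i: "p = (i, r i - 1)" "r (Suc i) < r i" by auto
  then show "p \<in> {p \<in> diagram r. young_shape (diagram r - {p})}"
    using young_shape_diagram[OF rows_dec[OF r i(2)]] diagram_dec[of r i] by (auto simp: diagram_def)
qed

text \<open>Induction along the branching rule. Removing a box from row i multiplies
  \<open>frob\<close> by b i * W i, a factor that vanishes for rows without a removable box. The sum
  thus extends over all rows, and \<open>lagrange_sums\<close> with t = -1 evaluates it to the
  number of boxes, once the staircase part of the beta numbers has cancelled.\<close>

theorem frobenius_formula:
  assumes "rows k r"
  shows "real (card (Syt (diagram r))) = fact (\<Sum>i<k. r i) * frob k r / frob k (\<lambda>_. 0)"
  using assms
proof (induction "\<Sum>i<k. r i" arbitrary: r)
  case 0
  have r0: "r = (\<lambda>_. 0)"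
  proof
    fix i show "r i = 0" using 0 by (cases "i < k") (auto simp: rows_def)
  qed
  have "diagram r = {}" by (simp add: r0 diagram_def)
  moreover have "Syt {} = {\<lambda>_. 0}" unfolding Syt_def by (auto simp: fun_eq_iff bij_betw_def)
  moreover have "frob k (\<lambda>_. 0) > 0" using frob_pos[OF 0(2)] r0 by simp
  ultimately show ?case by (simp add: r0)
next
  case (Suc N)
  note r = Suc.prems
  define b where "b i = real (beta k r i)" for i
  define W where "W i = (\<Prod>j\<in>{..<k} - {i}. 1 + (-1) / (b i - b j))" for i
  let ?F = "frob k r" and ?Z = "frob k (\<lambda>_. 0)"
  let ?C = "{i. i < k \<and> r (Suc i) < r i}"
  have inj: "inj_on b {..<k}" using beta_inj[OF r] by (simp add: b_def inj_on_def)
  have step: "real (card (Syt (diagram (r(i := r i - 1))))) = fact N * (?F * (b i * W i)) / ?Z"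
    if i: "i \<in> ?C" for i
  proof -
    have r': "rows k (r(i := r i - 1))" by (rule rows_dec[OF r]) (use i in simp)
    have s: "(\<Sum>j<k. r j) = r i + (\<Sum>j\<in>{..<k} - {i}. r j)" by (rule sum.remove) (use i in auto)
    have "(\<Sum>j<k. (r(i := r i - 1)) j) = (r i - 1) + (\<Sum>j\<in>{..<k} - {i}. (r(i := r i - 1)) j)"
      by (subst sum.remove[of _ i]) (use i in auto)
    also have "(\<Sum>j\<in>{..<k} - {i}. (r(i := r i - 1)) j) = (\<Sum>j\<in>{..<k} - {i}. r j)"
      by (rule sum.cong) auto
    finally have N: "N = (\<Sum>j<k. (r(i := r i - 1)) j)" using s Suc.hyps(2) i by simp
    have "r i > 0" using i by auto
    then have bi: "beta k r i = Suc (beta k (r(i := r i - 1)) i)"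
      by (simp only: beta_def fun_upd_same)
    have "frob k (r(i := r i - 1)) * fact (beta k (r(i := r i - 1)) i) = ?F * fact (beta k r i) * W i"
      unfolding W_def b_def by (rule frob_shift[OF r]) (use i bi in auto)
    then have "fact (beta k (r(i := r i - 1)) i) * frob k (r(i := r i - 1)) =
        fact (beta k (r(i := r i - 1)) i) * (?F * (b i * W i))"
      unfolding bi b_def by (simp add: algebra_simps)
    then have "frob k (r(i := r i - 1)) = ?F * (b i * W i)" by simp
    then show ?thesis using Suc.hyps(1)[OF N r'] N by simp
  qed
  \<comment> \<open>A row has no removable box either because the next row is equally long, which
    kills a factor of \<open>W i\<close>, or because it is the empty last row, where
    \<open>b i\<close> is zero.\<close>
  have zero: "b i * W i = 0" if "i < k" "i \<notin> ?C" for i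
  proof (cases "Suc i < k")
    case True
    have "r (Suc i) = r i" using that r unfolding rows_def by (simp add: le_antisym)
    then have "b i - b (Suc i) = 1" using True by (simp add: b_def beta_def)
    then have "W i = 0" unfolding W_def using True by (intro prod_zero) (auto intro!: bexI[of _ "Suc i"])
    then show ?thesis by simp
  next
    case False
    then have "i = k - 1" "r (Suc i) = 0" using that r by (auto simp: rows_def)
    then have "beta k r i = 0" using that by (simp add: beta_def)
    then show ?thesis by (simp add: b_def)
  qed
  have ne: "diagram r \<noteq> {}"
  proof
    assume "diagram r = {}"
    then show False using card_diagram[OF r] Suc.hyps(2) by simp
  qed
  have "real (card (Syt (diagram r))) = (\<Sum>i\<in>?C. real (card (Syt (diagram r - {(i, r i - 1)}))))"
    unfolding card_Syt_branch[OF young_shape_diagram[OF r] ne] diagram_corners[OF r]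
    by (subst sum.reindex) (auto simp: inj_on_def)
  also have "\<dots> = (\<Sum>i\<in>?C. fact N * (?F * (b i * W i)) / ?Z)"
  proof (rule sum.cong[OF refl])
    fix i assume i: "i \<in> ?C"
    then show "real (card (Syt (diagram r - {(i, r i - 1)}))) = fact N * (?F * (b i * W i)) / ?Z"
      using step[OF i] diagram_dec[of r i] by simp
  qed
  also have "\<dots> = fact N * ?F / ?Z * (\<Sum>i\<in>?C. b i * W i)"
    by (simp add: sum_distrib_left mult_ac)
  also have "(\<Sum>i\<in>?C. b i * W i) = (\<Sum>i<k. b i * W i)"
    by (rule sum.mono_neutral_left) (use zero in auto)
  also have "\<dots> = (\<Sum>i<k. b i) - real k * (real k - 1) / 2"
    using lagrange_sums(2)[OF _ inj, of "-1"] unfolding W_def by simp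
  also have "(\<Sum>i<k. b i) = real (\<Sum>i<k. r i) + real (\<Sum>i<k. k - 1 - i)"
    by (simp only: b_def beta_def sum.distrib of_nat_add of_nat_sum)
  also have "(\<Sum>i<k. k - 1 - i) = (\<Sum>i<k. i)"
    using sum.nat_diff_reindex[of "\<lambda>i. i" k] by simp
  also have "real (\<Sum>i<k. i) = real k * (real k - 1) / 2"
    by (induction k) (auto simp: field_simps)
  finally have "real (card (Syt (diagram r))) = fact N * ?F / ?Z * real (Suc N)"
    unfolding Suc.hyps(2)[symmetric] by (simp only: add_diff_cancel_right')
  then show ?case unfolding Suc.hyps(2)[symmetric] fact_Suc by (simp only: of_nat_fact times_divide_eq_left times_divide_eq_right mult_ac)
qed

lemma card_Syt_diagram_pos: "rows k r \<Longrightarrow> card (Syt (diagram r)) > 0"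
  using frobenius_formula[of k r] frob_pos[of k r] frob_pos[of k "\<lambda>_. 0"]
  by (simp add: rows_def flip: of_nat_0_less_iff[where 'a = real])

text \<open>For \<open>W i = \<Prod>\<^sub>j\<^sub>\<noteq>\<^sub>i (1 + 1/(b i - b j))\<close> the number of tableaux with a box added in row \<open>i\<close> is
  proportional to \<open>W i / (b i + 1)\<close>; the product in the partial fraction expansion vanishes both at
  \<open>b i\<^sub>0 - 1\<close> and at \<open>-1\<close>.\<close>

theorem kerov_equation:
  assumes r: "rows k r" and k: "k \<ge> 1" "r (k - 1) = 0" and i0: "r (Suc i\<^sub>0) < r i\<^sub>0"
  shows "(\<Sum>i\<in>{i. i < k \<and> (i = 0 \<or> r i < r (i - 1))}.
      real (card (Syt (diagram (r(i := r i + 1))))) / ((real (r i) - real i) - (real (r i\<^sub>0) - 1 - real i\<^sub>0))) = 0"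
proof -
  define b where "b i = real (beta k r i)" for i
  define W where "W i = (\<Prod>j\<in>{..<k} - {i}. 1 + 1 / (b i - b j))" for i
  let ?F = "frob k r" and ?Z = "frob k (\<lambda>_. 0)"
  let ?C = "{i. i < k \<and> (i = 0 \<or> r i < r (i - 1))}"
  define K where "K = fact (Suc (\<Sum>i<k. r i)) * ?F / ?Z"
  define y where "y = b i\<^sub>0"
  have inj: "inj_on b {..<k}" using beta_inj[OF r] by (simp add: b_def inj_on_def)
  have ik: "i\<^sub>0 < k" using i0 r unfolding rows_def by (metis not_less less_zeroE)
  have y: "y > 0" unfolding y_def b_def beta_def using i0 by simp
  have step: "real (card (Syt (diagram (r(i := r i + 1))))) = K * (W i / (b i + 1))" if i: "i \<in> ?C" for i
  proof -
    have r': "rows k (r(i := r i + 1))" by (rule rows_inc[OF r]) (use i in auto)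
    have s: "(\<Sum>j<k. r j) = r i + (\<Sum>j\<in>{..<k} - {i}. r j)" by (rule sum.remove) (use i in auto)
    have "(\<Sum>j<k. (r(i := r i + 1)) j) = (r i + 1) + (\<Sum>j\<in>{..<k} - {i}. (r(i := r i + 1)) j)"
      by (subst sum.remove[of _ i]) (use i in auto)
    also have "(\<Sum>j\<in>{..<k} - {i}. (r(i := r i + 1)) j) = (\<Sum>j\<in>{..<k} - {i}. r j)"
      by (rule sum.cong) auto
    finally have N: "(\<Sum>j<k. (r(i := r i + 1)) j) = Suc (\<Sum>i<k. r i)" using s by simp
    have bi: "beta k (r(i := r i + 1)) i = Suc (beta k r i)" by (simp add: beta_def)
    have "frob k (r(i := r i + 1)) * fact (beta k (r(i := r i + 1)) i) = ?F * fact (beta k r i) * W i"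
      unfolding W_def b_def by (rule frob_shift[OF r]) (use i bi in auto)
    then have "fact (beta k r i) * (frob k (r(i := r i + 1)) * (b i + 1)) = fact (beta k r i) * (?F * W i)"
      unfolding bi b_def by (simp add: algebra_simps)
    then have "frob k (r(i := r i + 1)) * (b i + 1) = ?F * W i" by simp
    moreover have "b i + 1 > 0" by (simp add: b_def)
    ultimately have "frob k (r(i := r i + 1)) = ?F * (W i / (b i + 1))" by (simp add: field_simps)
    then show ?thesis unfolding frobenius_formula[OF r'] N K_def by (simp add: mult_ac)
  qed
  \<comment> \<open>No box can be added to a row as long as the one above it; the two beta numbers
    then differ by 1 and a factor of \<open>W i\<close> is zero.\<close>
  have zero: "W i = 0" if "i < k" "i \<notin> ?C" for i
  proof -
    have i: "i > 0" "r i = r (i - 1)"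
      using that r rows_antimono[OF r, of "i - 1" i] by auto
    then have "b i - b (i - 1) = -1" using that by (simp add: b_def beta_def of_nat_diff)
    then show ?thesis unfolding W_def using i that
      by (intro prod_zero) (auto intro!: bexI[of _ "i - 1"])
  qed
  \<comment> \<open>The factor 1 + 1 / (a - b m) vanishes when b m = a + 1, so such an
    \<open>a\<close> is a zero of the product as long as it is not a pole.\<close>
  have pf: "(\<Sum>i<k. W i / (b i - a)) = 1" if a: "a \<notin> b ` {..<k}" "a + 1 \<in> b ` {..<k}" for a
  proof -
    obtain m where m: "m < k" "b m = a + 1" using a(2) by auto
    have "(\<Prod>i<k. 1 + 1 / (a - b i)) = 0" using m by (intro prod_zero bexI[of _ m]) auto
    then have "1 + (\<Sum>i<k. W i / (a - b i)) = 0"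
      using partial_fractions[OF _ inj a(1), of 1] unfolding W_def by simp
    moreover have "(\<Sum>i<k. W i / (a - b i)) = - (\<Sum>i<k. W i / (b i - a))"
      unfolding sum_negf[symmetric] by (rule sum.cong) (auto simp: minus_divide_right)
    ultimately show ?thesis by simp
  qed
  \<comment> \<open>Row \<open>i\<^sub>0\<close> has a removable box, so the next row is strictly
    shorter and the beta numbers skip the value just below \<open>b i\<^sub>0\<close>.\<close>
  have y1: "y - 1 \<notin> b ` {..<k}"
  proof
    assume "y - 1 \<in> b ` {..<k}"
    then obtain j where j: "j < k" "b j = y - 1" by auto
    then have e: "Suc (beta k r j) = beta k r i\<^sub>0" unfolding y_def b_def by linarith
    then have "\<not> j < i\<^sub>0" "j \<noteq> i\<^sub>0" using beta_less[OF r _ ik, of j] by auto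
    then have "r j \<le> r (Suc i\<^sub>0)" "j > i\<^sub>0" using rows_antimono[OF r, of "Suc i\<^sub>0" j] by auto
    then show False using e i0 j(1) unfolding beta_def by linarith
  qed
  have "beta k r (k - 1) = 0" using k by (simp add: beta_def)
  then have "b (k - 1) = -1 + 1" by (simp add: b_def)
  then have "-1 + 1 \<in> b ` {..<k}" using k(1) by (metis imageI lessThan_iff diff_less less_le_trans zero_less_one)
  moreover have "-1 \<notin> b ` {..<k}" by (auto simp: b_def)
  ultimately have s1: "(\<Sum>i<k. W i / (b i + 1)) = 1" using pf[of "-1"] by simp
  have s2: "(\<Sum>i<k. W i / (b i - (y - 1))) = 1" using pf[OF y1] ik by (simp add: y_def)
  have "(\<Sum>i\<in>?C. real (card (Syt (diagram (r(i := r i + 1))))) / ((real (r i) - real i) - (real (r i\<^sub>0) - 1 - real i\<^sub>0))) =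
      (\<Sum>i\<in>?C. K * (W i / (b i + 1) / (b i - (y - 1))))"
  proof (rule sum.cong[OF refl])
    fix i assume i: "i \<in> ?C"
    have "(real (r i) - real i) - (real (r i\<^sub>0) - 1 - real i\<^sub>0) = b i - (y - 1)"
      using i ik unfolding y_def b_def beta_def by (simp add: of_nat_diff)
    then show "real (card (Syt (diagram (r(i := r i + 1))))) / ((real (r i) - real i) - (real (r i\<^sub>0) - 1 - real i\<^sub>0)) =
        K * (W i / (b i + 1) / (b i - (y - 1)))" using step[OF i] by simp
  qed
  also have "\<dots> = (\<Sum>i<k. K * (W i / (b i + 1) / (b i - (y - 1))))"
    by (rule sum.mono_neutral_left) (use zero in auto)
  \<comment> \<open>The two zeros -1 and y - 1 lie at distance y, whence the factor 1 / y; both of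
    the sums being subtracted equal 1.\<close>
  also have "\<dots> = (\<Sum>i<k. K / y * (W i / (b i - (y - 1)) - W i / (b i + 1)))"
  proof (rule sum.cong[OF refl])
    fix i assume "i \<in> {..<k}"
    then have "b i - (y - 1) \<noteq> 0" using y1 by (metis eq_iff_diff_eq_0 imageI)
    moreover have "b i + 1 \<noteq> 0" by (simp add: b_def)
    ultimately show "K * (W i / (b i + 1) / (b i - (y - 1))) = K / y * (W i / (b i - (y - 1)) - W i / (b i + 1))"
      using y by (simp add: divide_simps) algebra
  qed
  also have "\<dots> = K / y * ((\<Sum>i<k. W i / (b i - (y - 1))) - (\<Sum>i<k. W i / (b i + 1)))"
    by (simp only: sum_distrib_left[symmetric] sum_subtractf)
  also have "\<dots> = 0" unfolding s1 s2 by simp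
  finally show ?thesis .
qed

section \<open>Addable and removable boxes\<close>

definition row :: "nat list \<Rightarrow> nat \<Rightarrow> nat" where
  "row lam i = (if i < length lam then lam ! i else 0)"

definition addable :: "nat list \<Rightarrow> nat set" where
  "addable mu = {i. i < length mu + 1 \<and> (i = 0 \<or> row mu i < row mu (i - 1))}"

text \<open>Determined by its row lengths, so that lengthening a row and opening a new one are
  handled alike; \<open>partition_row_inj\<close> makes the description unique.\<close>

definition add_box :: "nat list \<Rightarrow> nat \<Rightarrow> nat list" where
  "add_box mu i = (THE lam. partition_of lam (sum_list mu + 1) \<and> row lam = (row mu)(i := row mu i + 1))"

lemma boxes_diagram: "boxes lam = diagram (row lam)"
  by (auto simp: boxes_def diagram_def row_def split: if_splits)

lemma diagram_inj: assumes "diagram r = diagram s" shows "r = s"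
proof
  fix i
  have "{j. (i, j) \<in> diagram r} = {j. (i, j) \<in> diagram s}" using assms by simp
  then have "{..<r i} = {..<s i}" by (simp add: diagram_def lessThan_def)
  then show "r i = s i" by simp
qed

lemma rows_row:
  assumes "partition_of lam n" "length lam \<le> k"
  shows "rows k (row lam)"
  unfolding rows_def
proof (intro conjI allI impI)
  fix i show "row lam (Suc i) \<le> row lam i"
    using assms sorted_wrt_nth_less[of "(\<ge>)" lam i "Suc i"] by (auto simp: row_def partition_of_def)
next
  fix i assume "k \<le> i" then show "row lam i = 0" using assms by (simp add: row_def)
qed

lemma partition_row_inj:
  assumes "partition_of lam n" "partition_of lam' n'" "row lam = row lam'"
  shows "lam = lam'"
proof -
  have len: "row l i = 0 \<longleftrightarrow> length l \<le> i" if "partition_of l m" for l m i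
  proof (cases "i < length l")
    case True
    then have "l ! i \<noteq> 0" using that unfolding partition_of_def by (metis nth_mem)
    then show ?thesis using True by (simp add: row_def)
  qed (simp add: row_def)
  have "length lam \<le> i \<longleftrightarrow> length lam' \<le> i" for i
    using len[OF assms(1), of i] len[OF assms(2), of i] assms(3) by simp
  then have l: "length lam = length lam'" by (metis le_antisym order_refl)
  show ?thesis
  proof (rule nth_equalityI[OF l])
    fix i assume "i < length lam"
    then show "lam ! i = lam' ! i" using fun_cong[OF assms(3), of i] l by (simp add: row_def)
  qed
qed

lemma partition_exists:
  assumes r: "rows k r"
  shows "\<exists>lam. partition_of lam (\<Sum>i<k. r i) \<and> row lam = r"
proof -
  define m where "m = (LEAST i. r i = 0)"
  have z: "r m = 0" unfolding m_def by (rule LeastI[of _ k]) (use r in \<open>simp add: rows_def\<close>)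
  have nz: "r i \<noteq> 0" if "i < m" for i using not_less_Least[of i "\<lambda>i. r i = 0"] that unfolding m_def by simp
  define lam where "lam = map r [0..<m]"
  have row: "row lam = r"
  proof
    fix i show "row lam i = r i"
      using rows_antimono[OF r, of m i] z by (auto simp: row_def lam_def)
  qed
  have "sum_list lam = (\<Sum>i<k. r i)"
    using card_boxes[of lam] card_diagram[OF r] unfolding boxes_diagram row by simp
  moreover have "sorted_wrt (\<ge>) lam"
    unfolding sorted_wrt_iff_nth_less lam_def using rows_antimono[OF r] by simp
  moreover have "0 \<notin> set lam" using nz by (auto simp: lam_def simp del: neq0_conv)
  ultimately show ?thesis using row unfolding partition_of_def by blast
qed

context
  fixes mu :: "nat list"
  assumes mu: "partition_of mu (sum_list mu)"
begin

lemma rows_mu: "rows (length mu + 1) (row mu)"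
  by (rule rows_row[OF mu]) simp

lemma rows_add: "i \<in> addable mu \<Longrightarrow> rows (length mu + 1) ((row mu)(i := row mu i + 1))"
  by (rule rows_inc[OF rows_mu]) (auto simp: addable_def)

lemma add_box_spec:
  assumes i: "i \<in> addable mu"
  shows "partition_of (add_box mu i) (sum_list mu + 1)" "row (add_box mu i) = (row mu)(i := row mu i + 1)"
proof -
  obtain lam where lam: "partition_of lam (\<Sum>j<length mu + 1. ((row mu)(i := row mu i + 1)) j)"
      "row lam = (row mu)(i := row mu i + 1)"
    using partition_exists[OF rows_add[OF i]] by blast
  have "sum_list lam = card (insert (i, row mu i) (boxes mu))"
    using card_boxes[of lam] unfolding boxes_diagram lam(2) diagram_inc by simp
  also have "\<dots> = sum_list mu + 1"
  proof -
    have "finite (boxes mu)" using young_shape_boxes[OF mu] by (simp add: young_shape_def)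
    moreover have "(i, row mu i) \<notin> boxes mu" by (simp add: boxes_diagram diagram_def)
    ultimately show ?thesis by (simp add: card_boxes)
  qed
  finally have l: "partition_of lam (sum_list mu + 1) \<and> row lam = (row mu)(i := row mu i + 1)"
    using lam by (simp add: partition_of_def)
  have "add_box mu i = lam"
    unfolding add_box_def
  proof (rule the_equality)
    fix l assume "partition_of l (sum_list mu + 1) \<and> row l = (row mu)(i := row mu i + 1)"
    then show "l = lam" using l partition_row_inj[of l _ lam] by auto
  qed (rule l)
  then show "partition_of (add_box mu i) (sum_list mu + 1)" "row (add_box mu i) = (row mu)(i := row mu i + 1)"
    using l by auto
qed

lemma boxes_add_box: "i \<in> addable mu \<Longrightarrow> boxes (add_box mu i) = insert (i, row mu i) (boxes mu)"
  unfolding boxes_diagram add_box_spec diagram_inc ..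

lemma add_box_up: "i \<in> addable mu \<Longrightarrow> add_box mu i \<in> up mu"
  unfolding up_def mem_Collect_eq using add_box_spec(1) boxes_add_box
  by (intro conjI exI[of _ "(i, row mu i)"]) (auto simp: boxes_def row_def)

lemma up_add_box:
  assumes lam: "lam \<in> up mu"
  shows "\<exists>i\<in>addable mu. lam = add_box mu i"
proof -
  obtain i j where p: "(i, j) \<notin> boxes mu" "boxes lam = insert (i, j) (boxes mu)"
    using lam by (auto simp: up_def)
  have part: "partition_of lam (sum_list mu + 1)" using lam by (simp add: up_def)
  have y: "(i', j') \<in> boxes mu" if "i' \<le> i" "j' \<le> j" "(i', j') \<noteq> (i, j)" for i' j'
    using young_shapeD[OF young_shape_boxes[OF part], of i j i' j'] p that by auto
  have "\<not> row mu i < j" using y[of i "row mu i"] by (auto simp: boxes_diagram diagram_def)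
  moreover have "\<not> j < row mu i" using p by (simp add: boxes_diagram diagram_def)
  ultimately have j: "j = row mu i" by simp
  have d: "i = 0 \<or> row mu i < row mu (i - 1)"
    using y[of "i - 1" j] j by (cases "i = 0") (auto simp: boxes_diagram diagram_def)
  moreover have "i < length mu + 1"
  proof (rule ccontr)
    assume "\<not> i < length mu + 1"
    then have "row mu (i - 1) = 0" "i \<noteq> 0" by (auto simp: row_def)
    then show False using d by simp
  qed
  ultimately have i: "i \<in> addable mu" by (simp add: addable_def)
  have "row lam = row (add_box mu i)"
    by (rule diagram_inj) (use boxes_add_box[OF i] p j in \<open>simp add: boxes_diagram\<close>)
  then have "lam = add_box mu i" by (rule partition_row_inj[OF part add_box_spec(1)[OF i]])
  then show ?thesis using i by blast
qed

lemma up_eq: "up mu = add_box mu ` addable mu"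
  using up_add_box add_box_up by blast

lemma add_box_inj: "inj_on (add_box mu) (addable mu)"
proof (rule inj_onI)
  fix i j assume i: "i \<in> addable mu" and j: "j \<in> addable mu" and e: "add_box mu i = add_box mu j"
  have "(i, row mu i) \<in> insert (j, row mu j) (boxes mu)"
    using boxes_add_box[OF i] boxes_add_box[OF j] e by auto
  then show "i = j" by (auto simp: boxes_diagram diagram_def)
qed

lemma add_content_add_box: "i \<in> addable mu \<Longrightarrow> add_content mu (add_box mu i) = int (row mu i) - int i"
proof -
  assume i: "i \<in> addable mu"
  have "boxes (add_box mu i) - boxes mu = {(i, row mu i)}"
    unfolding boxes_add_box[OF i] by (auto simp: boxes_diagram diagram_def)
  then show ?thesis by (simp add: add_content_def)
qed

lemma dim_add_box: "i \<in> addable mu \<Longrightarrow> dim (add_box mu i) = card (Syt (diagram ((row mu)(i := row mu i + 1))))"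
  unfolding dim_def Tab_eq_Syt boxes_diagram by (simp add: add_box_spec)

lemma dim_add_box_pos: "i \<in> addable mu \<Longrightarrow> dim (add_box mu i) > 0"
  using card_Syt_diagram_pos[OF rows_add] dim_add_box by simp

text \<open>The largest entry sits in a removable corner. Conversely, after removing any corner the
  positive Frobenius count provides a tableau of the rest, and the largest entry is put back in the
  corner.\<close>

lemma last_contents:
  assumes pos: "sum_list mu \<ge> 1"
  shows "(\<lambda>R. content_at mu R (sum_list mu)) ` Tab mu =
    (\<lambda>i. int (row mu i) - 1 - int i) ` {i. row mu (Suc i) < row mu i}"
proof (intro subset_antisym subsetI)
  fix x assume "x \<in> (\<lambda>R. content_at mu R (sum_list mu)) ` Tab mu"
  then obtain R where R: "R \<in> Tab mu" "x = content_at mu R (sum_list mu)" by auto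
  obtain i j where ij: "(i, j) \<in> boxes mu" "R (i, j) = sum_list mu"
    using Tab_obtain_box[OF R(1), of "sum_list mu"] pos by auto
  have "young_shape (boxes mu - {(i, j)})"
    by (rule Syt_max_corner[of R]) (use R ij young_shape_boxes[OF mu] in \<open>auto simp: Tab_eq_Syt card_boxes\<close>)
  then have "(i, j) \<in> {p \<in> diagram (row mu). young_shape (diagram (row mu) - {p})}"
    using ij by (simp add: boxes_diagram)
  then have "j = row mu i - 1" "row mu (Suc i) < row mu i"
    unfolding diagram_corners[OF rows_mu] by auto
  moreover have "x = int j - int i" using content_at_eq[OF R(1) ij(1)] R(2) ij(2) by simp
  ultimately show "x \<in> (\<lambda>i. int (row mu i) - 1 - int i) ` {i. row mu (Suc i) < row mu i}"
    by (auto simp: of_nat_diff intro!: image_eqI[of _ _ i])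
next
  fix x assume "x \<in> (\<lambda>i. int (row mu i) - 1 - int i) ` {i. row mu (Suc i) < row mu i}"
  then obtain i where i: "row mu (Suc i) < row mu i" "x = int (row mu i) - 1 - int i" by auto
  define p where "p = (i, row mu i - 1)"
  define r where "r = (row mu)(i := row mu i - 1)"
  have r: "rows (length mu + 1) r" unfolding r_def by (rule rows_dec[OF rows_mu i(1)])
  have d: "boxes mu - {p} = diagram r"
    unfolding boxes_diagram p_def r_def by (rule diagram_dec) (use i in simp)
  have p: "p \<in> boxes mu" unfolding p_def using i by (simp add: boxes_diagram diagram_def)
  then have ins: "insert p (diagram r) = boxes mu" "p \<notin> diagram r" using d by auto
  have fin: "finite (boxes mu)" using young_shape_boxes[OF mu] by (simp add: young_shape_def)
  have c: "Suc (card (diagram r)) = sum_list mu"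
    using card_Suc_Diff1[OF fin p] d card_boxes[of mu] by simp
  obtain R where R: "R \<in> Syt (diagram r)"
    using card_Syt_diagram_pos[OF r] by (metis card.empty ex_in_conv less_numeral_extra(3))
  have T: "R(p := sum_list mu) \<in> Tab mu"
    using Syt_insertI[OF R ins(2) young_shape_diagram[OF r]] young_shape_boxes[OF mu] ins c
    by (simp add: Tab_eq_Syt)
  have "x = content_at mu (R(p := sum_list mu)) (sum_list mu)"
    using content_at_eq[OF T, of i "row mu i - 1"] p i by (simp add: p_def of_nat_diff)
  then show "x \<in> (\<lambda>R. content_at mu R (sum_list mu)) ` Tab mu" using T by blast
qed

theorem isoclinic_partition_rows:
  assumes pos: "sum_list mu \<ge> 1"
  shows "isoclinic_partition mu \<longleftrightarrow>
    (\<exists>M. M \<noteq> {} \<and> M \<subset> addable mu \<and> (\<exists>\<alpha>. \<forall>d. row mu (Suc d) < row mu d \<longrightarrow>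
      (\<Sum>i\<in>M. real (dim (add_box mu i)) /
        ((real (row mu i) - real i) - (real (row mu d) - 1 - real d)))\<^sup>2 = \<alpha>))"
proof -
  let ?g = "\<lambda>L x. \<Sum>lam\<in>L. real (dim lam) / real_of_int (add_content mu lam - x)"
  let ?f = "\<lambda>M d. \<Sum>i\<in>M. real (dim (add_box mu i)) /
        ((real (row mu i) - real i) - (real (row mu d) - 1 - real d))"
  have g: "?g (add_box mu ` M) (int (row mu d) - 1 - int d) = ?f M d" if M: "M \<subseteq> addable mu" for M d
  proof -
    have "?g (add_box mu ` M) (int (row mu d) - 1 - int d) =
        (\<Sum>i\<in>M. real (dim (add_box mu i)) / real_of_int (add_content mu (add_box mu i) - (int (row mu d) - 1 - int d)))"
      by (rule sum.reindex[OF inj_on_subset[OF add_box_inj M], unfolded comp_def])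
    also have "\<dots> = ?f M d"
      by (rule sum.cong[OF refl]) (use M add_content_add_box in auto)
    finally show ?thesis .
  qed
  have fin: "finite (up mu)" unfolding up_eq by (simp add: addable_def)
  have dp: "dim lam > 0" if "lam \<in> up mu" for lam using that dim_add_box_pos unfolding up_eq by auto
  have iff: "isoclinic_partition mu \<longleftrightarrow> (\<exists>L. L \<noteq> {} \<and> L \<subset> up mu \<and>
      (\<exists>\<alpha>. \<forall>R\<in>Tab mu. (?g L (content_at mu R (sum_list mu)))\<^sup>2 = \<alpha>))"
    by (rule isoclinic_partition_iff[OF mu pos fin]) (rule dp)
  have cont: "(\<forall>R\<in>Tab mu. (?g L (content_at mu R (sum_list mu)))\<^sup>2 = \<alpha>) \<longleftrightarrow>
      (\<forall>d. row mu (Suc d) < row mu d \<longrightarrow> (?g L (int (row mu d) - 1 - int d))\<^sup>2 = \<alpha>)" for L \<alpha>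
  proof -
    have "(\<forall>R\<in>Tab mu. (?g L (content_at mu R (sum_list mu)))\<^sup>2 = \<alpha>) \<longleftrightarrow>
        (\<forall>x\<in>(\<lambda>R. content_at mu R (sum_list mu)) ` Tab mu. (?g L x)\<^sup>2 = \<alpha>)" by blast
    then show ?thesis unfolding last_contents[OF pos] by blast
  qed
  have "isoclinic_partition mu \<longleftrightarrow> (\<exists>L. L \<noteq> {} \<and> L \<subset> add_box mu ` addable mu \<and>
      (\<exists>\<alpha>. \<forall>d. row mu (Suc d) < row mu d \<longrightarrow> (?g L (int (row mu d) - 1 - int d))\<^sup>2 = \<alpha>))"
    unfolding iff cont up_eq ..
  also have "\<dots> \<longleftrightarrow> (\<exists>M. M \<noteq> {} \<and> M \<subset> addable mu \<and> (\<exists>\<alpha>. \<forall>d. row mu (Suc d) < row mu d \<longrightarrow> (?f M d)\<^sup>2 = \<alpha>))"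
  proof
    assume "\<exists>L. L \<noteq> {} \<and> L \<subset> add_box mu ` addable mu \<and>
      (\<exists>\<alpha>. \<forall>d. row mu (Suc d) < row mu d \<longrightarrow> (?g L (int (row mu d) - 1 - int d))\<^sup>2 = \<alpha>)"
    then obtain L \<alpha> where L: "L \<noteq> {}" "L \<subset> add_box mu ` addable mu"
      "\<forall>d. row mu (Suc d) < row mu d \<longrightarrow> (?g L (int (row mu d) - 1 - int d))\<^sup>2 = \<alpha>" by blast
    from L(2) obtain M where M: "M \<subseteq> addable mu" "L = add_box mu ` M"
      by (meson psubset_imp_subset subset_imageE)
    have "\<forall>d. row mu (Suc d) < row mu d \<longrightarrow> (?f M d)\<^sup>2 = \<alpha>" using L(3) unfolding M(2) g[OF M(1)] .
    moreover have "M \<noteq> {}" "M \<subset> addable mu" using L(1,2) M by auto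
    ultimately show "\<exists>M. M \<noteq> {} \<and> M \<subset> addable mu \<and> (\<exists>\<alpha>. \<forall>d. row mu (Suc d) < row mu d \<longrightarrow> (?f M d)\<^sup>2 = \<alpha>)"
      by blast
  next
    assume "\<exists>M. M \<noteq> {} \<and> M \<subset> addable mu \<and> (\<exists>\<alpha>. \<forall>d. row mu (Suc d) < row mu d \<longrightarrow> (?f M d)\<^sup>2 = \<alpha>)"
    then obtain M \<alpha> where M: "M \<noteq> {}" "M \<subset> addable mu"
      "\<forall>d. row mu (Suc d) < row mu d \<longrightarrow> (?f M d)\<^sup>2 = \<alpha>" by blast
    have "\<forall>d. row mu (Suc d) < row mu d \<longrightarrow> (?g (add_box mu ` M) (int (row mu d) - 1 - int d))\<^sup>2 = \<alpha>"
      unfolding g[OF psubset_imp_subset[OF M(2)]] by (rule M(3))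
    moreover have "add_box mu ` M \<subset> add_box mu ` addable mu"
      by (rule image_strict_mono[OF add_box_inj M(2)])
    moreover have "add_box mu ` M \<noteq> {}" using M(1) by simp
    ultimately show "\<exists>L. L \<noteq> {} \<and> L \<subset> add_box mu ` addable mu \<and>
      (\<exists>\<alpha>. \<forall>d. row mu (Suc d) < row mu d \<longrightarrow> (?g L (int (row mu d) - 1 - int d))\<^sup>2 = \<alpha>)"
      by (intro exI[of _ "add_box mu ` M"] exI[of _ \<alpha>] conjI)
  qed
  finally show ?thesis .
qed

lemma kerov_equation_partition:
  assumes "row mu (Suc d) < row mu d"
  shows "(\<Sum>i\<in>addable mu. real (dim (add_box mu i)) /
        ((real (row mu i) - real i) - (real (row mu d) - 1 - real d))) = 0"
proof -
  have "row mu (length mu + 1 - 1) = 0" by (simp add: row_def)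
  from kerov_equation[OF rows_mu _ this assms] show ?thesis
    unfolding addable_def[symmetric] by (simp add: dim_add_box)
qed

end

section \<open>The system of equations for five added contents and four corners\<close>

text \<open>Adding the equations at z and -z eliminates \<open>w 2\<close> and leaves a homogeneous
  2 by 2 system in w 0 - w 4 and w 1 - w 3. The coefficient of the first is positive at both y and
  Y, while that of the second changes sign, so both differences vanish.\<close>

lemma transition_weights_symmetric:
  fixes X x Y y :: real and w :: "nat \<Rightarrow> real"
  assumes ord: "0 < y" "y < x" "x < Y" "Y < X"
    and K: "\<forall>z\<in>{Y, y, -y, -Y}. w 0 / (X - z) + w 1 / (x - z) + w 2 / (0 - z) + w 3 / (-x - z) + w 4 / (-X - z) = 0"
  shows "w 4 = w 0" "w 3 = w 1"
proof -
  define p where "p = w 0 - w 4"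
  define q where "q = w 1 - w 3"
  have sum: "p * (1 / (X - z) + 1 / (X + z)) + q * (1 / (x - z) + 1 / (x + z)) = 0"
    if "z \<in> {Y, y}" for z
  proof -
    have e: "w 0 / (X - z) + w 1 / (x - z) + w 2 / (0 - z) + w 3 / (-x - z) + w 4 / (-X - z) = 0"
      "w 0 / (X - (-z)) + w 1 / (x - (-z)) + w 2 / (0 - (-z)) + w 3 / (-x - (-z)) + w 4 / (-X - (-z)) = 0"
      using K that by auto
    have "w 3 / (-x - z) = - (w 3 / (x + z))" "w 4 / (-X - z) = - (w 4 / (X + z))"
      "w 3 / (-x - (-z)) = - (w 3 / (x - z))" "w 4 / (-X - (-z)) = - (w 4 / (X - z))"
      by (simp_all add: minus_divide_right)
    then show ?thesis using e unfolding p_def q_def by (simp add: algebra_simps diff_divide_distrib)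
  qed
  have 1: "1 / (X - y) + 1 / (X + y) > 0" "1 / (x - y) + 1 / (x + y) > 0" "1 / (X - Y) + 1 / (X + Y) > 0"
    using ord by (auto intro!: add_pos_pos)
  have "1 / (x + Y) < 1 / (Y - x)" using ord by (intro divide_strict_left_mono) auto
  moreover have "1 / (x - Y) = - (1 / (Y - x))" using minus_divide_right[of 1 "Y - x"] by simp
  ultimately have 2: "1 / (x - Y) + 1 / (x + Y) < 0" by simp
  have "p = 0 \<and> q = 0"
  proof -
    have s1: "p * (1 / (X - y) + 1 / (X + y)) = - q * (1 / (x - y) + 1 / (x + y))"
      and s2: "p * (1 / (X - Y) + 1 / (X + Y)) = - q * (1 / (x - Y) + 1 / (x + Y))"
      using sum[of y] sum[of Y] by auto
    consider "p > 0" | "p < 0" | "p = 0" by linarith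
    then show ?thesis
    proof cases
      case 1
      then have "- q * (1 / (x - y) + 1 / (x + y)) > 0" "- q * (1 / (x - Y) + 1 / (x + Y)) > 0"
        using s1 s2 \<open>1 / (X - y) + 1 / (X + y) > 0\<close> \<open>1 / (X - Y) + 1 / (X + Y) > 0\<close> by (metis mult_pos_pos)+
      then show ?thesis using \<open>1 / (x - y) + 1 / (x + y) > 0\<close> 2 by (smt (verit) zero_less_mult_iff)
    next
      case 2
      then have "- q * (1 / (x - y) + 1 / (x + y)) < 0" "- q * (1 / (x - Y) + 1 / (x + Y)) < 0"
        using s1 s2 \<open>1 / (X - y) + 1 / (X + y) > 0\<close> \<open>1 / (X - Y) + 1 / (X + Y) > 0\<close> by (metis mult_neg_pos)+
      then show ?thesis using \<open>1 / (x - y) + 1 / (x + y) > 0\<close> \<open>1 / (x - Y) + 1 / (x + Y) < 0\<close>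
        by (smt (verit) mult_less_0_iff)
    next
      case 3
      then show ?thesis using s1 \<open>1 / (x - y) + 1 / (x + y) > 0\<close> by simp
    qed
  qed
  then show "w 4 = w 0" "w 3 = w 1" by (auto simp: p_def q_def)
qed

text \<open>\<open>v\<close> is the common weight of the added contents x and -x. Selecting just
  these two gives the left side as the value at the corner y and the right side as minus the value
  at Y.\<close>

lemma balanced_pair_iff:
  fixes x Y y v :: real
  assumes "0 < y" "y < x" "x < Y" "v > 0"
  shows "v / (x - y) - v / (x + y) = v / (Y - x) + v / (Y + x) \<longleftrightarrow> x\<^sup>2 = y * Y"
proof -
  have 1: "v / (x - y) - v / (x + y) = 2 * v * y / ((x - y) * (x + y))"
    using assms by (simp add: field_simps)
  have 2: "v / (Y - x) + v / (Y + x) = 2 * v * Y / ((Y - x) * (Y + x))"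
    using assms by (simp add: field_simps)
  have pos: "(x - y) * (x + y) > 0" "(Y - x) * (Y + x) > 0" using assms by auto
  have "2 * v * y / ((x - y) * (x + y)) = 2 * v * Y / ((Y - x) * (Y + x)) \<longleftrightarrow>
      2 * v * y * ((Y - x) * (Y + x)) = 2 * v * Y * ((x - y) * (x + y))"
    using pos by (subst frac_eq_eq) auto
  also have "\<dots> \<longleftrightarrow> 2 * v * (Y + y) * (y * Y - x\<^sup>2) = 0"
    by (simp add: algebra_simps power2_eq_square)
  also have "\<dots> \<longleftrightarrow> x\<^sup>2 = y * Y" using assms by auto
  finally show ?thesis unfolding 1 2 .
qed

definition pick :: "bool \<Rightarrow> real \<Rightarrow> real" where
  "pick p u = (if p then u else 0)"

text \<open>Five Booleans, for the added contents X, x, 0, -x, -X in this order, replace the subset,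
  which turns the exclusion of selections into a finite case analysis over linear
  inequalities.\<close>

lemma isoclinic_selection_iff:
  fixes X x Y y :: real and w :: "nat \<Rightarrow> real"
  assumes ord: "0 < y" "y < x" "x < Y" "Y < X" and w: "\<And>i. i \<le> 4 \<Longrightarrow> w i > 0"
    and K: "\<forall>z\<in>{Y, y, -y, -Y}. w 0 / (X - z) + w 1 / (x - z) + w 2 / (0 - z) + w 3 / (-x - z) + w 4 / (-X - z) = 0"
  shows "(\<exists>s. (s 0 \<or> s 1 \<or> s 2 \<or> s 3 \<or> s (4::nat)) \<and> \<not> (s 0 \<and> s 1 \<and> s 2 \<and> s 3 \<and> s 4) \<and>
      (\<exists>\<alpha>. \<forall>z\<in>{Y, y, -y, -Y}. (pick (s 0) (w 0 / (X - z)) + pick (s 1) (w 1 / (x - z)) +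
        pick (s 2) (w 2 / (0 - z)) + pick (s 3) (w 3 / (-x - z)) + pick (s 4) (w 4 / (-X - z)))\<^sup>2 = \<alpha>)) \<longleftrightarrow>
    x\<^sup>2 = y * Y" (is "?L \<longleftrightarrow> ?R")
proof -
  note sym = transition_weights_symmetric[OF ord K]
  \<comment> \<open>By the symmetry of the weights these ten positive quotients are, up to sign, all
    the summands that occur at the four corners.\<close>
  define A where "A = w 0 / (X - y)"
  define A' where "A' = w 0 / (X + y)"
  define B where "B = w 1 / (x - y)"
  define B' where "B' = w 1 / (x + y)"
  define C where "C = w 0 / (X - Y)"
  define C' where "C' = w 0 / (X + Y)"
  define E where "E = w 1 / (Y - x)"
  define E' where "E' = w 1 / (Y + x)"
  define G where "G = w 2 / y"
  define G' where "G' = w 2 / Y"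
  have w': "w 0 > 0" "w 1 > 0" "w 2 > 0" using w by auto
  have less: "A' < A" "0 < A'" "B' < B" "0 < B'" "A < C" "C' < A'" "0 < C'" "E' < B'" "0 < E'" "0 < E"
    "G' < G" "0 < G'"
    unfolding A_def A'_def B_def B'_def C_def C'_def E_def E'_def G_def G'_def
    using ord w' by (auto intro!: divide_strict_left_mono mult_pos_pos)
  have neg: "u / (- a - b) = - (u / (a + b))" "u / (- a - - b) = - (u / (a - b))" for u a b :: real
    using minus_divide_right[of u "a + b"] minus_divide_right[of u "a - b"] by simp_all
  have EY: "w 1 / (x - Y) = - E" unfolding E_def using minus_divide_right[of "w 1" "Y - x"] by simp
  have sy: "x + Y = Y + x" by simp
  define F where "F s z = pick (s 0) (w 0 / (X - z)) + pick (s 1) (w 1 / (x - z)) +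
        pick (s 2) (w 2 / (0 - z)) + pick (s 3) (w 3 / (-x - z)) + pick (s 4) (w 4 / (-X - z))" for s :: "nat \<Rightarrow> bool" and z
  have Fy: "F s y = pick (s 0) A + pick (s 1) B - pick (s 2) G - pick (s 3) B' - pick (s 4) A'" for s
    unfolding F_def sym neg A_def B_def G_def B'_def A'_def by (simp add: pick_def)
  have Fmy: "F s (-y) = pick (s 0) A' + pick (s 1) B' + pick (s 2) G - pick (s 3) B - pick (s 4) A" for s
    unfolding F_def sym neg A_def B_def G_def B'_def A'_def by (simp add: pick_def)
  have FY: "F s Y = pick (s 0) C - pick (s 1) E - pick (s 2) G' - pick (s 3) E' - pick (s 4) C'" for s
    unfolding F_def sym neg EY C_def G'_def E'_def C'_def sy by (simp add: pick_def)
  have FmY: "F s (-Y) = pick (s 0) C' + pick (s 1) E' + pick (s 2) G' + pick (s 3) E - pick (s 4) C" for s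
    unfolding F_def sym neg EY C_def G'_def E'_def C'_def by (simp add: pick_def EY[unfolded One_nat_def] sy)
  have K': "C - E - G' - E' - C' = 0" "A + B - G - B' - A' = 0" "A' + B' + G - B - A = 0"
    "C' + E' + G' + E - C = 0"
  proof -
    have all: "F (\<lambda>_. True) z = 0" if "z \<in> {Y, y, -y, -Y}" for z
      unfolding F_def pick_def using bspec[OF K that] by simp
    show "C - E - G' - E' - C' = 0" "A + B - G - B' - A' = 0" "A' + B' + G - B - A = 0"
      "C' + E' + G' + E - C = 0"
      using all[of Y] all[of y] all[of "-y"] all[of "-Y"] unfolding FY Fy Fmy FmY pick_def by auto
  qed
  have bal: "B - B' = E + E' \<longleftrightarrow> ?R"
    unfolding B_def B'_def E_def E'_def by (rule balanced_pair_iff[OF ord(1-3) w'(2)])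
  have main: ?R if s2: "\<not> s 2" and some: "s 0 \<or> s 1 \<or> s 3 \<or> s 4"
    and e: "(F s y)\<^sup>2 = (F s (-y))\<^sup>2" "(F s Y)\<^sup>2 = (F s y)\<^sup>2" "(F s (-Y))\<^sup>2 = (F s y)\<^sup>2" for s
  proof -
    have e1: "F s y = F s (-y) \<or> F s y = - F s (-y)" and e2: "F s Y = F s y \<or> F s Y = - F s y"
      and e3: "F s (-Y) = F s y \<or> F s (-Y) = - F s y"
      using e by (auto simp: power2_eq_iff)
    \<comment> \<open>Equal squares leave a sign at each of -y, Y and -Y. For the other fourteen
      nonempty selections avoiding content 0, the orderings in \<open>less\<close> and two of
      Kerov's equations contradict every choice of signs.\<close>
    have "s 1 \<and> s 3 \<and> \<not> s 0 \<and> \<not> s 4"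
      using e1 e2 e3 some s2 less K'(1,2) unfolding Fy Fmy FY FmY pick_def by (smt (verit))
    \<comment> \<open>The value at Y is negative and the value at y is positive, so the two are
      opposite rather than equal.\<close>
    then have "B - B' = E + E'" using e2 s2 less unfolding Fy FY pick_def by auto
    then show ?R using bal by simp
  qed
  have compl: "F (\<lambda>i. \<not> s i) z = - F s z" if "z \<in> {Y, y, -y, -Y}" for s z
  proof -
    have not: "pick (\<not> p) u = u - pick p u" for p u by (simp add: pick_def)
    show ?thesis using bspec[OF K that] unfolding F_def not by linarith
  qed
  show ?thesis
  proof
    assume ?L
    then have "\<exists>s. (s 0 \<or> s 1 \<or> s 2 \<or> s 3 \<or> s 4) \<and> \<not> (s 0 \<and> s 1 \<and> s 2 \<and> s 3 \<and> s 4) \<and>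
        (\<exists>\<alpha>. \<forall>z\<in>{Y, y, -y, -Y}. (F s z)\<^sup>2 = \<alpha>)"
      unfolding F_def .
    then obtain s \<alpha> where s: "s 0 \<or> s 1 \<or> s 2 \<or> s 3 \<or> s 4" "\<not> (s 0 \<and> s 1 \<and> s 2 \<and> s 3 \<and> s 4)"
      and \<alpha>: "\<forall>z\<in>{Y, y, -y, -Y}. (F s z)\<^sup>2 = \<alpha>"
      by (elim exE conjE) (rule that)
    show ?R
    proof (cases "s 2")
      case False
      then show ?thesis using main[of s] s \<alpha> by auto
    next
      case True
      then show ?thesis using main[of "\<lambda>i. \<not> s i"] s \<alpha> compl[of y s] compl[of "-y" s] compl[of Y s] compl[of "-Y" s] by auto
    qed
  next
    assume ?R
    then have b: "B - B' = E + E'" using bal by simp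
    define s where "s i \<longleftrightarrow> i = 1 \<or> i = (3::nat)" for i
    have "F s y = B - B'" "F s (-y) = - (B - B')" "F s Y = - (B - B')" "F s (-Y) = B - B'"
      using b unfolding Fy Fmy FY FmY by (auto simp: s_def pick_def)
    then have "\<forall>z\<in>{Y, y, -y, -Y}. (F s z)\<^sup>2 = (B - B')\<^sup>2" by (auto simp: power2_commute)
    then have "(s 0 \<or> s 1 \<or> s 2 \<or> s 3 \<or> s 4) \<and> \<not> (s 0 \<and> s 1 \<and> s 2 \<and> s 3 \<and> s 4) \<and>
      (\<exists>\<alpha>. \<forall>z\<in>{Y, y, -y, -Y}. (F s z)\<^sup>2 = \<alpha>)" by (auto simp: s_def)
    then show ?L unfolding F_def by (rule exI[of _ s])
  qed
qed

section \<open>The four-block partition\<close>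

lemma row_block_partition:
  assumes "\<mu> = replicate a (a + b + c + e) @ replicate b (a + b + c) @ replicate c (a + b) @ replicate e a"
  shows "row \<mu> i = (if i < a then a + b + c + e else if i < a + b then a + b + c
    else if i < a + b + c then a + b else if i < a + b + c + e then a else 0)"
  unfolding assms row_def by (auto simp: nth_append)

theorem theorem6p13:
  fixes a b c e :: nat and \<mu> :: "nat list"
  assumes "a > 0" and "b > 0" and "c > 0" and "e > 0"
    and "\<mu> = replicate a (a + b + c + e) @ replicate b (a + b + c) @
             replicate c (a + b) @ replicate e a"
  shows "isoclinic_partition \<mu> \<longleftrightarrow> real e = (real b)\<^sup>2 / real c + real b"
proof -
  note row = row_block_partition[OF assms(5)]
  have sum: "sum_list \<mu> = a * (a + b + c + e) + b * (a + b + c) + c * (a + b) + e * a"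
    using partition_of_block_partition[OF assms(1-4)] assms(5) by (simp add: partition_of_def)
  then have mu: "partition_of \<mu> (sum_list \<mu>)"
    using partition_of_block_partition[OF assms(1-4)] assms(5) by simp
  have pos: "sum_list \<mu> \<ge> 1" using sum assms(1) by (simp add: Suc_le_eq)
  have len: "length \<mu> = a + b + c + e" using assms(5) by simp
  \<comment> \<open>The rows that accept a new box, from top to bottom, so that their contents
    appear in the order X, x, 0, -x, -X.\<close>
  define q where "q k = (if k = 0 then 0 else if k = 1 then a else if k = 2 then a + b
    else if k = 3 then a + b + c else a + b + c + e)" for k :: nat
  have addable: "addable \<mu> = {q 0, q 1, q 2, q 3, q 4}"
    unfolding addable_def len row q_def using assms(1-4) by (auto split: if_splits)
  have distinct: "distinct [q 0, q 1, q 2, q 3, q 4]" unfolding q_def using assms(1-4) by simp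
  define X where "X = real (a + b + c + e)"
  define x where "x = real (b + c)"
  define Y where "Y = real (b + c + e)"
  define y where "y = real c"
  have ord: "0 < y" "y < x" "x < Y" "Y < X" unfolding X_def x_def Y_def y_def using assms(1-4) by auto
  have removable: "{d. row \<mu> (Suc d) < row \<mu> d} = {a - 1, a + b - 1, a + b + c - 1, a + b + c + e - 1}"
    unfolding row using assms(1-4) by (auto split: if_splits)
  have last_content: "real (row \<mu> (a - 1)) - 1 - real (a - 1) = Y"
    "real (row \<mu> (a + b - 1)) - 1 - real (a + b - 1) = y"
    "real (row \<mu> (a + b + c - 1)) - 1 - real (a + b + c - 1) = - y"
    "real (row \<mu> (a + b + c + e - 1)) - 1 - real (a + b + c + e - 1) = - Y"
    unfolding row Y_def y_def using assms(1-4) by (auto simp: of_nat_diff)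
  have "(\<lambda>d. real (row \<mu> d) - 1 - real d) ` {d. row \<mu> (Suc d) < row \<mu> d} = {Y, y, -y, -Y}"
    unfolding removable image_insert image_empty last_content ..
  then have corners: "(\<forall>d. row \<mu> (Suc d) < row \<mu> d \<longrightarrow> P (real (row \<mu> d) - 1 - real d)) \<longleftrightarrow>
      (\<forall>z\<in>{Y, y, -y, -Y}. P z)" for P
    by (metis (mono_tags, lifting) imageE image_eqI mem_Collect_eq)
  define w where "w k = real (dim (add_box \<mu> (q k)))" for k
  have w: "w k > 0" if "k \<le> 4" for k
  proof -
    have "k = 0 \<or> k = 1 \<or> k = 2 \<or> k = 3 \<or> k = 4" using that by linarith
    then have "q k \<in> addable \<mu>" unfolding addable by auto
    then show ?thesis unfolding w_def using dim_add_box_pos[OF mu] by simp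
  qed
  let ?S = "\<lambda>M z. \<Sum>i\<in>M. real (dim (add_box \<mu> i)) / ((real (row \<mu> i) - real i) - z)"
  let ?F = "\<lambda>s z. pick (s 0) (w 0 / (X - z)) + pick (s 1) (w 1 / (x - z)) +
        pick (s 2) (w 2 / (0 - z)) + pick (s 3) (w 3 / (-x - z)) + pick (s 4) (w 4 / (-X - z))"
  have content: "real (row \<mu> (q 0)) - real (q 0) = X" "real (row \<mu> (q 1)) - real (q 1) = x"
    "real (row \<mu> (q 2)) - real (q 2) = 0" "real (row \<mu> (q 3)) - real (q 3) = - x"
    "real (row \<mu> (q 4)) - real (q 4) = - X"
    unfolding row q_def X_def x_def using assms(1-4) by auto
  have S: "?S M z = ?F (\<lambda>k. q k \<in> M) z" if "M \<subseteq> addable \<mu>" for M z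
  proof -
    have "?S M z = (\<Sum>i\<in>addable \<mu>. pick (i \<in> M) (real (dim (add_box \<mu> i)) / ((real (row \<mu> i) - real i) - z)))"
      unfolding pick_def using that by (intro sum.mono_neutral_cong_left) (auto simp: addable)
    also have "\<dots> = ?F (\<lambda>k. q k \<in> M) z"
      unfolding addable using distinct content by (simp add: w_def)
    finally show ?thesis .
  qed
  have K: "\<forall>z\<in>{Y, y, -y, -Y}. w 0 / (X - z) + w 1 / (x - z) + w 2 / (0 - z) + w 3 / (-x - z) + w 4 / (-X - z) = 0"
  proof -
    have "\<forall>z\<in>{Y, y, -y, -Y}. ?S (addable \<mu>) z = 0"
      unfolding corners[symmetric] using kerov_equation_partition[OF mu] by blast
    moreover have "?S (addable \<mu>) z = w 0 / (X - z) + w 1 / (x - z) + w 2 / (0 - z) + w 3 / (-x - z) + w 4 / (-X - z)" for z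
      unfolding S[OF order_refl] by (simp add: addable pick_def)
    ultimately show ?thesis by (simp only:)
  qed
  have "isoclinic_partition \<mu> \<longleftrightarrow> (\<exists>M. M \<noteq> {} \<and> M \<subset> addable \<mu> \<and> (\<exists>\<alpha>. \<forall>z\<in>{Y, y, -y, -Y}. (?S M z)\<^sup>2 = \<alpha>))"
    unfolding isoclinic_partition_rows[OF mu pos] corners[symmetric] ..
  also have "\<dots> \<longleftrightarrow> (\<exists>s. (s 0 \<or> s 1 \<or> s 2 \<or> s 3 \<or> s (4::nat)) \<and> \<not> (s 0 \<and> s 1 \<and> s 2 \<and> s 3 \<and> s 4) \<and>
      (\<exists>\<alpha>. \<forall>z\<in>{Y, y, -y, -Y}. (?F s z)\<^sup>2 = \<alpha>))" (is "?A \<longleftrightarrow> ?B")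
  proof
    assume ?A
    then obtain M where M: "M \<noteq> {}" "M \<subset> addable \<mu>" "\<exists>\<alpha>. \<forall>z\<in>{Y, y, -y, -Y}. (?S M z)\<^sup>2 = \<alpha>"
      by (rule exE, elim conjE) (rule that)
    show ?B
    proof (intro exI[of _ "\<lambda>k. q k \<in> M"] conjI)
      show "q 0 \<in> M \<or> q 1 \<in> M \<or> q 2 \<in> M \<or> q 3 \<in> M \<or> q 4 \<in> M"
        and "\<not> (q 0 \<in> M \<and> q 1 \<in> M \<and> q 2 \<in> M \<and> q 3 \<in> M \<and> q 4 \<in> M)"
        using M(1,2) unfolding addable by auto
      show "\<exists>\<alpha>. \<forall>z\<in>{Y, y, -y, -Y}. (?F (\<lambda>k. q k \<in> M) z)\<^sup>2 = \<alpha>"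
        using M(3) unfolding S[OF psubset_imp_subset[OF M(2)]] .
    qed
  next
    assume ?B
    then obtain s where s: "s 0 \<or> s 1 \<or> s 2 \<or> s 3 \<or> s (4::nat)" "\<not> (s 0 \<and> s 1 \<and> s 2 \<and> s 3 \<and> s 4)"
      "\<exists>\<alpha>. \<forall>z\<in>{Y, y, -y, -Y}. (?F s z)\<^sup>2 = \<alpha>"
      by (rule exE, elim conjE) (rule that)
    define M where "M = q ` {k. k \<le> 4 \<and> s k}"
    have le4: "k \<le> 4 \<longleftrightarrow> k = 0 \<or> k = 1 \<or> k = 2 \<or> k = 3 \<or> k = 4" for k :: nat by linarith
    have in_M: "q 0 \<in> M \<longleftrightarrow> s 0" "q 1 \<in> M \<longleftrightarrow> s 1" "q 2 \<in> M \<longleftrightarrow> s 2" "q 3 \<in> M \<longleftrightarrow> s 3" "q 4 \<in> M \<longleftrightarrow> s 4"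
    proof -
      have "k = l" if "k \<le> 4" "l \<le> 4" "q k = q l" for k l
        using that assms(1-4) unfolding q_def by (auto split: if_splits)
      then have "q k \<in> M \<longleftrightarrow> s k" if "k \<le> 4" for k unfolding M_def using that by blast
      from this[of 0] this[of 1] this[of 2] this[of 3] this[of 4]
      show "q 0 \<in> M \<longleftrightarrow> s 0" "q 1 \<in> M \<longleftrightarrow> s 1" "q 2 \<in> M \<longleftrightarrow> s 2" "q 3 \<in> M \<longleftrightarrow> s 3" "q 4 \<in> M \<longleftrightarrow> s 4"
        by simp_all
    qed
    have sub: "M \<subseteq> addable \<mu>" unfolding M_def addable le4 by auto
    have "M \<noteq> {}" using s(1) in_M by auto
    moreover have "M \<subset> addable \<mu>" using sub s(2) in_M unfolding addable by auto
    moreover have "\<exists>\<alpha>. \<forall>z\<in>{Y, y, -y, -Y}. (?S M z)\<^sup>2 = \<alpha>" unfolding S[OF sub] in_M by (rule s(3))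
    ultimately show ?A by (intro exI[of _ M] conjI)
  qed
  also have "\<dots> \<longleftrightarrow> x\<^sup>2 = y * Y" by (rule isoclinic_selection_iff[OF ord w K])
  \<comment> \<open>Cancelling b c + c^2 in (b + c)^2 = c (b + c + e) leaves b^2 + b c = c e, to be
    divided by c.\<close>
  also have "\<dots> \<longleftrightarrow> real e = (real b)\<^sup>2 / real c + real b"
    unfolding x_def y_def Y_def using assms(3) by (auto simp: field_simps power2_eq_square)
  finally show ?thesis .
qed

end
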